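(* Let $T$ be a Calderón–Zygmund operator in $\mathbb{R}^n$. Given $p$, $1<p<\infty$, with $p'=p/(p-1)$, let $A$ and $B$ be two Young functions such that $\bar A\in B_{p'}$ and $\bar B\in B_p$. If a couple of weights $(u,v)$ on $\mathbb{R}^n$ satisfies $$\sup_Q\|u^{1/p}\|_{A,Q}\,\|v^{-1/p}\|_{B,Q}<\infty$$ (supremum over all cubes $Q\subset\mathbb{R}^n$), then $$\|Tf\|_{L^p(u)}\le c\|f\|_{L^p(v)},$$ with a constant $c$ independent of $f$.
   Context: This is the "two-weight conjecture" of D. Cruz-Uribe and C. Pérez; the paper in which it is stated asserts that it follows, in full generality, from that paper's results. A weight is a non-negative locally integrable function on $\mathbb{R}^n$; $\|f\|_{L^p(w)}=(\int|f|^pw\,dx)^{1/p}$. Calderón–Zygmund operator: an $L^2(\mathbb{R}^n)$-bounded integral operator $T$ with kernel $K$ satisfying, for some constant $c$: (i) $|K(x,y)|\le \frac{c}{|x-y|^n}$ for all $x\ne y$; (ii) there exists $0<\delta\le 1$ such that $|K(x,y)-K(x',y)|+|K(y,x)-K(y,x')|\le c\frac{|x-x'|^{\delta}}{|x-y|^{n+\delta}}$ whenever $|x-x'|<|x-y|/2$. For a Young function $A$, $\bar A$ denotes its complementary Young function, $L^A$ is the Orlicz space equipped with the Luxemburg norm, and for a cube $Q$ with sidelength $\ell_Q$, $\|f\|_{A,Q}=\|(f\chi_Q)(\ell_Q\,\cdot)\|_{L^A}$, i.e. $\|f\|_{A,Q}=\inf\{\lambda>0:\frac1{|Q|}\int_QA(|f|/\lambda)\,dx\le1\}$.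 A Young function $A$ satisfies the $B_p$ condition, written $A\in B_p$, if for some $c>0$, $\int_c^{\infty}\frac{A(t)}{t^p}\frac{dt}{t}<\infty$. *)

theory Defs
  imports "HOL-Analysis.Analysis"
begin

definition weight :: "(real^'n \<Rightarrow> real) \<Rightarrow> bool" where
  "weight w \<longleftrightarrow> (\<forall>x. 0 \<le> w x) \<and> (\<forall>C. compact C \<longrightarrow> w absolutely_integrable_on C)"

definition Lp_norm :: "real \<Rightarrow> (real^'n \<Rightarrow> real) \<Rightarrow> (real^'n \<Rightarrow> complex) \<Rightarrow> ennreal" where
  "Lp_norm p w f =
    (let I = \<integral>\<^sup>+x. ennreal (norm (f x) powr p * w x) \<partial>lebesgue
     in if I = \<infinity> then \<infinity> else ennreal (enn2real I powr (1 / p)))"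

definition in_L2 :: "(real^'n \<Rightarrow> complex) \<Rightarrow> bool" where
  "in_L2 f \<longleftrightarrow> f \<in> borel_measurable lebesgue \<and> Lp_norm 2 (\<lambda>_. 1) f < \<infinity>"

definition standard_kernel :: "(real^'n \<Rightarrow> real^'n \<Rightarrow> complex) \<Rightarrow> bool" where
  "standard_kernel K \<longleftrightarrow>
    (\<exists>c :: real.
      (\<forall>x y. x \<noteq> y \<longrightarrow> norm (K x y) \<le> c / norm (x - y) ^ CARD('n)) \<and>
      (\<exists>\<delta>. 0 < \<delta> \<and> \<delta> \<le> 1 \<and>
        (\<forall>x x' y. norm (x - x') < norm (x - y) / 2 \<longrightarrow>
          norm (K x y - K x' y) + norm (K y x - K y x')
            \<le> c * (norm (x - x') powr \<delta> / norm (x - y) powr (real CARD('n) + \<delta>)))))"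

text \<open>Operators act on representatives of classes of functions modulo null sets. Linearity and
  boundedness together imply that the class of \<open>T f\<close> depends only on the class of \<open>f\<close>.\<close>

definition L2_bounded_operator ::
    "((real^'n \<Rightarrow> complex) \<Rightarrow> (real^'n \<Rightarrow> complex)) \<Rightarrow> bool" where
  "L2_bounded_operator T \<longleftrightarrow>
    (\<forall>f. in_L2 f \<longrightarrow> in_L2 (T f)) \<and>
    (\<forall>f g. in_L2 f \<longrightarrow> in_L2 g \<longrightarrow>
      (AE x in lebesgue. T (\<lambda>y. f y + g y) x = T f x + T g x)) \<and>
    (\<forall>a f. in_L2 f \<longrightarrow> (AE x in lebesgue. T (\<lambda>y. a * f y) x = a * T f x)) \<and>
    (\<exists>C :: real. \<forall>f. in_L2 f \<longrightarrow>
      Lp_norm 2 (\<lambda>_. 1) (T f) \<le> ennreal C * Lp_norm 2 (\<lambda>_. 1) f)"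

text \<open>As usual for singular integrals, the kernel represents the operator off the support of
  the argument only. For a standard kernel the integral there converges absolutely.\<close>

definition has_kernel ::
    "((real^'n \<Rightarrow> complex) \<Rightarrow> (real^'n \<Rightarrow> complex)) \<Rightarrow> (real^'n \<Rightarrow> real^'n \<Rightarrow> complex) \<Rightarrow> bool"
  where
  "has_kernel T K \<longleftrightarrow>
    (\<forall>f. in_L2 f \<longrightarrow> compact (closure {y. f y \<noteq> 0}) \<longrightarrow>
      (AE x in lebesgue. x \<notin> closure {y. f y \<noteq> 0} \<longrightarrow>
        T f x = (\<integral>y. K x y * f y \<partial>lebesgue)))"

definition calderon_zygmund_operator ::
    "((real^'n \<Rightarrow> complex) \<Rightarrow> (real^'n \<Rightarrow> complex)) \<Rightarrow> bool" where
  "calderon_zygmund_operator T \<longleftrightarrow>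
    L2_bounded_operator T \<and> (\<exists>K. standard_kernel K \<and> has_kernel T K)"

text \<open>Young functions may take the value \<open>\<infinity>\<close> (the Bennett--Sharpley convention), which covers
  \<open>L\<^sup>\<infinity>\<close>. A finite-valued Young function on \<open>[0,\<infinity>)\<close> is the special case in which \<open>A t = \<infinity>\<close>
  only for \<open>t = \<infinity>\<close>.\<close>

definition young_function :: "(ennreal \<Rightarrow> ennreal) \<Rightarrow> bool" where
  "young_function A \<longleftrightarrow>
    A 0 = 0 \<and> mono A \<and>
    (\<forall>a b s t. a + b = 1 \<longrightarrow> A (a * s + b * t) \<le> a * A s + b * A t) \<and>
    (\<forall>t>0. continuous (at_left t) A) \<and>
    (\<exists>t. 0 < t \<and> t < \<infinity> \<and> A t < \<infinity>) \<and>
    (\<exists>t<\<infinity>. 0 < A t)"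

text \<open>The truncation of subtraction at \<open>0\<close> is harmless, since \<open>t = 0\<close> contributes the value
  \<open>0\<close> to the supremum anyway.\<close>

definition complementary :: "(ennreal \<Rightarrow> ennreal) \<Rightarrow> ennreal \<Rightarrow> ennreal" where
  "complementary A s = (SUP t\<in>{t. t < \<infinity>}. s * t - A t)"

definition Bp_condition :: "real \<Rightarrow> (ennreal \<Rightarrow> ennreal) \<Rightarrow> bool" where
  "Bp_condition p A \<longleftrightarrow>
    (\<exists>c::real. 0 < c \<and>
      (\<integral>\<^sup>+t\<in>{c<..}. A (ennreal t) / ennreal (t powr p) / ennreal t \<partial>lborel) < \<infinity>)"

definition cubes :: "(real^'n) set set" where
  "cubes = {cbox a (\<chi> i. a $ i + l) | a l. 0 < l}"

text \<open>The argument is \<open>[0,\<infinity>]\<close>-valued because \<open>v\<^sup>-\<^sup>1\<^sup>/\<^sup>p\<close> is infinite where \<open>v\<close> vanishes, whereas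
  \<open>0 powr (- 1 / p) = 0\<close>. The infimum of the empty set is \<open>\<infinity>\<close>.\<close>

definition luxemburg_avg ::
    "(ennreal \<Rightarrow> ennreal) \<Rightarrow> (real^'n) set \<Rightarrow> (real^'n \<Rightarrow> ennreal) \<Rightarrow> ennreal" where
  "luxemburg_avg A Q f =
    Inf {ennreal l | l. 0 < l \<and>
      (\<integral>\<^sup>+x\<in>Q. A (f x / ennreal l) \<partial>lebesgue) / emeasure lebesgue Q \<le> 1}"

end

(*
  Local domination in the manner of Lerner and Ombrosi. By the weak type (1,1) bounds of T and of the
  maximal function, on a dyadic cube Q the function |T(f 1_Q')| (Q' a fixed dilate of Q) is at most
  C avg_Q' |f| off a disjoint family of dyadic subcubes P of total measure at most |Q|/2; on each P,
  smoothness of the kernel bounds it by C avg_Q' |f| + |T(f 1_P')|. The cubes left over in Q after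
  removing the P carry at least half of |Q|, so Hoelder's inequality for Orlicz averages and the bump
  condition bound the pairing of the first term with a weight g u^(1/p) by
  the integral of M_1(|f| v^(1/p)) M_2(g) over that remainder, where M_1, M_2 are the dyadic Orlicz
  maximal functions of the complements of B and A. Iterating, these remainders are disjoint, so
  the whole pairing is bounded by the integral of M_1(|f| v^(1/p)) M_2(g) over Q. The B_p conditions
  bound M_1 on L^p and M_2 on L^p', and g = |Tf|^(p-1) u^(1-1/p), truncated, closes the estimate by
  absorption.
*)
theory Submission
  imports Defs
begin

section \<open>Covering and tail estimates\<close>

text \<open>The comparison on a subcube P rests on a single good point. The part T(f 1_(Q' - P')) is
  the difference of T(f 1_Q') and T(f 1_P'), so it is bounded at any point of P where both of these
  are under control; if the centred averages of f 1_Q' are controlled there too, smoothness spreads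
  the bound over P. Such a point exists only if the exceptional sets leave enough of P free. The
  stopping rule must therefore keep their density in each P at most one half and, at the same time,
  the total measure of the P at most |Q|/2.

  The iteration never ends. After N rounds Q is treated up to a set of measure at most |Q|/2^N, with
  a constant free of N; Borel-Cantelli and Fatou remove that set.

  Absorption needs a finite quantity, and u is only locally integrable. This is why |Tf| is cut at a
  height k and integrated over one root cube of side L. The constants depend neither on k nor on L,
  so both can tend to infinity at the end.\<close>

lemma nn_integral_disjoint_UN:
  fixes f :: "'a \<Rightarrow> ennreal"
  assumes "countable I" "disjoint_family_on A I" "\<And>i. i \<in> I \<Longrightarrow> A i \<in> sets M" "f \<in> borel_measurable M"
  shows "(\<integral>\<^sup>+x\<in>(\<Union>i\<in>I. A i). f x \<partial>M) = (\<integral>\<^sup>+i. (\<integral>\<^sup>+x\<in>A i. f x \<partial>M) \<partial>count_space I)"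
proof -
  have "emeasure (density M f) (\<Union>i\<in>I. A i) = (\<integral>\<^sup>+i. emeasure (density M f) (A i) \<partial>count_space I)"
    by (rule emeasure_UN_countable) (use assms in auto)
  moreover have "emeasure (density M f) (\<Union>i\<in>I. A i) = (\<integral>\<^sup>+x\<in>(\<Union>i\<in>I. A i). f x \<partial>M)"
    using assms by (intro emeasure_density) auto
  moreover have "(\<integral>\<^sup>+i. emeasure (density M f) (A i) \<partial>count_space I)
      = (\<integral>\<^sup>+i. (\<integral>\<^sup>+x\<in>A i. f x \<partial>M) \<partial>count_space I)"
    by (intro nn_integral_cong) (use assms in \<open>auto simp: emeasure_density\<close>)
  ultimately show ?thesis by simp
qed

lemma emeasure_UN_countable_le:
  assumes "countable I" "\<And>i. i \<in> I \<Longrightarrow> X i \<in> sets M"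
  shows "emeasure M (\<Union>i\<in>I. X i) \<le> (\<integral>\<^sup>+i. emeasure M (X i) \<partial>count_space I)"
proof -
  have "(\<Union>i\<in>I. X i) \<in> sets M" using assms by (intro sets.countable_UN') auto
  then have "emeasure M (\<Union>i\<in>I. X i) = (\<integral>\<^sup>+x. indicator (\<Union>i\<in>I. X i) x \<partial>M)"
    by simp
  also have "\<dots> \<le> (\<integral>\<^sup>+x. \<integral>\<^sup>+i. indicator (X i) x \<partial>count_space I \<partial>M)"
  proof (rule nn_integral_mono)
    fix x
    show "indicator (\<Union>i\<in>I. X i) x \<le> (\<integral>\<^sup>+i. indicator (X i) x \<partial>count_space I :: ennreal)"
    proof (cases "x \<in> (\<Union>i\<in>I. X i)")
      case True
      then obtain j where j: "j \<in> I" "x \<in> X j" by auto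
      have "(indicator (X j) x :: ennreal) \<le> (\<integral>\<^sup>+i. indicator (X i) x \<partial>count_space I)"
        using nn_integral_ge_point[OF j(1), of "\<lambda>i. indicator (X i) x"] by simp
      with j show ?thesis by (auto simp: indicator_def)
    qed auto
  qed
  also have "\<dots> = (\<integral>\<^sup>+i. \<integral>\<^sup>+x. indicator (X i) x \<partial>M \<partial>count_space I)"
    by (rule nn_integral_count_space_nn_integral) (use assms in auto)
  also have "\<dots> = (\<integral>\<^sup>+i. emeasure M (X i) \<partial>count_space I)"
    by (intro nn_integral_cong) (use assms in auto)
  finally show ?thesis .
qed

lemma emeasure_lebesgue_ball:
  fixes x :: "real^'n"
  assumes "0 \<le> r"
  shows "emeasure lebesgue (ball x r) = ennreal (unit_ball_vol (real CARD('n)) * r ^ CARD('n))"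
  using emeasure_ball[OF assms, of x] by simp

text \<open>Vitali selects disjoint balls whose fivefold dilates cover S; the volume of each is paid
  for by the mass of F in it, and masses over disjoint balls add up. S itself may fail to be
  measurable, hence the superset. Both weak type estimates for maximal functions
  (\<open>maximal_bad_set\<close>, \<open>orlicz_max_level\<close>) come from here.\<close>

lemma vitali_bound:
  fixes F :: "real^'n \<Rightarrow> ennreal"
  assumes F: "F \<in> borel_measurable lebesgue" and fin: "(\<integral>\<^sup>+y. F y \<partial>lebesgue) < \<infinity>" and c: "0 \<le> c"
    and S: "\<And>x. x \<in> S \<Longrightarrow> \<exists>r>0. ennreal (r ^ CARD('n)) \<le> ennreal c * (\<integral>\<^sup>+y\<in>ball x r. F y \<partial>lebesgue)"
  shows "\<exists>S'\<in>sets lebesgue. S \<subseteq> S' \<and>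
    emeasure lebesgue S' \<le> ennreal (5 ^ CARD('n) * unit_ball_vol (real CARD('n)) * c) * (\<integral>\<^sup>+y. F y \<partial>lebesgue)"
proof -
  let ?n = "CARD('n)" and ?v = "unit_ball_vol (real CARD('n))"
  define m where "m = enn2real (\<integral>\<^sup>+y. F y \<partial>lebesgue)"
  have m: "(\<integral>\<^sup>+y. F y \<partial>lebesgue) = ennreal m" "0 \<le> m" using fin by (auto simp: m_def)
  define K where "K = {(x, r). x \<in> S \<and> 0 < r \<and> ennreal (r ^ ?n) \<le> ennreal c * (\<integral>\<^sup>+y\<in>ball x r. F y \<partial>lebesgue)}"
  have cov: "S \<subseteq> (\<Union>i\<in>K. ball (fst i) (snd i))"
  proof
    fix x assume "x \<in> S"
    then obtain r where "r > 0" "ennreal (r ^ ?n) \<le> ennreal c * (\<integral>\<^sup>+y\<in>ball x r. F y \<partial>lebesgue)"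
      using S by blast
    with \<open>x \<in> S\<close> have "(x, r) \<in> K" by (auto simp: K_def)
    then show "x \<in> (\<Union>i\<in>K. ball (fst i) (snd i))" using \<open>r > 0\<close> by (intro UN_I[of "(x,r)"]) auto
  qed
  \<comment> \<open>The covering lemma wants uniformly bounded radii; the finite total mass m gives
    r^n <= c m, and r <= r^n once r > 1.\<close>
  have bd: "0 < snd i \<and> snd i \<le> max 1 (c * m)" if "i \<in> K" for i
  proof -
    obtain x r where i: "i = (x, r)" by (cases i)
    have r: "0 < r" "ennreal (r ^ ?n) \<le> ennreal c * (\<integral>\<^sup>+y\<in>ball x r. F y \<partial>lebesgue)"
      using that by (auto simp: K_def i)
    have "(\<integral>\<^sup>+y\<in>ball x r. F y \<partial>lebesgue) \<le> ennreal m"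
      unfolding m(1)[symmetric] by (intro nn_integral_mono) (auto simp: indicator_def)
    then have "ennreal (r ^ ?n) \<le> ennreal c * ennreal m"
      using r(2) by (meson mult_left_mono order_trans zero_le)
    then have "r ^ ?n \<le> c * m" using c m by (simp add: ennreal_mult[symmetric])
    moreover have "r \<le> r ^ ?n" if "1 < r"
      using that by (intro self_le_power) auto
    ultimately show ?thesis using r(1) i by (force simp: le_max_iff_disj)
  qed
  obtain C where C: "countable C" "C \<subseteq> K" 
    "pairwise (\<lambda>i j. disjnt (ball (fst i) (snd i)) (ball (fst j) (snd j))) C"
    "S \<subseteq> (\<Union>i\<in>C. ball (fst i) (5 * snd i))"
    by (rule Vitali_covering_lemma_balls[OF cov bd]) (blast intro: that)+
  let ?S = "\<Union>i\<in>C. ball (fst i) (5 * snd i)"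
  have ms: "?S \<in> sets lebesgue" by (rule sets.countable_UN'[OF C(1)]) auto
  have disj: "disjoint_family_on (\<lambda>i. ball (fst i) (snd i)) C"
    using C(3) by (auto simp: disjoint_family_on_def pairwise_def disjnt_def)
  have "emeasure lebesgue ?S \<le> (\<integral>\<^sup>+i. emeasure lebesgue (ball (fst i) (5 * snd i)) \<partial>count_space C)"
    by (rule emeasure_UN_countable_le[OF C(1)]) auto
  also have "\<dots> \<le> (\<integral>\<^sup>+i. ennreal (5 ^ ?n * ?v * c) * (\<integral>\<^sup>+y\<in>ball (fst i) (snd i). F y \<partial>lebesgue) \<partial>count_space C)"
  proof (rule nn_integral_mono)
    fix i assume "i \<in> space (count_space C)"
    then have iK: "i \<in> K" using C(2) by auto
    then have r: "0 < snd i" "ennreal (snd i ^ ?n) \<le> ennreal c * (\<integral>\<^sup>+y\<in>ball (fst i) (snd i). F y \<partial>lebesgue)"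
      by (auto simp: K_def)
    have "emeasure lebesgue (ball (fst i) (5 * snd i)) = ennreal (5^?n * ?v) * ennreal (snd i ^ ?n)"
      using r(1) by (subst emeasure_lebesgue_ball) (auto simp: power_mult_distrib ennreal_mult[symmetric] mult_ac)
    also have "\<dots> \<le> ennreal (5^?n * ?v) * (ennreal c * (\<integral>\<^sup>+y\<in>ball (fst i) (snd i). F y \<partial>lebesgue))"
      by (rule mult_left_mono[OF r(2)]) auto
    also have "\<dots> = ennreal (5 ^ ?n * ?v * c) * (\<integral>\<^sup>+y\<in>ball (fst i) (snd i). F y \<partial>lebesgue)"
      using c by (simp add: ennreal_mult mult.assoc)
    finally show "emeasure lebesgue (ball (fst i) (5 * snd i)) \<le> \<dots>" .
  qed
  also have "\<dots> = ennreal (5 ^ ?n * ?v * c) * (\<integral>\<^sup>+i. (\<integral>\<^sup>+y\<in>ball (fst i) (snd i). F y \<partial>lebesgue) \<partial>count_space C)"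
    by (rule nn_integral_cmult) auto
  also have "(\<integral>\<^sup>+i. (\<integral>\<^sup>+y\<in>ball (fst i) (snd i). F y \<partial>lebesgue) \<partial>count_space C)
      = (\<integral>\<^sup>+y\<in>(\<Union>i\<in>C. ball (fst i) (snd i)). F y \<partial>lebesgue)"
    by (rule nn_integral_disjoint_UN[OF C(1) disj _ F, symmetric]) auto
  also have "ennreal (5 ^ ?n * ?v * c) * (\<integral>\<^sup>+y\<in>(\<Union>i\<in>C. ball (fst i) (snd i)). F y \<partial>lebesgue)
      \<le> ennreal (5 ^ ?n * ?v * c) * (\<integral>\<^sup>+y. F y \<partial>lebesgue)"
    by (intro mult_left_mono nn_integral_mono) (auto simp: indicator_def)
  finally show ?thesis using ms C(4) by blast
qed

text \<open>k is the dyadic shell with rho 2^k <= t < rho 2^(k+1). There the decay is 2^(-delta k)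
  over the n-th power of the inner radius; the factor 2^n replaces inner by outer radius, so that
  the quotient is ready for integration over a ball.\<close>

lemma annulus_bound:
  fixes \<rho> t \<delta> :: real
  assumes "0 < \<rho>" "\<rho> \<le> t" "0 < \<delta>"
  shows "\<exists>k. t < \<rho> * 2 ^ Suc k \<and>
    \<rho> powr \<delta> / t powr (real n + \<delta>) \<le> 2 ^ n * (2 powr - \<delta>) ^ k / (\<rho> * 2 ^ Suc k) ^ n"
proof -
  obtain k0 where "t / \<rho> < 2 ^ k0" using real_arch_pow[of 2 "t / \<rho>"] by auto
  define k1 where "k1 = (LEAST k. t / \<rho> < 2 ^ k)"
  have k1: "t / \<rho> < 2 ^ k1" unfolding k1_def by (rule LeastI) fact
  have "k1 \<noteq> 0" using k1 assms by (intro notI) (simp add: field_simps)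
  then obtain k where k: "k1 = Suc k" by (cases k1) auto
  have "\<not> t / \<rho> < 2 ^ k" using not_less_Least[of k "\<lambda>k. t / \<rho> < 2 ^ k"] k unfolding k1_def by auto
  then have lo: "\<rho> * 2 ^ k \<le> t" using assms by (simp add: field_simps)
  have hi: "t < \<rho> * 2 ^ Suc k" using k1 k assms by (simp add: field_simps)
  have p: "0 < \<rho> * 2 ^ k" using assms by simp
  have "(\<rho> * 2 ^ k) powr (real n + \<delta>) \<le> t powr (real n + \<delta>)"
    using lo p assms by (intro powr_mono2) auto
  then have "\<rho> powr \<delta> / t powr (real n + \<delta>) \<le> \<rho> powr \<delta> / (\<rho> * 2 ^ k) powr (real n + \<delta>)"
    using p by (intro divide_left_mono mult_pos_pos) (auto intro: order_less_le_trans[of 0 "(\<rho> * 2 ^ k) powr (real n + \<delta>)"])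
  also have "(\<rho> * 2 ^ k) powr (real n + \<delta>) = (\<rho> * 2^k) ^ n * (\<rho> powr \<delta> * (2 powr \<delta>) ^ k)"
  proof -
    have "(2 ^ k) powr \<delta> = (2 powr real k) powr \<delta>" by (simp add: powr_realpow)
    also have "\<dots> = (2 powr \<delta>) powr real k" by (simp add: powr_powr mult.commute)
    also have "\<dots> = (2 powr \<delta>) ^ k" by (simp add: powr_realpow)
    finally have "(2 ^ k) powr \<delta> = (2 powr \<delta>) ^ k" .
    then show ?thesis using p assms by (simp add: powr_add powr_realpow powr_mult power_mult_distrib)
  qed
  also have "\<rho> powr \<delta> / ((\<rho> * 2^k) ^ n * (\<rho> powr \<delta> * (2 powr \<delta>) ^ k)) = 2 ^ n * (2 powr - \<delta>) ^ k / (\<rho> * 2 ^ Suc k) ^ n"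
    using assms by (simp add: powr_minus field_simps power_mult_distrib)
  finally show ?thesis using hi by blast
qed

text \<open>Sum over dyadic shells: shell k costs \<open>m\<close> times 2^n 2^(-delta k), a
  geometric series. Here \<open>m\<close> bounds all averages of F centred at z, up to the volume of
  the unit ball. It is used with F = 1 for the bad functions and with F = |f| for the oscillation of
  the far part.\<close>

lemma tail_bound:
  fixes F :: "real^'n \<Rightarrow> ennreal"
  assumes \<delta>: "0 < \<delta>" and \<rho>: "0 < \<rho>" and F[measurable]: "F \<in> borel_measurable lebesgue"
    and m: "\<And>r. 0 < r \<Longrightarrow> (\<integral>\<^sup>+y\<in>ball z r. F y \<partial>lebesgue) \<le> m * ennreal (r ^ CARD('n))"
  shows "(\<integral>\<^sup>+y\<in>{y. \<rho> \<le> dist z y}. F y * ennreal (\<rho> powr \<delta> / dist z y powr (real CARD('n) + \<delta>)) \<partial>lebesgue)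
    \<le> ennreal (2 ^ CARD('n) / (1 - 2 powr - \<delta>)) * m"
proof -
  let ?n = "CARD('n)"
  define r where "r k = \<rho> * 2 ^ Suc k" for k
  define c where "c k = 2 ^ ?n * (2 powr - \<delta>) ^ k / r k ^ ?n" for k
  have r: "0 < r k" for k using \<rho> by (simp add: r_def)
  have [measurable]: "ball z (r k) \<in> sets lebesgue" for k by simp
  have q: "0 < 2 powr - \<delta>" "2 powr - \<delta> < 1" using \<delta> by (auto simp: powr_less_one)
  have "(\<integral>\<^sup>+y\<in>{y. \<rho> \<le> dist z y}. F y * ennreal (\<rho> powr \<delta> / dist z y powr (real ?n + \<delta>)) \<partial>lebesgue)
     \<le> (\<integral>\<^sup>+y. (\<Sum>k. ennreal (c k) * (F y * indicator (ball z (r k)) y)) \<partial>lebesgue)"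
  proof (rule nn_integral_mono)
    fix y
    show "F y * ennreal (\<rho> powr \<delta> / dist z y powr (real ?n + \<delta>)) * indicator {y. \<rho> \<le> dist z y} y
       \<le> (\<Sum>k. ennreal (c k) * (F y * indicator (ball z (r k)) y))"
    proof (cases "\<rho> \<le> dist z y")
      case True
      obtain k where k: "dist z y < r k" "\<rho> powr \<delta> / dist z y powr (real ?n + \<delta>) \<le> c k"
        using annulus_bound[OF \<rho> True \<delta>, of ?n] unfolding r_def c_def by blast
      have "F y * ennreal (\<rho> powr \<delta> / dist z y powr (real ?n + \<delta>)) * indicator {y. \<rho> \<le> dist z y} y
         \<le> ennreal (c k) * (F y * indicator (ball z (r k)) y)"
        using k True by (auto simp: mult.commute intro!: mult_left_mono ennreal_leI)
      also have "\<dots> \<le> (\<Sum>k. ennreal (c k) * (F y * indicator (ball z (r k)) y))"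
        using sum_le_suminf[OF summableI, of "{k}" "\<lambda>k. ennreal (c k) * (F y * indicator (ball z (r k)) y)"] by simp
      finally show ?thesis .
    qed auto
  qed
  also have "\<dots> = (\<Sum>k. \<integral>\<^sup>+y. ennreal (c k) * (F y * indicator (ball z (r k)) y) \<partial>lebesgue)"
    by (rule nn_integral_suminf) measurable
  also have "\<dots> \<le> (\<Sum>k. ennreal (2 ^ ?n * (2 powr - \<delta>) ^ k) * m)"
  proof (intro suminf_le summableI)
    fix k
    have "(\<integral>\<^sup>+y. ennreal (c k) * (F y * indicator (ball z (r k)) y) \<partial>lebesgue)
        = ennreal (c k) * (\<integral>\<^sup>+y\<in>ball z (r k). F y \<partial>lebesgue)"
      by (rule nn_integral_cmult) measurable
    also have "\<dots> \<le> ennreal (c k) * (m * ennreal (r k ^ ?n))"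
      by (intro mult_left_mono m r) auto
    also have "\<dots> = ennreal (c k * r k ^ ?n) * m"
      using r[of k] q by (subst ennreal_mult) (auto simp: c_def mult_ac)
    also have "c k * r k ^ ?n = 2 ^ ?n * (2 powr - \<delta>) ^ k"
      using r[of k] by (simp add: c_def)
    finally show "(\<integral>\<^sup>+y. ennreal (c k) * (F y * indicator (ball z (r k)) y) \<partial>lebesgue)
       \<le> ennreal (2 ^ ?n * (2 powr - \<delta>) ^ k) * m" .
  qed
  also have "\<dots> = (\<Sum>k. ennreal (2 ^ ?n * (2 powr - \<delta>) ^ k)) * m"
    by simp
  also have "(\<Sum>k. ennreal (2 ^ ?n * (2 powr - \<delta>) ^ k)) = ennreal (2 ^ ?n / (1 - 2 powr - \<delta>))"
  proof -
    have "(\<lambda>k. 2 ^ ?n * (2 powr - \<delta>) ^ k) sums (2 ^ ?n * (1 / (1 - 2 powr - \<delta>)))"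
      using q by (intro sums_mult geometric_sums) auto
    then show ?thesis using q by (intro suminf_ennreal_eq) auto
  qed
  finally show ?thesis .
qed

section \<open>The dyadic grid\<close>

text \<open>The grid has a free top scale \<open>L\<close> and is shifted so that the cube of level \<open>0\<close> containing the
  origin is centred there. A cube is named by its level and its integer position, so that
  families of cubes are countable for free. All constants below are independent of \<open>L\<close>.\<close>

definition didx :: "real \<Rightarrow> nat \<Rightarrow> real^'n \<Rightarrow> 'n \<Rightarrow> int" where
  "didx L j x = (\<lambda>i. \<lfloor>(x $ i / L + 1 / 2) * 2 ^ j\<rfloor>)"

definition dcube :: "real \<Rightarrow> nat \<times> ('n \<Rightarrow> int) \<Rightarrow> (real^'n) set" where
  "dcube L q = {x. didx L (fst q) x = snd q}"

definition dside :: "real \<Rightarrow> nat \<times> ('n \<Rightarrow> int) \<Rightarrow> real" where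
  "dside L q = L / 2 ^ fst q"

definition dcorner :: "real \<Rightarrow> nat \<times> ('n \<Rightarrow> int) \<Rightarrow> real^'n" where
  "dcorner L q = (\<chi> i. (real_of_int (snd q i) / 2 ^ fst q - 1 / 2) * L)"

text \<open>This dilation makes points outside the dilated cube lie more than twice the diameter bound
  \<open>n * dside L q\<close> away from the cube, which is what the kernel smoothness condition needs.\<close>

abbreviation dil :: "'n itself \<Rightarrow> real" where
  "dil _ \<equiv> 2 * real CARD('n) + 1"

text \<open>Centred at the lower corner of the cube rather than at its midpoint, so membership is a
  bound on |y_i - corner_i| alone. The literal shape is that of the members of \<open>cubes\<close>,
  to which the bump condition applies.\<close>

definition dstar :: "real \<Rightarrow> nat \<times> ('n \<Rightarrow> int) \<Rightarrow> (real^'n) set" where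
  "dstar L q = (let a = (\<chi> i. dcorner L q $ i - dil TYPE('n) * dside L q)
     in cbox a (\<chi> i. a $ i + 2 * dil TYPE('n) * dside L q))"

lemma dside_pos: "0 < L \<Longrightarrow> 0 < dside L q"
  by (simp add: dside_def)

lemma dcube_self: "x \<in> dcube L (j, didx L j x)"
  by (simp add: dcube_def)

lemma dcube_eqD: "x \<in> dcube L q \<Longrightarrow> q = (fst q, didx L (fst q) x)"
  by (simp add: dcube_def prod_eq_iff)

lemma mem_dcube_iff:
  assumes "0 < L"
  shows "x \<in> dcube L q \<longleftrightarrow> (\<forall>i. dcorner L q $ i \<le> x $ i \<and> x $ i < dcorner L q $ i + dside L q)"
proof -
  have "\<lfloor>(x $ i / L + 1 / 2) * 2 ^ fst q\<rfloor> = snd q i \<longleftrightarrow>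
     dcorner L q $ i \<le> x $ i \<and> x $ i < dcorner L q $ i + dside L q" for i
    unfolding floor_eq_iff dcorner_def dside_def using assms by (simp add: field_simps)
  then show ?thesis by (simp add: dcube_def didx_def fun_eq_iff)
qed

lemma dcube_coord:
  assumes "0 < L" "x \<in> dcube L q"
  shows "\<bar>x $ i - dcorner L q $ i\<bar> \<le> dside L q"
proof -
  have "dcorner L q $ i \<le> x $ i" "x $ i < dcorner L q $ i + dside L q"
    using assms mem_dcube_iff by blast+
  then show ?thesis by simp
qed

lemma didx_parent: "didx L (Suc j) x = didx L (Suc j) y \<Longrightarrow> didx L j x = didx L j y"
proof -
  assume a: "didx L (Suc j) x = didx L (Suc j) y"
  have "\<lfloor>t * 2 ^ j\<rfloor> = \<lfloor>t * 2 ^ Suc j\<rfloor> div 2" for t :: real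
    using floor_divide_real_eq_div[of 2 "t * 2 ^ Suc j"] by simp
  with a show ?thesis unfolding didx_def fun_eq_iff by metis
qed

lemma didx_mono: "j \<le> k \<Longrightarrow> didx L k x = didx L k y \<Longrightarrow> didx L j x = didx L j y"
  by (induction rule: inc_induct) (use didx_parent in blast)+

lemma dcube_mono: "j \<le> k \<Longrightarrow> dcube L (k, didx L k x) \<subseteq> dcube L (j, didx L j x)"
  using didx_mono by (fastforce simp: dcube_def)

lemma dcube_subset_box: "0 < L \<Longrightarrow> dcube L q \<subseteq> cbox (dcorner L q) (\<chi> i. dcorner L q $ i + dside L q)"
  by (auto simp: mem_dcube_iff mem_box_cart less_imp_le)

lemma box_subset_dcube: "0 < L \<Longrightarrow> box (dcorner L q) (\<chi> i. dcorner L q $ i + dside L q) \<subseteq> dcube L q"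
  by (auto simp: mem_dcube_iff mem_box_cart less_imp_le)

lemma emeasure_cube:
  fixes a :: "real^'n"
  assumes "0 \<le> l"
  shows "emeasure lebesgue (cbox a (\<chi> i. a $ i + l)) = ennreal (l ^ CARD('n))"
proof -
  have "emeasure lebesgue (cbox a (\<chi> i. a $ i + l)) = ennreal (measure lebesgue (cbox a (\<chi> i. a $ i + l)))"
    by (simp add: emeasure_eq_measure2 lmeasurable_cbox)
  moreover have "cbox a (\<chi> i. a $ i + l) \<noteq> {}"
    using assms by (simp add: interval_ne_empty_cart)
  ultimately show ?thesis by (simp add: content_cbox_cart)
qed

lemma dcube_sets [measurable, simp]:
  assumes "0 < L" shows "dcube L q \<in> sets lebesgue"
proof -
  have "dcube L q = (\<Inter>i. {x. dcorner L q $ i \<le> x $ i} \<inter> {x. x $ i < dcorner L q $ i + dside L q})"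
    by (auto simp: mem_dcube_iff[OF assms])
  also have "\<dots> \<in> sets borel"
    by (intro sets.finite_INT sets.Int borel_closed borel_open closed_halfspace_component_ge_cart
        open_halfspace_component_lt_cart) auto
  finally show ?thesis by simp
qed

text \<open>The half-open cube lies between an open and a closed box of equal measure.\<close>

lemma emeasure_dcube:
  fixes q :: "nat \<times> ('n::finite \<Rightarrow> int)"
  assumes L: "0 < L" shows "emeasure lebesgue (dcube L q) = ennreal (dside L q ^ CARD('n))"
proof (rule antisym)
  let ?b = "(\<chi> i. dcorner L q $ i + dside L q)"
  have c: "emeasure lebesgue (cbox (dcorner L q) ?b) = ennreal (dside L q ^ CARD('n))"
    by (rule emeasure_cube) (use dside_pos[OF L, of q] in simp)
  show "emeasure lebesgue (dcube L q) \<le> ennreal (dside L q ^ CARD('n))"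
    unfolding c[symmetric] by (intro emeasure_mono dcube_subset_box L) simp
  have "emeasure lebesgue (cbox (dcorner L q) ?b) = emeasure lebesgue (box (dcorner L q) ?b)"
    by (simp add: emeasure_lborel_cbox_eq emeasure_lborel_box_eq)
  also have "\<dots> \<le> emeasure lebesgue (dcube L q)"
    by (intro emeasure_mono box_subset_dcube L) (simp add: L)
  finally show "ennreal (dside L q ^ CARD('n)) \<le> emeasure lebesgue (dcube L q)" unfolding c .
qed

lemma dstar_in_cubes: "0 < L \<Longrightarrow> dstar L q \<in> cubes"
  unfolding dstar_def cubes_def Let_def
  by (rule CollectI, intro exI conjI, rule refl) (simp add: dside_pos)

lemma dstar_sets [measurable, simp]: "dstar L q \<in> sets lebesgue"
  by (simp add: dstar_def Let_def)

lemma emeasure_dstar: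
  fixes q :: "nat \<times> ('n::finite \<Rightarrow> int)"
  assumes L: "0 < L" shows "emeasure lebesgue (dstar L q) = ennreal ((2 * dil TYPE('n) * dside L q) ^ CARD('n))"
  unfolding dstar_def Let_def using dside_pos[OF L, of q] by (subst emeasure_cube) auto

lemma mem_dstar_iff:
  fixes q :: "nat \<times> ('n::finite \<Rightarrow> int)"
  shows "y \<in> dstar L q \<longleftrightarrow> (\<forall>i. \<bar>y $ i - dcorner L q $ i\<bar> \<le> dil TYPE('n) * dside L q)"
  by (simp add: dstar_def Let_def mem_box_cart abs_le_iff) (auto simp: algebra_simps; smt (verit))

section \<open>Distances between cubes, dilates and points\<close>

lemma dist_le_cart:
  fixes x y :: "real^'n"
  assumes "\<And>i. \<bar>x $ i - y $ i\<bar> \<le> d"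
  shows "dist x y \<le> real CARD('n) * d"
proof -
  have "dist x y \<le> (\<Sum>i\<in>UNIV. \<bar>(x - y) $ i\<bar>)" unfolding dist_norm by (rule norm_le_l1_cart)
  also have "\<dots> \<le> (\<Sum>i\<in>(UNIV::'n set). d)" by (intro sum_mono) (use assms in simp)
  finally show ?thesis by simp
qed

lemma dist_dcube_le:
  fixes x y :: "real^'n"
  assumes "0 < L" "x \<in> dcube L q" "y \<in> dcube L q"
  shows "dist x y \<le> real CARD('n) * dside L q"
proof (rule dist_le_cart)
  fix i
  have "dcorner L q $ i \<le> x $ i" "x $ i < dcorner L q $ i + dside L q"
    "dcorner L q $ i \<le> y $ i" "y $ i < dcorner L q $ i + dside L q"
    using assms mem_dcube_iff by blast+
  then show "\<bar>x $ i - y $ i\<bar> \<le> dside L q" by simp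
qed

lemma dist_dstar_le:
  fixes x y :: "real^'n"
  assumes L: "0 < L" and x: "x \<in> dcube L q" and y: "y \<in> dstar L q"
  shows "dist x y \<le> real CARD('n) * ((dil TYPE('n) + 1) * dside L q)"
proof (rule dist_le_cart)
  fix i
  have "\<bar>x $ i - dcorner L q $ i\<bar> \<le> dside L q" using dcube_coord[OF L x] by simp
  moreover have "\<bar>y $ i - dcorner L q $ i\<bar> \<le> dil TYPE('n) * dside L q" using y by (simp add: mem_dstar_iff)
  ultimately show "\<bar>x $ i - y $ i\<bar> \<le> (dil TYPE('n) + 1) * dside L q" by (simp add: algebra_simps)
qed

text \<open>In some coordinate y is more than 2n+1 sides away from the corner, and x is within one
  side of it. The remaining 2n sides are twice the diameter bound of
  \<open>dist_dcube_le\<close>.\<close>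

lemma dist_not_dstar:
  fixes x y :: "real^'n"
  assumes L: "0 < L" and x: "x \<in> dcube L q" and y: "y \<notin> dstar L q"
  shows "2 * real CARD('n) * dside L q < dist x y"
proof -
  obtain i where i: "dil TYPE('n) * dside L q < \<bar>y $ i - dcorner L q $ i\<bar>"
    using y by (auto simp: mem_dstar_iff not_le)
  have "\<bar>x $ i - dcorner L q $ i\<bar> \<le> dside L q" using dcube_coord[OF L x] by simp
  then have "2 * real CARD('n) * dside L q < \<bar>(x - y) $ i\<bar>" using i by (simp add: algebra_simps)
  also have "\<dots> \<le> dist x y" unfolding dist_norm by (rule component_le_norm_cart)
  finally show ?thesis .
qed

lemma card_ge_1: "1 \<le> real CARD('n::finite)"
  by (simp add: Suc_le_eq)

lemma dcube_subset_dstar: "0 < L \<Longrightarrow> dcube L q \<subseteq> (dstar L q :: (real^'n) set)"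
proof
  fix x :: "real^'n" assume L: "0 < L" and x: "x \<in> dcube L q"
  show "x \<in> dstar L q" unfolding mem_dstar_iff
  proof
    fix i
    have "\<bar>x $ i - dcorner L q $ i\<bar> \<le> 1 * dside L q" using dcube_coord[OF L x] by simp
    also have "\<dots> \<le> dil TYPE('n) * dside L q" using dside_pos[OF L, of q] by (intro mult_right_mono) auto
    finally show "\<bar>x $ i - dcorner L q $ i\<bar> \<le> dil TYPE('n) * dside L q" .
  qed
qed

lemma dcorner_mem: "0 < L \<Longrightarrow> dcorner L q \<in> dcube L q"
  using dside_pos[of L q] by (simp add: mem_dcube_iff)

text \<open>A deeper level at least halves the side. The shift of the corner costs one side of q,
  and the halved dilate still fits because \<open>dil\<close> is at least 2.\<close>

lemma dstar_mono:
  fixes q q' :: "nat \<times> ('n::finite \<Rightarrow> int)"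
  assumes L: "0 < L" and sub: "dcube L q' \<subseteq> dcube L q" and lt: "fst q < fst q'"
  shows "dstar L q' \<subseteq> dstar L q"
proof
  fix y assume y: "y \<in> dstar L q'"
  have s: "dside L q' \<le> dside L q / 2"
  proof -
    have "(2::real) ^ Suc (fst q) \<le> 2 ^ fst q'" using lt by (intro power_increasing) auto
    then show ?thesis using L by (simp add: dside_def field_simps)
  qed
  have c: "dcorner L q' \<in> dcube L q" using dcorner_mem[OF L, of q'] sub by auto
  show "y \<in> dstar L q" unfolding mem_dstar_iff
  proof
    fix i
    have "\<bar>dcorner L q' $ i - dcorner L q $ i\<bar> \<le> dside L q" using dcube_coord[OF L c] by simp
    moreover have "\<bar>y $ i - dcorner L q' $ i\<bar> \<le> dil TYPE('n) * dside L q'" using y by (simp add: mem_dstar_iff)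
    moreover have "dil TYPE('n) * dside L q' \<le> dil TYPE('n) * (dside L q / 2)" using s by (intro mult_left_mono) auto
    moreover have "dside L q + dil TYPE('n) * (dside L q / 2) \<le> dil TYPE('n) * dside L q"
    proof -
      have "2 * dside L q \<le> dil TYPE('n) * dside L q"
      proof (rule mult_right_mono)
        show "2 \<le> dil TYPE('n)" using card_ge_1[where 'n='n] by linarith
      qed (use dside_pos[OF L, of q] in simp)
      then show ?thesis by (simp add: algebra_simps)
    qed
    ultimately show "\<bar>y $ i - dcorner L q $ i\<bar> \<le> dil TYPE('n) * dside L q" by linarith
  qed
qed

text \<open>The prescribed level \<open>j0\<close> lets cubes be found strictly below a given
  one.\<close>

lemma dcube_in_open:
  fixes x :: "real^'n"
  assumes L: "0 < L" and U: "open U" "x \<in> U"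
  shows "\<exists>j>j0. dcube L (j, didx L j x) \<subseteq> U"
proof -
  obtain e where e: "e > 0" "ball x e \<subseteq> U" using U by (auto simp: open_contains_ball)
  obtain k where k: "real CARD('n) * L / e < 2 ^ k" using real_arch_pow[of 2] by auto
  define j where "j = Suc (j0 + k)"
  have "(2::real) ^ k \<le> 2 ^ j" by (intro power_increasing) (auto simp: j_def)
  then have "real CARD('n) * L / e < 2 ^ j" using k by (rule less_le_trans[rotated])
  then have small: "real CARD('n) * (L / 2 ^ j) < e" using e by (simp add: field_simps)
  have "dcube L (j, didx L j x) \<subseteq> ball x e"
  proof
    fix y assume "y \<in> dcube L (j, didx L j x)"
    then have "dist x y \<le> real CARD('n) * dside L (j, didx L j x)"
      by (intro dist_dcube_le[OF L] dcube_self)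
    then show "y \<in> ball x e" using small by (simp add: dside_def)
  qed
  with e show ?thesis by (intro exI[of _ j]) (auto simp: j_def)
qed

text \<open>The maximal cubes with property P. Ancestors are addressed through a point of the cube,
  as (i, \<open>didx L i x\<close>); one point is as good as all, since points of one cube share all
  coarser indices (\<open>dmax_ancestor\<close>).\<close>

definition dmax :: "real \<Rightarrow> (nat \<times> ('n \<Rightarrow> int) \<Rightarrow> bool) \<Rightarrow> (nat \<times> ('n::finite \<Rightarrow> int)) set" where
  "dmax L P = {q. P q \<and> (\<exists>x\<in>dcube L q. \<forall>i<fst q. \<not> P (i, didx L i x))}"

lemma dmaxD: "q \<in> dmax L P \<Longrightarrow> P q"
  by (simp add: dmax_def)

lemma dmax_ancestor:
  assumes "q \<in> dmax L P" "x \<in> dcube L q" "i < fst q"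
  shows "\<not> P (i, didx L i x)"
proof -
  obtain y where y: "y \<in> dcube L q" "\<forall>i<fst q. \<not> P (i, didx L i y)" using assms by (auto simp: dmax_def)
  have "didx L (fst q) x = didx L (fst q) y" using assms(2) y(1) by (simp add: dcube_def)
  then have "didx L i x = didx L i y" using assms(3) by (intro didx_mono[of i "fst q"]) auto
  with y assms(3) show ?thesis by auto
qed

text \<open>Levels are natural numbers, so among the cubes with P through x there is a largest one.
  The top scale L thus replaces any decay condition at infinity.\<close>

lemma dmax_cover:
  assumes "P (j, didx L j x)"
  shows "\<exists>q\<in>dmax L P. x \<in> dcube L q"
proof -
  define k where "k = (LEAST j. P (j, didx L j x))"
  have "P (k, didx L k x)" unfolding k_def by (rule LeastI) fact
  moreover have "\<not> P (i, didx L i x)" if "i < k" for i using not_less_Least that unfolding k_def by blast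
  ultimately show ?thesis using dcube_self[of x L k]
    by (intro bexI[of _ "(k, didx L k x)"]) (auto simp: dmax_def)
qed

text \<open>If two of the cubes shared a point and had different levels, the larger would be an
  ancestor with P of the smaller.\<close>

lemma dmax_disjoint: "disjoint_family_on (dcube L) (dmax L P)"
proof -
  have "q = q'" if q: "q \<in> dmax L P" "q' \<in> dmax L P" and x: "x \<in> dcube L q" "x \<in> dcube L q'" for q q' x
  proof -
    have e: "q = (fst q, didx L (fst q) x)" "q' = (fst q', didx L (fst q') x)"
      using x by (simp_all add: dcube_def prod_eq_iff)
    have "\<not> fst q < fst q'" using dmax_ancestor[OF q(2) x(2), of "fst q"] dmaxD[OF q(1)] e(1) by metis
    moreover have "\<not> fst q' < fst q" using dmax_ancestor[OF q(1) x(1), of "fst q'"] dmaxD[OF q(2)] e(2) by metis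
    ultimately show "q = q'" using e by (metis linorder_neqE_nat)
  qed
  then show ?thesis by (auto simp: disjoint_family_on_def)
qed

lemma countable_dyadic [simp]: "countable (I :: (nat \<times> ('n::finite \<Rightarrow> int)) set)"
  by (rule countableI_type)

section \<open>Square integrable functions and Calderon--Zygmund operators\<close>

text \<open>The squared norm as a plain integral, free of the root and the case distinction in
  \<open>Lp_norm\<close>.\<close>

definition L2_sq :: "(real^'n \<Rightarrow> complex) \<Rightarrow> ennreal" where
  "L2_sq f = (\<integral>\<^sup>+x. ennreal ((norm (f x))\<^sup>2) \<partial>lebesgue)"

lemma Lp_norm_2: "Lp_norm 2 (\<lambda>_. 1) f = (if L2_sq f = \<infinity> then \<infinity> else ennreal (sqrt (enn2real (L2_sq f))))"
  by (simp add: Lp_norm_def L2_sq_def Let_def powr_numeral powr_half_sqrt)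

lemma in_L2_iff: "in_L2 f \<longleftrightarrow> f \<in> borel_measurable lebesgue \<and> L2_sq f < \<infinity>"
  by (auto simp: in_L2_def Lp_norm_2 less_top)

lemma in_L2_meas: "in_L2 f \<Longrightarrow> f \<in> borel_measurable lebesgue"
  by (simp add: in_L2_iff)

lemma in_L2_dom:
  assumes "in_L2 f" "g \<in> borel_measurable lebesgue" "\<And>x. norm (g x) \<le> norm (f x)"
  shows "in_L2 g"
proof -
  have "L2_sq g \<le> L2_sq f" unfolding L2_sq_def by (intro nn_integral_mono ennreal_leI power_mono assms) auto
  with assms show ?thesis by (auto simp: in_L2_iff)
qed

lemma in_L2_add:
  assumes "in_L2 f" "in_L2 g" shows "in_L2 (\<lambda>x. f x + g x)"
proof -
  have [measurable]: "f \<in> borel_measurable lebesgue" "g \<in> borel_measurable lebesgue"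
    using assms by (auto intro: in_L2_meas)
  have "L2_sq (\<lambda>x. f x + g x) \<le> (\<integral>\<^sup>+x. 2 * ennreal ((norm (f x))\<^sup>2) + 2 * ennreal ((norm (g x))\<^sup>2) \<partial>lebesgue)"
    unfolding L2_sq_def
  proof (rule nn_integral_mono)
    fix x
    have "(norm (f x + g x))\<^sup>2 \<le> (norm (f x) + norm (g x))\<^sup>2"
      by (intro power_mono norm_triangle_ineq) auto
    also have "\<dots> \<le> 2 * (norm (f x))\<^sup>2 + 2 * (norm (g x))\<^sup>2"
      using zero_le_power2[of "norm (f x) - norm (g x)"] by (simp add: power2_sum power2_diff)
    finally show "ennreal ((norm (f x + g x))\<^sup>2) \<le> 2 * ennreal ((norm (f x))\<^sup>2) + 2 * ennreal ((norm (g x))\<^sup>2)"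
      by (simp add: ennreal_plus[symmetric] ennreal_mult'[symmetric] ennreal_leI del: ennreal_plus flip: ennreal_numeral)
  qed
  also have "\<dots> = 2 * L2_sq f + 2 * L2_sq g"
    unfolding L2_sq_def by (subst nn_integral_add) (auto simp: nn_integral_cmult)
  also have "\<dots> < \<infinity>" using assms by (auto simp: in_L2_iff ennreal_mult_less_top)
  finally show ?thesis by (simp add: in_L2_iff)
qed

lemma in_L2_zero: "in_L2 (\<lambda>x. 0)"
  by (simp add: in_L2_iff L2_sq_def)

lemma in_L2_sum: "finite I \<Longrightarrow> (\<And>i. i \<in> I \<Longrightarrow> in_L2 (b i)) \<Longrightarrow> in_L2 (\<lambda>x. \<Sum>i\<in>I. b i x)"
  by (induction rule: finite_induct) (auto intro: in_L2_add in_L2_zero)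

lemma in_L2_indicator:
  assumes "in_L2 f" "A \<in> sets lebesgue" shows "in_L2 (\<lambda>x. indicator A x * f x)"
proof -
  have [measurable]: "f \<in> borel_measurable lebesgue" "A \<in> sets lebesgue"
    using assms by (auto intro: in_L2_meas)
  show ?thesis by (rule in_L2_dom[OF assms(1)]) (auto simp: norm_mult indicator_def)
qed

lemma in_L2_const_indicator:
  assumes "A \<in> sets lebesgue" "emeasure lebesgue A < \<infinity>" shows "in_L2 (\<lambda>x. indicator A x * c)"
proof -
  have [measurable]: "A \<in> sets lebesgue" by fact
  have "L2_sq (\<lambda>x. indicator A x * c) = (\<integral>\<^sup>+x. ennreal ((norm c)\<^sup>2) * indicator A x \<partial>lebesgue)"
    unfolding L2_sq_def by (intro nn_integral_cong) (auto simp: indicator_def norm_mult)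
  also have "\<dots> = ennreal ((norm c)\<^sup>2) * emeasure lebesgue A"
    using assms(1) by (subst nn_integral_cmult_indicator) auto
  also have "\<dots> < \<infinity>" using assms(2) by (auto simp: ennreal_mult_less_top)
  finally show ?thesis by (simp add: in_L2_iff)
qed

text \<open>The pointwise bound |f| <= 1 + |f|^2 takes the place of Cauchy-Schwarz.\<close>

lemma in_L2_integrable_on:
  assumes f: "in_L2 f" and A[measurable]: "A \<in> sets lebesgue" and fin: "emeasure lebesgue A < \<infinity>"
  shows "integrable lebesgue (\<lambda>x. indicator A x * f x)"
proof -
  have [measurable]: "f \<in> borel_measurable lebesgue" using f by (rule in_L2_meas)
  have "(\<integral>\<^sup>+x. ennreal (norm (indicator A x * f x)) \<partial>lebesgue)
     \<le> (\<integral>\<^sup>+x. indicator A x + ennreal ((norm (f x))\<^sup>2) \<partial>lebesgue)"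
  proof (rule nn_integral_mono)
    fix x
    have "norm (f x) \<le> 1 + (norm (f x))\<^sup>2"
      using zero_le_power2[of "norm (f x) - 1"] norm_ge_zero[of "f x"] unfolding power2_diff by (simp del: norm_ge_zero) 
    then have "ennreal (norm (f x)) \<le> 1 + ennreal ((norm (f x))\<^sup>2)"
      by (metis ennreal_1 ennreal_leI ennreal_plus zero_le_one zero_le_power2)
    then show "ennreal (norm (indicator A x * f x)) \<le> indicator A x + ennreal ((norm (f x))\<^sup>2)"
      by (auto simp: indicator_def)
  qed
  also have "\<dots> = emeasure lebesgue A + L2_sq f" unfolding L2_sq_def by (subst nn_integral_add) auto
  also have "\<dots> < \<infinity>" using f fin by (simp add: in_L2_iff)
  finally show ?thesis by (simp add: integrable_iff_bounded)
qed

lemma emeasure_gt_le: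
  fixes \<phi> :: "'a \<Rightarrow> ennreal"
  assumes [measurable]: "\<phi> \<in> borel_measurable M" "A \<in> sets M" and c: "0 < c"
  shows "emeasure M {x\<in>A. ennreal c < \<phi> x} \<le> ennreal (1 / c) * (\<integral>\<^sup>+x\<in>A. \<phi> x \<partial>M)"
proof -
  have "emeasure M {x\<in>A. ennreal c < \<phi> x} \<le> emeasure M {x\<in>A. 1 \<le> ennreal (1 / c) * \<phi> x}"
  proof (rule emeasure_mono)
    show "{x\<in>A. ennreal c < \<phi> x} \<subseteq> {x\<in>A. 1 \<le> ennreal (1 / c) * \<phi> x}"
    proof safe
      fix x assume "ennreal c < \<phi> x"
      then have "ennreal (1 / c) * ennreal c \<le> ennreal (1 / c) * \<phi> x" by (intro mult_left_mono) auto
      moreover have "ennreal (1 / c) * ennreal c = 1" using c by (simp add: ennreal_mult[symmetric])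
      ultimately show "1 \<le> ennreal (1 / c) * \<phi> x" by simp
    qed
    show "{x\<in>A. 1 \<le> ennreal (1 / c) * \<phi> x} \<in> sets M"
    proof -
      have "{x\<in>A. 1 \<le> ennreal (1 / c) * \<phi> x} = A \<inter> {x\<in>space M. 1 \<le> ennreal (1 / c) * \<phi> x}"
        using sets.sets_into_space[OF assms(2)] by auto
      then show ?thesis by simp
    qed
  qed
  also have "\<dots> \<le> ennreal (1 / c) * (\<integral>\<^sup>+x\<in>A. \<phi> x \<partial>M)"
    by (rule nn_integral_Markov_inequality) auto
  finally show ?thesis .
qed

text \<open>This replaces Lebesgue's differentiation theorem: outer regularity shows that the integral of
  \<open>\<phi>\<close> over the exceptional set is at most \<open>lam\<close> times its measure.\<close>

lemma AE_le_off_dcubes: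
  fixes \<phi> :: "real^'n \<Rightarrow> ennreal"
  assumes L: "0 < L" and \<phi>[measurable]: "\<phi> \<in> borel_measurable lebesgue"
    and fin: "(\<integral>\<^sup>+x. \<phi> x \<partial>lebesgue) < \<infinity>" and lam: "0 < lam" and S[measurable]: "S \<in> sets lebesgue"
    and bd: "\<And>q x. x \<in> S \<Longrightarrow> x \<in> dcube L q \<Longrightarrow>
      (\<integral>\<^sup>+y\<in>dcube L q. \<phi> y \<partial>lebesgue) \<le> ennreal lam * emeasure lebesgue (dcube L q)"
  shows "AE x in lebesgue. x \<in> S \<longrightarrow> \<phi> x \<le> ennreal lam"
proof -
  define F where "F = {x\<in>S. ennreal lam < \<phi> x}"
  have F_eq: "F = S \<inter> {x\<in>space lebesgue. ennreal lam < \<phi> x}" by (auto simp: F_def)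
  have Fm[measurable]: "F \<in> sets lebesgue" unfolding F_eq by measurable
  have "emeasure lebesgue F \<le> ennreal (1 / lam) * (\<integral>\<^sup>+x\<in>S. \<phi> x \<partial>lebesgue)"
    unfolding F_def by (rule emeasure_gt_le) (use lam in auto)
  also have "\<dots> \<le> ennreal (1 / lam) * (\<integral>\<^sup>+x. \<phi> x \<partial>lebesgue)"
    by (intro mult_left_mono nn_integral_mono) (auto simp: indicator_def)
  also have "\<dots> < \<infinity>" using fin by (auto simp: ennreal_mult_less_top)
  finally have Ffin: "emeasure lebesgue F < \<infinity>" .
  have key: "(\<integral>\<^sup>+x\<in>F. \<phi> x \<partial>lebesgue) \<le> ennreal lam * emeasure lebesgue F + ennreal e" if e: "0 < e" for e
  proof -
    obtain U where U: "open U" "F \<subseteq> U" "(U - F) \<in> lmeasurable" "emeasure lebesgue (U - F) < ennreal (e / lam)"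
      by (rule sets_lebesgue_outer_open[OF Fm, of "e / lam"]) (use e lam in auto)
    \<comment> \<open>Cubes must meet S for \<open>bd\<close> to apply, and lie in U so that their
      union exceeds F by measure at most e/lam.\<close>
    define P where "P q \<longleftrightarrow> dcube L q \<subseteq> U \<and> dcube L q \<inter> S \<noteq> {}" for q
    let ?I = "dmax L P"
    have cov: "F \<subseteq> (\<Union>q\<in>?I. dcube L q)"
    proof
      fix x assume x: "x \<in> F"
      then obtain j where "dcube L (j, didx L j x) \<subseteq> U"
        using dcube_in_open[OF L U(1), of x 0] U(2) by auto
      moreover have "x \<in> dcube L (j, didx L j x) \<inter> S" using x by (auto simp: F_def dcube_self)
      ultimately have "P (j, didx L j x)" unfolding P_def by auto
      then show "x \<in> (\<Union>q\<in>?I. dcube L q)" using dmax_cover[of P j L x] by auto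
    qed
    have "(\<integral>\<^sup>+x\<in>F. \<phi> x \<partial>lebesgue) \<le> (\<integral>\<^sup>+x\<in>(\<Union>q\<in>?I. dcube L q). \<phi> x \<partial>lebesgue)"
      using cov by (intro nn_integral_mono) (auto simp: indicator_def)
    also have "\<dots> = (\<integral>\<^sup>+q. (\<integral>\<^sup>+x\<in>dcube L q. \<phi> x \<partial>lebesgue) \<partial>count_space ?I)"
      by (rule nn_integral_disjoint_UN[OF _ dmax_disjoint]) (use L in auto)
    also have "\<dots> \<le> (\<integral>\<^sup>+q. ennreal lam * emeasure lebesgue (dcube L q) \<partial>count_space ?I)"
    proof (rule nn_integral_mono)
      fix q assume "q \<in> space (count_space ?I)"
      then have "P q" by (auto intro: dmaxD)
      then obtain x where "x \<in> S" "x \<in> dcube L q" by (auto simp: P_def)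
      then show "(\<integral>\<^sup>+x\<in>dcube L q. \<phi> x \<partial>lebesgue) \<le> ennreal lam * emeasure lebesgue (dcube L q)"
        by (rule bd)
    qed
    also have "\<dots> = ennreal lam * (\<integral>\<^sup>+q. emeasure lebesgue (dcube L q) \<partial>count_space ?I)"
      by (rule nn_integral_cmult) auto
    also have "\<dots> = ennreal lam * emeasure lebesgue (\<Union>q\<in>?I. dcube L q)"
      by (subst emeasure_UN_countable[OF _ _ dmax_disjoint]) (use L in auto)
    also have "\<dots> \<le> ennreal lam * emeasure lebesgue (F \<union> (U - F))"
    proof (intro mult_left_mono emeasure_mono)
      show "(\<Union>q\<in>?I. dcube L q) \<subseteq> F \<union> (U - F)" using dmaxD[of _ L P] by (fastforce simp: P_def)
    qed (use U in auto)
    also have "\<dots> \<le> ennreal lam * (emeasure lebesgue F + emeasure lebesgue (U - F))"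
      by (intro mult_left_mono emeasure_subadditive) (use U in auto)
    also have "\<dots> \<le> ennreal lam * (emeasure lebesgue F + ennreal (e / lam))"
      using U(4) by (intro mult_left_mono add_left_mono) auto
    also have "\<dots> = ennreal lam * emeasure lebesgue F + ennreal e"
      using lam e by (simp add: distrib_left ennreal_mult[symmetric])
    finally show ?thesis .
  qed
  \<comment> \<open>Once lam |F|, finite by \<open>Ffin\<close>, is cancelled on both sides, the
    excess of phi over lam has integral 0 on F; but it is positive there, so F is null.\<close>
  have le: "(\<integral>\<^sup>+x\<in>F. \<phi> x \<partial>lebesgue) \<le> ennreal lam * emeasure lebesgue F"
    by (rule ennreal_le_epsilon) (use key in auto)
  have "(\<integral>\<^sup>+x\<in>F. \<phi> x \<partial>lebesgue) = (\<integral>\<^sup>+x. (\<phi> x - ennreal lam) * indicator F x + ennreal lam * indicator F x \<partial>lebesgue)"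
    by (intro nn_integral_cong) (auto simp: F_def indicator_def diff_add_cancel_ennreal less_imp_le)
  also have "\<dots> = (\<integral>\<^sup>+x\<in>F. (\<phi> x - ennreal lam) \<partial>lebesgue) + ennreal lam * emeasure lebesgue F"
    by (subst nn_integral_add) (auto simp: nn_integral_cmult_indicator)
  finally have "(\<integral>\<^sup>+x\<in>F. (\<phi> x - ennreal lam) \<partial>lebesgue) + ennreal lam * emeasure lebesgue F
     \<le> 0 + ennreal lam * emeasure lebesgue F" using le by simp
  then have "(\<integral>\<^sup>+x\<in>F. (\<phi> x - ennreal lam) \<partial>lebesgue) = 0"
    using Ffin by (auto simp: ennreal_mult_eq_top_iff ennreal_add_left_cancel_le add.commute less_top)
  then have "AE x in lebesgue. (\<phi> x - ennreal lam) * indicator F x = 0"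
    by (subst (asm) nn_integral_0_iff_AE) auto
  then show ?thesis
  proof eventually_elim
    case (elim x)
    show ?case
    proof (rule impI, rule ccontr)
      assume x: "x \<in> S" "\<not> \<phi> x \<le> ennreal lam"
      then have "0 < \<phi> x - ennreal lam" by (intro diff_gr0_ennreal) (auto simp: not_le)
      with x elim show False by (auto simp: F_def indicator_def)
    qed
  qed
qed

text \<open>The hypotheses in working form. \<open>cT\<close> bounds squared norms, so it is the
  square of an operator bound. The two smoothness conditions are separated because they do different
  jobs: variation in the first variable compares values of the operator at two points
  (\<open>kernel_osc\<close>), variation in the second exploits mean zero
  (\<open>kernel_cancel\<close>).\<close>

locale czo =
  fixes T :: "(real^'n \<Rightarrow> complex) \<Rightarrow> (real^'n \<Rightarrow> complex)"
    and K :: "real^'n \<Rightarrow> real^'n \<Rightarrow> complex" and cK \<delta> cT :: real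
  assumes T_L2: "in_L2 f \<Longrightarrow> in_L2 (T f)"
    and T_add: "in_L2 f \<Longrightarrow> in_L2 g \<Longrightarrow> AE x in lebesgue. T (\<lambda>y. f y + g y) x = T f x + T g x"
    and T_bound: "in_L2 f \<Longrightarrow> L2_sq (T f) \<le> ennreal cT * L2_sq f"
    and cT: "0 \<le> cT" and cK: "0 < cK" and delta: "0 < \<delta>"
    and K_size: "x \<noteq> y \<Longrightarrow> norm (K x y) \<le> cK / dist x y ^ CARD('n)"
    and K_smooth1: "dist x x' < dist x y / 2 \<Longrightarrow>
      norm (K x y - K x' y) \<le> cK * (dist x x' powr \<delta> / dist x y powr (real CARD('n) + \<delta>))"
    and K_smooth2: "dist x x' < dist x y / 2 \<Longrightarrow>
      norm (K y x - K y x') \<le> cK * (dist x x' powr \<delta> / dist x y powr (real CARD('n) + \<delta>))"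
    and T_kernel: "has_kernel T K"
begin

section \<open>Measurability and size of kernel integrals; first consequences of boundedness\<close>

lemma T_meas: "in_L2 f \<Longrightarrow> T f \<in> borel_measurable lebesgue"
  by (intro in_L2_meas T_L2)

text \<open>Measurability of the kernel is not among the hypotheses; it is drawn from smoothness in
  the second variable through continuity off the diagonal.\<close>

lemma K_cont: "continuous_on (-{x}) (K x)"
  unfolding continuous_on_def
proof
  fix y assume "y \<in> -{x}"
  then have d: "0 < dist y x" by auto
  have "((\<lambda>z. cK * (dist y z powr \<delta> / dist y x powr (real CARD('n) + \<delta>))) \<longlongrightarrow>
      cK * (dist y y powr \<delta> / dist y x powr (real CARD('n) + \<delta>))) (at y within -{x})"
    using d delta by (intro tendsto_intros) auto
  then have lim: "((\<lambda>z. cK * (dist y z powr \<delta> / dist y x powr (real CARD('n) + \<delta>))) \<longlongrightarrow> 0) (at y within -{x})"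
    by simp
  have "((\<lambda>z. K x z - K x y) \<longlongrightarrow> 0) (at y within -{x})"
  proof (rule Lim_null_comparison[OF _ lim])
    have "eventually (\<lambda>z. dist z y < dist y x / 2) (at y within -{x})"
      using d by (auto simp: eventually_at intro!: exI[of _ "dist y x / 2"])
    then show "eventually (\<lambda>z. norm (K x z - K x y) \<le>
        cK * (dist y z powr \<delta> / dist y x powr (real CARD('n) + \<delta>))) (at y within -{x})"
    proof eventually_elim
      case (elim z)
      then show ?case using K_smooth2[of y z x] by (simp add: dist_commute norm_minus_commute)
    qed
  qed
  then show "(K x \<longlongrightarrow> K x y) (at y within -{x})" by (simp add: Lim_null[symmetric])
qed

text \<open>The value of the kernel on the diagonal is arbitrary; f x = 0 removes it from the
  product.\<close>

lemma K_meas: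
  assumes "f \<in> borel_measurable lebesgue" "f x = 0"
  shows "(\<lambda>y. K x y * f y) \<in> borel_measurable lebesgue"
proof -
  have "(\<lambda>y. indicator (-{x}) y *\<^sub>R K x y) \<in> borel_measurable borel"
    by (rule borel_measurable_continuous_on_indicator[OF _ K_cont]) auto
  then have "(\<lambda>y. indicator (-{x}) y *\<^sub>R K x y) \<in> borel_measurable lebesgue"
    by (simp add: measurable_completion)
  then have "(\<lambda>y. (indicator (-{x}) y *\<^sub>R K x y) * f y) \<in> borel_measurable lebesgue"
    using assms(1) by (rule borel_measurable_times)
  moreover have "(\<lambda>y. (indicator (-{x}) y *\<^sub>R K x y) * f y) = (\<lambda>y. K x y * f y)"
    using assms(2) by (auto simp: indicator_def fun_eq_iff)
  ultimately show ?thesis by simp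
qed

lemma K_integrable:
  assumes f: "integrable lebesgue f" and r: "0 < \<rho>" and off: "\<And>y. f y \<noteq> 0 \<Longrightarrow> \<rho> \<le> dist x y"
  shows "integrable lebesgue (\<lambda>y. K x y * f y)"
proof (rule Bochner_Integration.integrable_bound)
  show "integrable lebesgue (\<lambda>y. complex_of_real (cK / \<rho> ^ CARD('n)) * f y)" using f by simp
  have "f x = 0" using off[of x] r by force
  then show "(\<lambda>y. K x y * f y) \<in> borel_measurable lebesgue" using f by (intro K_meas) auto
  show "AE y in lebesgue. norm (K x y * f y) \<le> norm (complex_of_real (cK / \<rho> ^ CARD('n)) * f y)"
  proof (rule AE_I2)
    fix y
    show "norm (K x y * f y) \<le> norm (complex_of_real (cK / \<rho> ^ CARD('n)) * f y)"
    proof (cases "f y = 0")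
      case False
      then have d: "\<rho> \<le> dist x y" by (rule off)
      then have "norm (K x y) \<le> cK / dist x y ^ CARD('n)" using r by (intro K_size) auto
      also have "\<dots> \<le> cK / \<rho> ^ CARD('n)" using d r cK by (intro divide_left_mono power_mono mult_pos_pos zero_less_power) auto
      finally have "norm (K x y) * norm (f y) \<le> cK / \<rho> ^ CARD('n) * norm (f y)" by (rule mult_right_mono) simp
      then show ?thesis using cK r by (simp add: norm_mult norm_divide norm_power)
    qed simp
  qed
qed

text \<open>Mean zero allows K x c to be subtracted under the integral, after which smoothness in
  the second variable yields the extra decay of order delta.\<close>

lemma kernel_cancel:
  assumes b: "integrable lebesgue b" "(\<integral>y. b y \<partial>lebesgue) = 0" and r: "0 < \<rho>"
    and supp: "\<And>y. b y \<noteq> 0 \<Longrightarrow> dist c y \<le> \<rho>" and x: "2 * \<rho> < dist c x"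
  shows "ennreal (norm (\<integral>y. K x y * b y \<partial>lebesgue)) \<le>
    ennreal (cK * (\<rho> powr \<delta> / dist c x powr (real CARD('n) + \<delta>))) * (\<integral>\<^sup>+y. ennreal (norm (b y)) \<partial>lebesgue)"
proof -
  let ?B = "cK * (\<rho> powr \<delta> / dist c x powr (real CARD('n) + \<delta>))"
  have [measurable]: "b \<in> borel_measurable lebesgue" using b by auto
  have i1: "integrable lebesgue (\<lambda>y. K x y * b y)"
  proof (rule K_integrable[OF b(1) r])
    fix y assume "b y \<noteq> 0"
    then have "dist c y \<le> \<rho>" by (rule supp)
    then show "\<rho> \<le> dist x y" using x dist_triangle[of c x y] by (simp add: dist_commute)
  qed
  have i2: "integrable lebesgue (\<lambda>y. K x c * b y)" using b by simp
  have "(\<integral>y. K x y * b y \<partial>lebesgue) = (\<integral>y. K x y * b y - K x c * b y \<partial>lebesgue)"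
    using i1 i2 b(2) by simp
  then have "ennreal (norm (\<integral>y. K x y * b y \<partial>lebesgue)) \<le> (\<integral>\<^sup>+y. ennreal (norm (K x y * b y - K x c * b y)) \<partial>lebesgue)"
    using integral_norm_bound_ennreal[OF Bochner_Integration.integrable_diff[OF i1 i2]] by (simp only:)
  also have "\<dots> \<le> (\<integral>\<^sup>+y. ennreal ?B * ennreal (norm (b y)) \<partial>lebesgue)"
  proof (rule nn_integral_mono)
    fix y
    show "ennreal (norm (K x y * b y - K x c * b y)) \<le> ennreal ?B * ennreal (norm (b y))"
    proof (cases "b y = 0")
      case False
      then have d: "dist c y \<le> \<rho>" by (rule supp)
      then have "norm (K x c - K x y) \<le> cK * (dist c y powr \<delta> / dist c x powr (real CARD('n) + \<delta>))"
        using x r by (intro K_smooth2) auto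
      also have "\<dots> \<le> ?B" using d delta cK by (intro mult_left_mono divide_right_mono powr_mono2) auto
      finally have "norm (K x y - K x c) * norm (b y) \<le> ?B * norm (b y)"
        by (intro mult_right_mono) (auto simp: norm_minus_commute)
      moreover have "norm (K x y * b y - K x c * b y) = norm (K x y - K x c) * norm (b y)"
        by (simp add: norm_mult[symmetric] left_diff_distrib)
      ultimately show ?thesis using cK by (simp add: ennreal_mult[symmetric] ennreal_leI)
    qed simp
  qed
  also have "\<dots> = ennreal ?B * (\<integral>\<^sup>+y. ennreal (norm (b y)) \<partial>lebesgue)"
    by (rule nn_integral_cmult) auto
  finally show ?thesis .
qed

text \<open>T acts on representatives, and boundedness makes it respect null sets: a function of
  norm 0 has an image of norm 0.\<close>

lemma T_cong0:
  assumes f: "in_L2 f" and z: "AE x in lebesgue. f x = 0"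
  shows "AE x in lebesgue. T f x = 0"
proof -
  have [measurable]: "T f \<in> borel_measurable lebesgue" using f by (rule T_meas)
  have "L2_sq f = 0" unfolding L2_sq_def using z
    by (subst nn_integral_0_iff_AE) (use in_L2_meas[OF f] in auto)
  then have "L2_sq (T f) = 0" using T_bound[OF f] by simp
  then have "AE x in lebesgue. ennreal ((norm (T f x))\<^sup>2) = 0"
    unfolding L2_sq_def by (subst (asm) nn_integral_0_iff_AE) auto
  then show ?thesis by eventually_elim simp
qed

lemma T_sum:
  assumes "finite I" "\<And>i. i \<in> I \<Longrightarrow> in_L2 (b i)"
  shows "AE x in lebesgue. T (\<lambda>y. \<Sum>i\<in>I. b i y) x = (\<Sum>i\<in>I. T (b i) x)"
  using assms
proof (induction rule: finite_induct)
  case empty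
  then show ?case using T_cong0[OF in_L2_zero] by simp
next
  case (insert i I)
  have "AE x in lebesgue. T (\<lambda>y. b i y + (\<Sum>i\<in>I. b i y)) x = T (b i) x + T (\<lambda>y. \<Sum>i\<in>I. b i y) x"
    using insert by (intro T_add in_L2_sum) auto
  moreover have "AE x in lebesgue. T (\<lambda>y. \<Sum>i\<in>I. b i y) x = (\<Sum>i\<in>I. T (b i) x)"
    using insert by auto
  ultimately show ?case using insert by (simp; elim AE_mp; intro AE_I2) auto
qed

lemma T_level_bound:
  assumes f: "in_L2 f" and l: "0 < lam"
  shows "emeasure lebesgue {x. lam < norm (T f x)} \<le> ennreal (cT / lam\<^sup>2) * L2_sq f"
proof -
  have [measurable]: "T f \<in> borel_measurable lebesgue" using f by (rule T_meas)
  have "emeasure lebesgue {x. lam < norm (T f x)} \<le> emeasure lebesgue {x\<in>UNIV. ennreal (lam\<^sup>2) < ennreal ((norm (T f x))\<^sup>2)}"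
  proof (rule emeasure_mono)
    show "{x\<in>UNIV. ennreal (lam\<^sup>2) < ennreal ((norm (T f x))\<^sup>2)} \<in> sets lebesgue"
      using measurable_sets[of "\<lambda>x. ennreal ((norm (T f x))\<^sup>2)" lebesgue borel "{ennreal (lam\<^sup>2)<..}"] by (simp add: vimage_def)
    show "{x. lam < norm (T f x)} \<subseteq> {x\<in>UNIV. ennreal (lam\<^sup>2) < ennreal ((norm (T f x))\<^sup>2)}"
      using l by (auto simp: ennreal_less_iff intro: power_strict_mono)
  qed
  also have "\<dots> \<le> ennreal (1 / lam\<^sup>2) * (\<integral>\<^sup>+x\<in>UNIV. ennreal ((norm (T f x))\<^sup>2) \<partial>lebesgue)"
    by (rule emeasure_gt_le) (use l in auto)
  also have "\<dots> = ennreal (1 / lam\<^sup>2) * L2_sq (T f)" by (simp add: L2_sq_def)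
  also have "\<dots> \<le> ennreal (1 / lam\<^sup>2) * (ennreal cT * L2_sq f)" by (intro mult_left_mono T_bound f) auto
  also have "\<dots> = ennreal (cT / lam\<^sup>2) * L2_sq f"
    using cT by (simp add: mult.assoc[symmetric] ennreal_mult[symmetric])
  finally show ?thesis .
qed

end

section \<open>The weak type (1,1) bound\<close>

lemma integral_indicator_times_const:
  fixes c :: complex
  assumes "A \<in> sets M" "emeasure M A < \<infinity>"
  shows "(\<integral>x. indicator A x * c \<partial>M) = complex_of_real (measure M A) * c"
proof -
  have "(\<lambda>x. indicator A x * c) = (\<lambda>x. indicat_real A x *\<^sub>R c)"
    by (auto simp: indicator_def fun_eq_iff)
  moreover have "A \<inter> space M = A" using sets.sets_into_space[OF assms(1)] by auto
  ultimately show ?thesis using assms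
    by (simp add: scaleR_conv_of_real less_top)
qed

lemma lebesgue_Compl: "A \<in> sets lebesgue \<Longrightarrow> - A \<in> sets lebesgue"
  using sets.compl_sets[of A lebesgue] by (simp add: Compl_eq_Diff_UNIV)

lemma nn_integral_split_UN:
  fixes \<phi> :: "'a \<Rightarrow> ennreal"
  assumes [measurable]: "\<phi> \<in> borel_measurable M" and fin: "finite I" and A: "\<And>q. q \<in> I \<Longrightarrow> A q \<in> sets M"
    and disj: "disjoint_family_on A I"
  shows "(\<integral>\<^sup>+x. \<phi> x \<partial>M) = (\<integral>\<^sup>+x. \<phi> x * indicator (- (\<Union>q\<in>I. A q)) x \<partial>M) + (\<Sum>q\<in>I. \<integral>\<^sup>+x\<in>A q. \<phi> x \<partial>M)"
proof -
  have U[measurable]: "(\<Union>q\<in>I. A q) \<in> sets M" using fin A by auto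
  have "(\<integral>\<^sup>+x. \<phi> x \<partial>M) = (\<integral>\<^sup>+x. \<phi> x * indicator (space M - (\<Union>q\<in>I. A q)) x + (\<Sum>q\<in>I. \<phi> x * indicator (A q) x) \<partial>M)"
  proof (rule nn_integral_cong)
    fix x assume x: "x \<in> space M"
    have "(\<Sum>q\<in>I. \<phi> x * indicator (A q) x) = \<phi> x * indicator (\<Union>q\<in>I. A q) x"
      unfolding indicator_UN_disjoint[OF fin disj] by (rule sum_distrib_left[symmetric])
    then show "\<phi> x = \<phi> x * indicator (space M - (\<Union>q\<in>I. A q)) x + (\<Sum>q\<in>I. \<phi> x * indicator (A q) x)"
      using x by (auto simp: indicator_def)
  qed
  also have "\<dots> = (\<integral>\<^sup>+x. \<phi> x * indicator (space M - (\<Union>q\<in>I. A q)) x \<partial>M) + (\<integral>\<^sup>+x. (\<Sum>q\<in>I. \<phi> x * indicator (A q) x) \<partial>M)"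
    using A by (intro nn_integral_add borel_measurable_sum borel_measurable_times_ennreal borel_measurable_indicator) auto
  also have "(\<integral>\<^sup>+x. (\<Sum>q\<in>I. \<phi> x * indicator (A q) x) \<partial>M) = (\<Sum>q\<in>I. \<integral>\<^sup>+x\<in>A q. \<phi> x \<partial>M)"
    using A by (intro nn_integral_sum) auto
  also have "(\<integral>\<^sup>+x. \<phi> x * indicator (space M - (\<Union>q\<in>I. A q)) x \<partial>M) = (\<integral>\<^sup>+x. \<phi> x * indicator (- (\<Union>q\<in>I. A q)) x \<partial>M)"
    by (intro nn_integral_cong) (auto simp: indicator_def)
  finally show ?thesis .
qed

context czo
begin

text \<open>The constant of \<open>tail_bound\<close>: 2^n times the sum of the geometric series
  with ratio 2^(-delta).\<close>

definition tailc :: real where "tailc = 2 ^ CARD('n) / (1 - 2 powr - \<delta>)"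

lemma tailc_pos: "0 < tailc"
  using delta by (simp add: tailc_def powr_less_one)

text \<open>One summand for each exceptional set in \<open>weak_type_1_1_finite\<close>: the good
  function, the balls around the cubes, and the bad functions outside these balls.\<close>

definition weak_const :: real where
  "weak_const = 4 * cT * 2 ^ CARD('n) + unit_ball_vol (real CARD('n)) * (3 * real CARD('n)) ^ CARD('n) + 4 * cK * tailc * unit_ball_vol (real CARD('n))"

text \<open>Away from the support T b is a kernel integral, so the pointwise decay of
  \<open>kernel_cancel\<close> is integrated by \<open>tail_bound\<close> with F = 1, whose averages
  are the volume of the unit ball.\<close>

lemma T_cancel_tail:
  assumes b: "in_L2 b" "integrable lebesgue b" "(\<integral>y. b y \<partial>lebesgue) = 0" and r: "0 < \<rho>"
    and supp: "\<And>y. b y \<noteq> 0 \<Longrightarrow> dist c y \<le> \<rho>"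
  shows "(\<integral>\<^sup>+x\<in>{x. 3 * \<rho> \<le> dist c x}. ennreal (norm (T b x)) \<partial>lebesgue)
    \<le> ennreal (cK * tailc * unit_ball_vol (real CARD('n))) * (\<integral>\<^sup>+y. ennreal (norm (b y)) \<partial>lebesgue)"
proof -
  let ?B = "\<integral>\<^sup>+y. ennreal (norm (b y)) \<partial>lebesgue"
  let ?k = "\<lambda>x. (3 * \<rho>) powr \<delta> / dist c x powr (real CARD('n) + \<delta>)"
  have clo: "closure {y. b y \<noteq> 0} \<subseteq> cball c \<rho>"
    by (rule closure_minimal) (use supp in auto)
  have "compact (closure {y. b y \<noteq> 0})"
    using clo by (meson compact_cball compact_eq_bounded_closed bounded_subset closed_closure)
  then have "AE x in lebesgue. x \<notin> closure {y. b y \<noteq> 0} \<longrightarrow> T b x = (\<integral>y. K x y * b y \<partial>lebesgue)"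
    using T_kernel b(1) unfolding has_kernel_def by blast
  then have "AE x in lebesgue. ennreal (norm (T b x)) * indicator {x. 3 * \<rho> \<le> dist c x} x
      \<le> (ennreal cK * ?B) * (1 * ennreal (?k x) * indicator {x. 3 * \<rho> \<le> dist c x} x)"
  proof eventually_elim
    case (elim x)
    show ?case
    proof (cases "3 * \<rho> \<le> dist c x")
      case True
      have "x \<notin> closure {y. b y \<noteq> 0}" using True r clo by auto
      then have "ennreal (norm (T b x)) \<le> ennreal (cK * (\<rho> powr \<delta> / dist c x powr (real CARD('n) + \<delta>))) * ?B"
        using elim True r by (simp only: not_False_eq_True simp_thms)
          (rule kernel_cancel[OF b(2,3) r supp], auto)
      \<comment> \<open>Enlarging the numerator to (3 rho)^delta gives the weight the shape of
        \<open>tail_bound\<close> with inner radius 3 rho.\<close>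
      also have "\<dots> \<le> ennreal (cK * ?k x) * ?B"
        using r cK delta by (intro mult_right_mono ennreal_leI mult_left_mono divide_right_mono powr_mono2) auto
      also have "\<dots> = (ennreal cK * ?B) * (1 * ennreal (?k x) * 1)"
      proof -
        have "ennreal (cK * ?k x) = ennreal cK * ennreal (?k x)" by (rule ennreal_mult) (use cK in auto)
        then show ?thesis by (simp only: mult_ac mult_1)
      qed
      finally show ?thesis using True by simp
    qed auto
  qed
  then have "(\<integral>\<^sup>+x\<in>{x. 3 * \<rho> \<le> dist c x}. ennreal (norm (T b x)) \<partial>lebesgue)
     \<le> (\<integral>\<^sup>+x. (ennreal cK * ?B) * (1 * ennreal (?k x) * indicator {x. 3 * \<rho> \<le> dist c x} x) \<partial>lebesgue)"
    by (rule nn_integral_mono_AE)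
  also have "\<dots> = (ennreal cK * ?B) * (\<integral>\<^sup>+x\<in>{x. 3 * \<rho> \<le> dist c x}. 1 * ennreal (?k x) \<partial>lebesgue)"
  proof (rule nn_integral_cmult)
    have "(\<lambda>x. 1 * ennreal (?k x) * indicator {x. 3 * \<rho> \<le> dist c x} x) \<in> borel_measurable borel"
      by measurable
    then show "(\<lambda>x. 1 * ennreal (?k x) * indicator {x. 3 * \<rho> \<le> dist c x} x) \<in> borel_measurable lebesgue"
      by (simp add: measurable_completion)
  qed
  also have "\<dots> \<le> (ennreal cK * ?B) * (ennreal (2 ^ CARD('n) / (1 - 2 powr - \<delta>)) * ennreal (unit_ball_vol (real CARD('n))))"
  proof (rule mult_left_mono)
    show "(\<integral>\<^sup>+x\<in>{x. 3 * \<rho> \<le> dist c x}. 1 * ennreal (?k x) \<partial>lebesgue) \<le> ennreal (2 ^ CARD('n) / (1 - 2 powr - \<delta>)) * ennreal (unit_ball_vol (real CARD('n)))"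
      by (rule tail_bound[OF delta]) (use r in \<open>auto simp: emeasure_ball ennreal_mult\<close>)
  qed simp
  also have "\<dots> = ennreal (cK * tailc * unit_ball_vol (real CARD('n))) * ?B"
    using cK tailc_pos unfolding tailc_def[symmetric] by (simp add: ennreal_mult mult_ac)
  finally show ?thesis .
qed

text \<open>Calderon--Zygmund decomposition with finitely many cubes, so that only finite additivity of \<open>T\<close>
  enters; the general case follows by truncating \<open>f\<close> and using \<open>L\<^sup>2\<close> continuity.\<close>

lemma weak_type_1_1_finite:
  fixes I :: "(nat \<times> ('n \<Rightarrow> int)) set"
  assumes L: "0 < L" and fin: "finite I" and disj: "disjoint_family_on (dcube L) I" and lam: "0 < lam"
    and f: "in_L2 f" and f1: "(\<integral>\<^sup>+x. ennreal (norm (f x)) \<partial>lebesgue) < \<infinity>"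
    and lo: "\<And>q. q \<in> I \<Longrightarrow> ennreal lam * emeasure lebesgue (dcube L q) \<le> (\<integral>\<^sup>+x\<in>dcube L q. ennreal (norm (f x)) \<partial>lebesgue)"
    and hi: "\<And>q. q \<in> I \<Longrightarrow> (\<integral>\<^sup>+x\<in>dcube L q. ennreal (norm (f x)) \<partial>lebesgue) \<le> ennreal (2 ^ CARD('n) * lam) * emeasure lebesgue (dcube L q)"
    and off: "AE x in lebesgue. x \<notin> (\<Union>q\<in>I. dcube L q) \<longrightarrow> norm (f x) \<le> lam"
  shows "emeasure lebesgue {x. lam < norm (T f x)} \<le> ennreal (weak_const / lam) * (\<integral>\<^sup>+x. ennreal (norm (f x)) \<partial>lebesgue)"
proof -
  let ?n = "CARD('n)" and ?D = "dcube L :: nat \<times> ('n \<Rightarrow> int) \<Rightarrow> (real^'n) set" and ?U = "\<Union>q\<in>I. dcube L q"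
  let ?N = "\<integral>\<^sup>+x. ennreal (norm (f x)) \<partial>lebesgue"
  define Nq where "Nq q = (\<integral>\<^sup>+x\<in>?D q. ennreal (norm (f x)) \<partial>lebesgue)" for q
  \<comment> \<open>The mean of f over the cube. Subtracting it gives each bad function
    \<open>b q\<close> mean zero; the good function g is this mean on the cubes and f off
    them.\<close>
  define a where "a q = (\<integral>x. indicator (?D q) x * f x \<partial>lebesgue) / complex_of_real (dside L q ^ ?n)" for q
  define b where "b q x = indicator (?D q) x * f x + indicator (?D q) x * (- a q)" for q x
  define g where "g x = indicator (- ?U) x * f x + (\<Sum>q\<in>I. indicator (?D q) x * a q)" for x
  have [measurable]: "f \<in> borel_measurable lebesgue" using f by (rule in_L2_meas)
  have Dm[measurable]: "?D q \<in> sets lebesgue" for q using L by simp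
  have Um[measurable]: "?U \<in> sets lebesgue" using fin by auto
  have Ucm[measurable]: "- ?U \<in> sets lebesgue"
    using Um by (rule lebesgue_Compl)
  have s: "0 < dside L q" for q :: "nat \<times> ('n \<Rightarrow> int)" using L by (rule dside_pos)
  have De: "emeasure lebesgue (?D q) = ennreal (dside L q ^ ?n)" for q using L by (rule emeasure_dcube)
  have Dfin: "emeasure lebesgue (?D q) < \<infinity>" for q unfolding De by simp
  have Dms: "measure lebesgue (?D q) = dside L q ^ ?n" for q
    using s[of q] De[of q] by (simp add: measure_def)
  have fi: "integrable lebesgue (\<lambda>x. indicator (?D q) x * f x)" for q
    by (rule in_L2_integrable_on[OF f Dm Dfin])
  have a_le: "ennreal (norm (a q)) * ennreal (dside L q ^ ?n) \<le> Nq q" for q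
  proof -
    have "ennreal (norm (a q)) * ennreal (dside L q ^ ?n) = ennreal (norm (\<integral>x. indicator (?D q) x * f x \<partial>lebesgue))"
      using s[of q] by (simp add: a_def norm_divide norm_power ennreal_mult[symmetric])
    also have "\<dots> \<le> (\<integral>\<^sup>+x. ennreal (norm (indicator (?D q) x * f x)) \<partial>lebesgue)"
      by (rule integral_norm_bound_ennreal[OF fi])
    also have "\<dots> = Nq q" unfolding Nq_def by (intro nn_integral_cong) (auto simp: indicator_def)
    finally show ?thesis .
  qed
  have a_le2: "norm (a q) \<le> 2 ^ ?n * lam" if "q \<in> I" for q
  proof -
    have "ennreal (norm (a q)) * ennreal (dside L q ^ ?n) \<le> ennreal (2 ^ ?n * lam) * ennreal (dside L q ^ ?n)"
      using a_le[of q] hi[OF that] unfolding Nq_def De by (rule order_trans)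
    then show ?thesis using s[of q] lam by (simp add: ennreal_mult[symmetric])
  qed
  have L2a: "in_L2 (\<lambda>x. indicator (?D q) x * c)" for q c
    by (rule in_L2_const_indicator[OF Dm Dfin])
  have L2b: "in_L2 (b q)" for q unfolding b_def by (intro in_L2_add in_L2_indicator f Dm L2a)
  have L2g: "in_L2 g" unfolding g_def by (intro in_L2_add in_L2_indicator[OF f Ucm] in_L2_sum[OF fin] L2a)
  have [measurable]: "g \<in> borel_measurable lebesgue" "b q \<in> borel_measurable lebesgue"
      "T g \<in> borel_measurable lebesgue" "T (b q) \<in> borel_measurable lebesgue" "T f \<in> borel_measurable lebesgue" for q
    using in_L2_meas[OF L2g] in_L2_meas[OF L2b] T_meas[OF L2g] T_meas[OF L2b] T_meas[OF f] by blast+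
  have sum_ind: "(\<Sum>q\<in>I. indicator (?D q) x * h q) = h q0" if "q0 \<in> I" "x \<in> ?D q0" for x q0 and h :: "_ \<Rightarrow> complex"
  proof -
    have "(\<Sum>q\<in>I. indicator (?D q) x * h q) = (\<Sum>q\<in>{q0}. indicator (?D q) x * h q)"
      using that disj fin by (intro sum.mono_neutral_right) (auto simp: disjoint_family_on_def indicator_def)
    then show ?thesis using that by simp
  qed
  have sum_ind0: "(\<Sum>q\<in>I. indicator (?D q) x * h q) = 0" if "x \<notin> ?U" for x and h :: "_ \<Rightarrow> complex"
    using that by (intro sum.neutral) (auto simp: indicator_def)
  have f_eq: "f = (\<lambda>x. g x + (\<Sum>q\<in>I. b q x))"
  proof
    fix x
    have "(\<Sum>q\<in>I. b q x) = (\<Sum>q\<in>I. indicator (?D q) x * (f x - a q))"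
      by (intro sum.cong) (auto simp: b_def algebra_simps)
    then show "f x = g x + (\<Sum>q\<in>I. b q x)"
      by (cases "x \<in> ?U") (auto simp: g_def sum_ind sum_ind0)
  qed
  have gq: "g x = a q" if "q \<in> I" "x \<in> ?D q" for q x
    unfolding g_def sum_ind[OF that] using that by (auto simp: indicator_def)
  have split: "?N = (\<integral>\<^sup>+x. ennreal (norm (f x)) * indicator (- ?U) x \<partial>lebesgue) + (\<Sum>q\<in>I. Nq q)"
    unfolding Nq_def by (rule nn_integral_split_UN[OF _ fin _ disj]) auto
  have sumN: "(\<Sum>q\<in>I. Nq q) \<le> ?N" unfolding split by simp
  have g_bd: "AE x in lebesgue. norm (g x) \<le> 2 ^ ?n * lam"
    using off
  proof eventually_elim
    case (elim x)
    have "lam \<le> 2 ^ ?n * lam" using lam by simp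
    then show ?case using elim a_le2
      by (cases "x \<in> ?U") (auto simp: g_def sum_ind sum_ind0)
  qed
  have g1: "(\<integral>\<^sup>+x. ennreal (norm (g x)) \<partial>lebesgue) \<le> ?N"
  proof -
    have "(\<integral>\<^sup>+x. ennreal (norm (g x)) \<partial>lebesgue) = (\<integral>\<^sup>+x. ennreal (norm (g x)) * indicator (- ?U) x \<partial>lebesgue) + (\<Sum>q\<in>I. \<integral>\<^sup>+x\<in>?D q. ennreal (norm (g x)) \<partial>lebesgue)"
      by (rule nn_integral_split_UN[OF _ fin _ disj]) auto
    also have "\<dots> \<le> (\<integral>\<^sup>+x. ennreal (norm (f x)) * indicator (- ?U) x \<partial>lebesgue) + (\<Sum>q\<in>I. Nq q)"
    proof (intro add_mono sum_mono)
      show "(\<integral>\<^sup>+x. ennreal (norm (g x)) * indicator (- ?U) x \<partial>lebesgue) \<le> (\<integral>\<^sup>+x. ennreal (norm (f x)) * indicator (- ?U) x \<partial>lebesgue)"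
      proof (rule nn_integral_mono)
        fix x
        show "ennreal (norm (g x)) * indicator (- ?U) x \<le> ennreal (norm (f x)) * indicator (- ?U) x"
          by (cases "x \<in> ?U") (auto simp: g_def sum_ind0)
      qed
      fix q assume q: "q \<in> I"
      have "(\<integral>\<^sup>+x\<in>?D q. ennreal (norm (g x)) \<partial>lebesgue) = (\<integral>\<^sup>+x\<in>?D q. ennreal (norm (a q)) \<partial>lebesgue)"
      proof (rule nn_integral_cong)
        fix x
        show "ennreal (norm (g x)) * indicator (?D q) x = ennreal (norm (a q)) * indicator (?D q) x"
          by (cases "x \<in> ?D q") (simp_all add: gq[OF q])
      qed
      also have "\<dots> = ennreal (norm (a q)) * ennreal (dside L q ^ ?n)"
        by (subst nn_integral_cmult_indicator[OF Dm]) (simp only: De)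
      also have "\<dots> \<le> Nq q" by (rule a_le)
      finally show "(\<integral>\<^sup>+x\<in>?D q. ennreal (norm (g x)) \<partial>lebesgue) \<le> Nq q" .
    qed
    also have "\<dots> = ?N" by (rule split[symmetric])
    finally show ?thesis .
  qed
  \<comment> \<open>The bound |g| <= 2^n lam trades one power of |g| for the level, so the square
    norm is controlled by the integral of |f|.\<close>
  have "L2_sq g \<le> (\<integral>\<^sup>+x. ennreal (2 ^ ?n * lam) * ennreal (norm (g x)) \<partial>lebesgue)"
    unfolding L2_sq_def
  proof (rule nn_integral_mono_AE)
    show "AE x in lebesgue. ennreal ((norm (g x))\<^sup>2) \<le> ennreal (2 ^ ?n * lam) * ennreal (norm (g x))"
      using g_bd by eventually_elim
        (use lam in \<open>auto simp: power2_eq_square ennreal_mult[symmetric] intro!: ennreal_leI mult_right_mono\<close>)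
  qed
  also have "\<dots> = ennreal (2 ^ ?n * lam) * (\<integral>\<^sup>+x. ennreal (norm (g x)) \<partial>lebesgue)"
    by (rule nn_integral_cmult) auto
  also have "\<dots> \<le> ennreal (2 ^ ?n * lam) * ?N" by (rule mult_left_mono[OF g1]) simp
  finally have L2g_sq: "L2_sq g \<le> ennreal (2 ^ ?n * lam) * ?N" .

  have ai: "integrable lebesgue (\<lambda>x. indicator (?D q) x * (- a q))" for q
  proof -
    have "(\<lambda>x. indicator (?D q) x * (indicator (?D q) x * (- a q))) = (\<lambda>x. indicator (?D q) x * (- a q))"
      by (auto simp: indicator_def)
    then show ?thesis using in_L2_integrable_on[OF L2a[of q "- a q"] Dm[of q] Dfin[of q]] by simp
  qed
  have bi: "integrable lebesgue (b q)" for q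
    unfolding b_def by (rule Bochner_Integration.integrable_add[OF fi ai])
  have b0: "(\<integral>x. b q x \<partial>lebesgue) = 0" for q
  proof -
    have "(\<integral>x. b q x \<partial>lebesgue) = (\<integral>x. indicator (?D q) x * f x \<partial>lebesgue) + (\<integral>x. indicator (?D q) x * (- a q) \<partial>lebesgue)"
      unfolding b_def by (rule Bochner_Integration.integral_add[OF fi ai])
    also have "(\<integral>x. indicator (?D q) x * (- a q) \<partial>lebesgue) = complex_of_real (dside L q ^ ?n) * (- a q)"
      unfolding integral_indicator_times_const[OF Dm Dfin] Dms ..
    finally show ?thesis using s[of q] by (simp add: a_def)
  qed
  have b1: "(\<integral>\<^sup>+x. ennreal (norm (b q x)) \<partial>lebesgue) \<le> 2 * Nq q" for q
  proof -
    have "(\<integral>\<^sup>+x. ennreal (norm (b q x)) \<partial>lebesgue) \<le> (\<integral>\<^sup>+x. ennreal (norm (f x)) * indicator (?D q) x + ennreal (norm (a q)) * indicator (?D q) x \<partial>lebesgue)"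
    proof (rule nn_integral_mono)
      fix x
      show "ennreal (norm (b q x)) \<le> ennreal (norm (f x)) * indicator (?D q) x + ennreal (norm (a q)) * indicator (?D q) x"
        using norm_triangle_ineq4[of "f x" "a q"]
        by (auto simp: b_def indicator_def ennreal_plus[symmetric] simp del: ennreal_plus intro: ennreal_leI)
    qed
    also have "\<dots> = Nq q + ennreal (norm (a q)) * ennreal (dside L q ^ ?n)"
      by (subst nn_integral_add) (auto simp: Nq_def nn_integral_cmult_indicator De simp del: emeasure_completion)
    also have "\<dots> \<le> Nq q + Nq q" by (intro add_left_mono a_le)
    finally show ?thesis by (simp add: mult_2)
  qed
  \<comment> \<open>A ball of this radius about the corner contains the cube; the threefold ball is
    discarded into \<open>E2\<close>, and \<open>T_cancel_tail\<close> controls the bad function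
    outside it.\<close>
  define \<rho> where "\<rho> q = real ?n * dside L q" for q :: "nat \<times> ('n \<Rightarrow> int)"
  have r: "0 < \<rho> q" for q using s[of q] by (simp add: \<rho>_def)
  have bsupp: "dist (dcorner L q) y \<le> \<rho> q" if "b q y \<noteq> 0" for q y
  proof -
    have "y \<in> ?D q" using that by (auto simp: b_def indicator_def split: if_splits)
    then show ?thesis unfolding \<rho>_def by (intro dist_dcube_le[OF L dcorner_mem[OF L]])
  qed
  let ?F = "\<lambda>q. {x. 3 * \<rho> q \<le> dist (dcorner L q) x}"
  have Tb: "(\<integral>\<^sup>+x\<in>?F q. ennreal (norm (T (b q) x)) \<partial>lebesgue) \<le> ennreal (cK * tailc * unit_ball_vol (real CARD('n))) * (2 * Nq q)" for q
    by (rule order_trans[OF T_cancel_tail[OF L2b bi b0 r bsupp] mult_left_mono[OF b1]]) auto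

  \<comment> \<open>If |T f| > lam, then T g or the sum of the T (b q) exceeds lam/2.
    \<open>E3\<close> looks at the latter only off \<open>E2\<close>, where the integral of the sum
    is available.\<close>
  define E1 where "E1 = {x. lam / 2 < norm (T g x)}"
  define E2 where "E2 = (\<Union>q\<in>I. ball (dcorner L q) (3 * \<rho> q))"
  define E3 where "E3 = {x\<in>- E2. ennreal (lam / 2) < ennreal (norm (\<Sum>q\<in>I. T (b q) x))}"
  have E2m[measurable]: "E2 \<in> sets lebesgue" unfolding E2_def using fin by auto
  have E1m: "E1 \<in> sets lebesgue"
    using measurable_sets[of "\<lambda>x. norm (T g x)" lebesgue borel "{lam/2<..}"] by (simp add: vimage_def E1_def)
  have E3m: "E3 \<in> sets lebesgue"
  proof -
    have "(\<lambda>x. ennreal (norm (\<Sum>q\<in>I. T (b q) x))) \<in> borel_measurable lebesgue" by measurable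
    from measurable_sets[OF this, of "{ennreal (lam/2)<..}"]
    have "{x. ennreal (lam / 2) < ennreal (norm (\<Sum>q\<in>I. T (b q) x))} \<in> sets lebesgue" by (simp add: vimage_def)
    moreover have "E3 = {x. ennreal (lam / 2) < ennreal (norm (\<Sum>q\<in>I. T (b q) x))} - E2" by (auto simp: E3_def)
    ultimately show ?thesis using E2m by simp
  qed
  have m1: "emeasure lebesgue E1 \<le> ennreal (4 * cT * 2 ^ ?n / lam) * ?N"
  proof -
    have "emeasure lebesgue E1 \<le> ennreal (cT / (lam / 2)\<^sup>2) * L2_sq g"
      unfolding E1_def by (rule T_level_bound[OF L2g]) (use lam in auto)
    also have "\<dots> \<le> ennreal (cT / (lam / 2)\<^sup>2) * (ennreal (2 ^ ?n * lam) * ?N)" by (rule mult_left_mono[OF L2g_sq]) simp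
    also have "\<dots> = ennreal (cT / (lam / 2)\<^sup>2 * (2 ^ ?n * lam)) * ?N"
      using lam cT by (subst mult.assoc[symmetric], subst ennreal_mult[symmetric]) auto
    also have "cT / (lam / 2)\<^sup>2 * (2 ^ ?n * lam) = 4 * cT * 2 ^ ?n / lam"
      using lam by (simp add: power2_eq_square field_simps)
    finally show ?thesis .
  qed
  have m2: "emeasure lebesgue E2 \<le> ennreal (unit_ball_vol (real CARD('n)) * (3 * real ?n) ^ ?n / lam) * ?N"
  proof -
    have "emeasure lebesgue E2 \<le> (\<Sum>q\<in>I. emeasure lebesgue (ball (dcorner L q) (3 * \<rho> q)))"
      unfolding E2_def by (rule emeasure_subadditive_finite[OF fin]) auto
    also have "\<dots> \<le> (\<Sum>q\<in>I. ennreal (unit_ball_vol (real CARD('n)) * (3 * real ?n) ^ ?n / lam) * Nq q)"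
    proof (rule sum_mono)
      fix q assume q: "q \<in> I"
      have "emeasure lebesgue (ball (dcorner L q) (3 * \<rho> q)) = ennreal (unit_ball_vol (real CARD('n)) * (3 * \<rho> q) ^ ?n)"
        using r[of q] by (intro emeasure_lebesgue_ball) simp
      also have "unit_ball_vol (real CARD('n)) * (3 * \<rho> q) ^ ?n = unit_ball_vol (real CARD('n)) * (3 * real ?n) ^ ?n / lam * (lam * dside L q ^ ?n)"
        using lam by (simp add: \<rho>_def power_mult_distrib)
      also have "ennreal \<dots> = ennreal (unit_ball_vol (real CARD('n)) * (3 * real ?n) ^ ?n / lam) * (ennreal lam * emeasure lebesgue (?D q))"
        unfolding De using lam s[of q]
        by (intro trans[OF ennreal_mult] arg_cong2[where f = "(*)"] refl ennreal_mult) auto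
      also have "\<dots> \<le> ennreal (unit_ball_vol (real CARD('n)) * (3 * real ?n) ^ ?n / lam) * Nq q"
        unfolding Nq_def by (rule mult_left_mono[OF lo[OF q]]) simp
      finally show "emeasure lebesgue (ball (dcorner L q) (3 * \<rho> q)) \<le> \<dots>" .
    qed
    also have "\<dots> \<le> ennreal (unit_ball_vol (real CARD('n)) * (3 * real ?n) ^ ?n / lam) * ?N"
      unfolding sum_distrib_left[symmetric] by (rule mult_left_mono[OF sumN]) simp
    finally show ?thesis .
  qed
  have m3: "emeasure lebesgue E3 \<le> ennreal (4 * cK * tailc * unit_ball_vol (real CARD('n)) / lam) * ?N"
  proof -
    have "(\<integral>\<^sup>+x\<in>- E2. ennreal (norm (\<Sum>q\<in>I. T (b q) x)) \<partial>lebesgue)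
        \<le> (\<integral>\<^sup>+x. (\<Sum>q\<in>I. ennreal (norm (T (b q) x)) * indicator (?F q) x) \<partial>lebesgue)"
    proof (rule nn_integral_mono)
      fix x
      show "ennreal (norm (\<Sum>q\<in>I. T (b q) x)) * indicator (- E2) x \<le> (\<Sum>q\<in>I. ennreal (norm (T (b q) x)) * indicator (?F q) x)"
      proof (cases "x \<in> E2")
        case False
        then have "indicator (?F q) x = (1 :: ennreal)" if "q \<in> I" for q
          using that by (auto simp: E2_def indicator_def)
        then have "(\<Sum>q\<in>I. ennreal (norm (T (b q) x)) * indicator (?F q) x) = (\<Sum>q\<in>I. ennreal (norm (T (b q) x)))"
          by (intro sum.cong) auto
        also have "\<dots> = ennreal (\<Sum>q\<in>I. norm (T (b q) x))" by (simp add: sum_ennreal)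
        finally show ?thesis using False by (simp add: ennreal_leI norm_sum)
      qed auto
    qed
    also have "\<dots> = (\<Sum>q\<in>I. \<integral>\<^sup>+x\<in>?F q. ennreal (norm (T (b q) x)) \<partial>lebesgue)"
    proof (rule nn_integral_sum)
      fix q
      have "closed (?F q)" by (intro closed_Collect_le continuous_intros)
      then show "(\<lambda>x. ennreal (norm (T (b q) x)) * indicator (?F q) x) \<in> borel_measurable lebesgue"
        by (intro borel_measurable_times_ennreal borel_measurable_indicator) auto
    qed
    also have "\<dots> \<le> (\<Sum>q\<in>I. ennreal (cK * tailc * unit_ball_vol (real CARD('n))) * (2 * Nq q))" by (rule sum_mono[OF Tb])
    also have "\<dots> = ennreal (cK * tailc * unit_ball_vol (real CARD('n))) * (2 * (\<Sum>q\<in>I. Nq q))" by (simp add: sum_distrib_left)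
    also have "\<dots> \<le> ennreal (cK * tailc * unit_ball_vol (real CARD('n))) * (2 * ?N)" by (intro mult_left_mono sumN) auto
    finally have i: "(\<integral>\<^sup>+x\<in>- E2. ennreal (norm (\<Sum>q\<in>I. T (b q) x)) \<partial>lebesgue)
        \<le> ennreal (cK * tailc * unit_ball_vol (real CARD('n))) * (2 * ?N)" .
    have "emeasure lebesgue E3 \<le> ennreal (1 / (lam / 2)) * (\<integral>\<^sup>+x\<in>- E2. ennreal (norm (\<Sum>q\<in>I. T (b q) x)) \<partial>lebesgue)"
      unfolding E3_def by (rule emeasure_gt_le) (use lam lebesgue_Compl[OF E2m] in auto)
    also have "\<dots> \<le> ennreal (1 / (lam / 2)) * (ennreal (cK * tailc * unit_ball_vol (real CARD('n))) * (2 * ?N))"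
      by (rule mult_left_mono[OF i]) simp
    also have "\<dots> = ennreal (4 * cK * tailc * unit_ball_vol (real CARD('n)) / lam) * ?N"
    proof -
      have "ennreal (1 / (lam / 2)) * (ennreal (cK * tailc * unit_ball_vol (real CARD('n))) * (2 * ?N)) = (ennreal (1 / (lam / 2)) * ennreal (cK * tailc * unit_ball_vol (real CARD('n))) * ennreal 2) * ?N"
        by (simp add: mult_ac)
      also have "ennreal (1 / (lam / 2)) * ennreal (cK * tailc * unit_ball_vol (real CARD('n))) * ennreal 2 = ennreal (4 * cK * tailc * unit_ball_vol (real CARD('n)) / lam)"
      proof -
        have "ennreal (1 / (lam / 2) * (cK * tailc * unit_ball_vol (real CARD('n))) * 2) = ennreal (1 / (lam / 2)) * ennreal (cK * tailc * unit_ball_vol (real CARD('n))) * ennreal 2"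
          using lam cK tailc_pos by (intro trans[OF ennreal_mult] arg_cong2[where f = "(*)"] refl ennreal_mult) auto
        moreover have "1 / (lam / 2) * (cK * tailc * unit_ball_vol (real CARD('n))) * 2 = 4 * cK * tailc * unit_ball_vol (real CARD('n)) / lam"
          using lam by (simp add: field_simps)
        ultimately show ?thesis by (simp only:)
      qed
      finally show ?thesis .
    qed
    finally show ?thesis .
  qed
  have "AE x in lebesgue. T (\<lambda>x. g x + (\<Sum>q\<in>I. b q x)) x = T g x + T (\<lambda>x. \<Sum>q\<in>I. b q x) x"
    by (rule T_add[OF L2g in_L2_sum[OF fin L2b]])
  moreover have "AE x in lebesgue. T (\<lambda>x. \<Sum>q\<in>I. b q x) x = (\<Sum>q\<in>I. T (b q) x)"
    by (rule T_sum[OF fin L2b])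
  ultimately have "AE x in lebesgue. T f x = T g x + (\<Sum>q\<in>I. T (b q) x)"
    unfolding f_eq[symmetric] by eventually_elim simp
  then have ae: "AE x in lebesgue. x \<in> {x. lam < norm (T f x)} \<longrightarrow> x \<in> E1 \<union> E2 \<union> E3"
  proof eventually_elim
    case (elim x)
    show ?case
    proof
      assume "x \<in> {x. lam < norm (T f x)}"
      then have "lam < norm (T g x) + norm (\<Sum>q\<in>I. T (b q) x)"
        using norm_triangle_ineq[of "T g x" "\<Sum>q\<in>I. T (b q) x"] elim by simp
      then have "lam / 2 < norm (T g x) \<or> lam / 2 < norm (\<Sum>q\<in>I. T (b q) x)" by linarith
      then show "x \<in> E1 \<union> E2 \<union> E3" using lam by (auto simp: E1_def E3_def ennreal_less_iff)
    qed
  qed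
  have "emeasure lebesgue {x. lam < norm (T f x)} \<le> emeasure lebesgue (E1 \<union> E2 \<union> E3)"
    by (rule emeasure_mono_AE[OF ae]) (use E1m E2m E3m in auto)
  also have "\<dots> \<le> emeasure lebesgue E1 + emeasure lebesgue E2 + emeasure lebesgue E3"
    using E1m E2m E3m by (intro order_trans[OF emeasure_subadditive] add_right_mono emeasure_subadditive) auto
  also have "\<dots> \<le> ennreal (4 * cT * 2 ^ ?n / lam) * ?N + ennreal (unit_ball_vol (real CARD('n)) * (3 * real ?n) ^ ?n / lam) * ?N + ennreal (4 * cK * tailc * unit_ball_vol (real CARD('n)) / lam) * ?N"
    by (intro add_mono m1 m2 m3)
  also have "\<dots> = ennreal (weak_const / lam) * ?N"
    unfolding weak_const_def add_divide_distrib using cT cK lam tailc_pos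
    by (subst ennreal_plus, simp, simp, subst ennreal_plus) (simp_all add: distrib_right)
  finally show ?thesis .
qed

lemma weak_const_nonneg: "0 \<le> weak_const"
  unfolding weak_const_def using cT cK tailc_pos by (intro add_nonneg_nonneg mult_nonneg_nonneg) auto

text \<open>The stopping family may be infinite. f is kept on the complement of its union and on
  finitely many of its cubes, where \<open>weak_type_1_1_finite\<close> applies at level lam/2; the
  rest tends to 0 in square norm and disappears by Chebyshev. Halving the level is the source of the
  factor 2.\<close>

lemma weak_type_1_1:
  assumes f: "in_L2 f" and f1: "(\<integral>\<^sup>+x. ennreal (norm (f x)) \<partial>lebesgue) < \<infinity>" and lam0: "0 < lam"
  shows "emeasure lebesgue {x. lam < norm (T f x)} \<le> ennreal (2 * weak_const / lam) * (\<integral>\<^sup>+x. ennreal (norm (f x)) \<partial>lebesgue)"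
proof -
  let ?n = "CARD('n)" and ?N = "\<integral>\<^sup>+x. ennreal (norm (f x)) \<partial>lebesgue"
  define \<mu> where "\<mu> = lam / 2"
  have lam: "0 < \<mu>" using lam0 by (simp add: \<mu>_def)
  define m where "m = enn2real ?N"
  have m: "?N = ennreal m" "0 \<le> m" using f1 by (auto simp: m_def)
  \<comment> \<open>So large that no cube of level 0 has average above \<open>\<mu>\<close>. Hence
    every selected cube has a parent that was not selected, which gives the upper bound
    \<open>hi\<close>. The maximum with 1 serves L <= L^n.\<close>
  define L where "L = max 1 (m / \<mu>)"
  have L: "0 < L" by (simp add: L_def)
  have Ln: "m \<le> \<mu> * L ^ ?n"
  proof -
    have "m / \<mu> \<le> L" by (simp add: L_def)
    also have "L \<le> L ^ ?n" by (rule self_le_power) (auto simp: L_def)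
    finally show ?thesis using lam by (simp add: field_simps)
  qed
  let ?D = "dcube L :: nat \<times> ('n \<Rightarrow> int) \<Rightarrow> (real^'n) set"
  have [measurable]: "f \<in> borel_measurable lebesgue" using f by (rule in_L2_meas)
  have Dm[measurable]: "?D q \<in> sets lebesgue" for q using L by simp
  have De: "emeasure lebesgue (?D q) = ennreal (dside L q ^ ?n)" for q using L by (rule emeasure_dcube)
  define P where "P q \<longleftrightarrow> ennreal \<mu> * emeasure lebesgue (?D q) < (\<integral>\<^sup>+x\<in>?D q. ennreal (norm (f x)) \<partial>lebesgue)" for q
  let ?I = "dmax L P"
  have P0: "\<not> P q" if "fst q = 0" for q
  proof -
    have "(\<integral>\<^sup>+x\<in>?D q. ennreal (norm (f x)) \<partial>lebesgue) \<le> ?N"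
      by (intro nn_integral_mono) (auto simp: indicator_def)
    also have "\<dots> \<le> ennreal (\<mu> * L ^ ?n)" unfolding m(1) using Ln by (rule ennreal_leI)
    also have "\<dots> = ennreal \<mu> * emeasure lebesgue (?D q)"
      unfolding De using lam L that by (simp add: dside_def ennreal_mult)
    finally show ?thesis by (simp add: P_def not_less)
  qed
  have hi: "(\<integral>\<^sup>+x\<in>?D q. ennreal (norm (f x)) \<partial>lebesgue) \<le> ennreal (2 ^ ?n * \<mu>) * emeasure lebesgue (?D q)"
    if q: "q \<in> ?I" for q
  proof -
    have "fst q \<noteq> 0" using P0[of q] dmaxD[OF q] by auto
    then obtain j where j: "fst q = Suc j" by (cases "fst q") auto
    define x :: "real^'n" where "x = dcorner L q"
    have x: "x \<in> ?D q" unfolding x_def by (rule dcorner_mem[OF L])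
    define p where "p = (j, didx L j x)"
    have np: "\<not> P p" unfolding p_def by (rule dmax_ancestor[OF q x]) (simp add: j)
    have sub: "?D q \<subseteq> ?D p"
      using dcube_mono[of j "Suc j" L x] dcube_eqD[OF x] unfolding p_def j by simp
    have "(\<integral>\<^sup>+x\<in>?D q. ennreal (norm (f x)) \<partial>lebesgue) \<le> (\<integral>\<^sup>+x\<in>?D p. ennreal (norm (f x)) \<partial>lebesgue)"
      using sub by (intro nn_integral_mono) (auto simp: indicator_def)
    also have "\<dots> \<le> ennreal \<mu> * emeasure lebesgue (?D p)" using np by (simp add: P_def not_less)
    also have "\<dots> = ennreal (\<mu> * dside L p ^ ?n)"
      unfolding De using lam dside_pos[OF L, of p] by (simp add: ennreal_mult)
    also have "dside L p = 2 * dside L q" by (simp add: dside_def p_def j)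
    also have "\<mu> * (2 * dside L q) ^ ?n = 2 ^ ?n * \<mu> * dside L q ^ ?n" by (simp add: power_mult_distrib)
    also have "ennreal \<dots> = ennreal (2 ^ ?n * \<mu>) * emeasure lebesgue (?D q)"
      unfolding De using lam dside_pos[OF L, of q] by (intro ennreal_mult) auto
    finally show ?thesis .
  qed
  define S where "S = - (\<Union>q\<in>?I. ?D q)"
  have Sm[measurable]: "S \<in> sets lebesgue" unfolding S_def by (intro lebesgue_Compl sets.countable_UN') auto
  have "AE x in lebesgue. x \<in> S \<longrightarrow> ennreal (norm (f x)) \<le> ennreal \<mu>"
  proof (rule AE_le_off_dcubes[OF L _ f1 lam Sm])
    fix q x assume x: "x \<in> S" "x \<in> ?D q"
    have "\<not> P q"
    proof
      assume "P q"
      then have "P (fst q, didx L (fst q) x)" using dcube_eqD[OF x(2)] by simp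
      then show False using dmax_cover[of P "fst q" L x] x(1) by (auto simp: S_def)
    qed
    then show "(\<integral>\<^sup>+x\<in>?D q. ennreal (norm (f x)) \<partial>lebesgue) \<le> ennreal \<mu> * emeasure lebesgue (?D q)"
      by (simp add: P_def not_less)
  qed auto
  then have Sbd: "AE x in lebesgue. x \<in> S \<longrightarrow> norm (f x) \<le> \<mu>" using lam by simp
  \<comment> \<open>A finite exhaustion of the stopping family along an enumeration of all
    cubes.\<close>
  define J where "J k = {q \<in> ?I. to_nat q < k}" for k
  have Jfin: "finite (J k)" for k
  proof (rule finite_subset)
    show "J k \<subseteq> (to_nat :: nat \<times> ('n \<Rightarrow> int) \<Rightarrow> nat) -` {..<k}" by (auto simp: J_def)
    show "finite ((to_nat :: nat \<times> ('n \<Rightarrow> int) \<Rightarrow> nat) -` {..<k})" by (intro finite_vimageI inj_to_nat) simp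
  qed
  have Jdisj: "disjoint_family_on ?D (J k)" for k
    by (rule disjoint_family_on_mono[OF _ dmax_disjoint[of L P]]) (auto simp: J_def)
  define Sk where "Sk k = S \<union> (\<Union>q\<in>J k. ?D q)" for k
  have Skm[measurable]: "Sk k \<in> sets lebesgue" for k unfolding Sk_def using Jfin[of k] by auto
  define fk where "fk k x = indicator (Sk k) x * f x" for k x
  define rk where "rk k x = indicator (- Sk k) x * f x" for k x
  have L2: "in_L2 (fk k)" "in_L2 (rk k)" for k
    unfolding fk_def rk_def by (intro in_L2_indicator f Skm lebesgue_Compl)+
  have [measurable]: "T f \<in> borel_measurable lebesgue" "T (fk k) \<in> borel_measurable lebesgue" "T (rk k) \<in> borel_measurable lebesgue"
    "rk k \<in> borel_measurable lebesgue" for k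
    using T_meas[OF f] T_meas[OF L2(1)] T_meas[OF L2(2)] in_L2_meas[OF L2(2)] by blast+
  have f_eq: "f = (\<lambda>x. fk k x + rk k x)" for k by (auto simp: fk_def rk_def indicator_def fun_eq_iff)
  have N_le: "(\<integral>\<^sup>+x. ennreal (norm (fk k x)) \<partial>lebesgue) \<le> ?N" for k
    by (intro nn_integral_mono) (auto simp: fk_def indicator_def)
  have wk: "emeasure lebesgue {x. \<mu> < norm (T (fk k) x)} \<le> ennreal (weak_const / \<mu>) * ?N" for k
  proof -
    have eq: "(\<integral>\<^sup>+x\<in>?D q. ennreal (norm (fk k x)) \<partial>lebesgue) = (\<integral>\<^sup>+x\<in>?D q. ennreal (norm (f x)) \<partial>lebesgue)" if "q \<in> J k" for q
      using that by (intro nn_integral_cong) (auto simp: fk_def indicator_def Sk_def)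
    have "emeasure lebesgue {x. \<mu> < norm (T (fk k) x)} \<le> ennreal (weak_const / \<mu>) * (\<integral>\<^sup>+x. ennreal (norm (fk k x)) \<partial>lebesgue)"
    proof (rule weak_type_1_1_finite[OF L Jfin Jdisj lam L2(1)])
      show "(\<integral>\<^sup>+x. ennreal (norm (fk k x)) \<partial>lebesgue) < \<infinity>" using N_le[of k] f1 by (rule order_le_less_trans)
      show "ennreal \<mu> * emeasure lebesgue (?D q) \<le> (\<integral>\<^sup>+x\<in>?D q. ennreal (norm (fk k x)) \<partial>lebesgue)" if q: "q \<in> J k" for q
      proof -
        have "P q" using q dmaxD[of q L P] by (simp add: J_def)
        then show ?thesis unfolding eq[OF q] P_def by (rule less_imp_le)
      qed
      show "(\<integral>\<^sup>+x\<in>?D q. ennreal (norm (fk k x)) \<partial>lebesgue) \<le> ennreal (2 ^ ?n * \<mu>) * emeasure lebesgue (?D q)" if q: "q \<in> J k" for q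
        unfolding eq[OF q] by (rule hi) (use q in \<open>simp add: J_def\<close>)
      show "AE x in lebesgue. x \<notin> (\<Union>q\<in>J k. ?D q) \<longrightarrow> norm (fk k x) \<le> \<mu>"
        using Sbd by eventually_elim (use lam in \<open>auto simp: fk_def indicator_def Sk_def\<close>)
    qed
    also have "\<dots> \<le> ennreal (weak_const / \<mu>) * ?N" by (rule mult_left_mono[OF N_le]) simp
    finally show ?thesis .
  qed
  have lim: "(\<lambda>k. L2_sq (rk k)) \<longlonglongrightarrow> 0"
  proof -
    have "(\<lambda>k. \<integral>\<^sup>+x. ennreal ((norm (rk k x))\<^sup>2) \<partial>lebesgue) \<longlonglongrightarrow> (\<integral>\<^sup>+x. 0 \<partial>(lebesgue :: (real^'n) measure))"
    proof (rule nn_integral_dominated_convergence[where w = "\<lambda>x. ennreal ((norm (f x))\<^sup>2)"])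
      show "(\<integral>\<^sup>+x. ennreal ((norm (f x))\<^sup>2) \<partial>lebesgue) < \<infinity>" using f by (simp add: in_L2_iff L2_sq_def)
      show "AE x in lebesgue. (\<lambda>k. ennreal ((norm (rk k x))\<^sup>2)) \<longlonglongrightarrow> 0"
      proof (rule AE_I2)
        fix x
        obtain k0 where k0: "x \<in> Sk k" if "k0 \<le> k" for k
        proof (cases "x \<in> S")
          case True
          then show ?thesis using that[of 0] by (simp add: Sk_def)
        next
          case False
          then obtain q where q: "q \<in> ?I" "x \<in> ?D q" by (auto simp: S_def)
          show ?thesis
          proof (rule that)
            fix k assume "Suc (to_nat q) \<le> k"
            then have "q \<in> J k" using q by (simp add: J_def)
            then show "x \<in> Sk k" using q(2) unfolding Sk_def by blast
          qed
        qed
        then show "(\<lambda>k. ennreal ((norm (rk k x))\<^sup>2)) \<longlonglongrightarrow> 0"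
          by (intro tendsto_eventually eventually_sequentiallyI[of k0]) (simp add: rk_def)
      qed
    qed (auto simp: rk_def indicator_def)
    then show ?thesis by (simp add: L2_sq_def)
  qed
  have main: "emeasure lebesgue {x. lam < norm (T f x)} \<le> ennreal (weak_const / \<mu>) * ?N + ennreal (cT / \<mu>\<^sup>2) * L2_sq (rk k)" for k
  proof -
    define E1 where "E1 = {x. \<mu> < norm (T (fk k) x)}"
    define E2 where "E2 = {x. \<mu> < norm (T (rk k) x)}"
    have E: "E1 \<in> sets lebesgue" "E2 \<in> sets lebesgue"
      using measurable_sets[of "\<lambda>x. norm (T (fk k) x)" lebesgue borel "{\<mu><..}"]
        measurable_sets[of "\<lambda>x. norm (T (rk k) x)" lebesgue borel "{\<mu><..}"] by (simp_all add: vimage_def E1_def E2_def)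
    have "AE x in lebesgue. T (\<lambda>x. fk k x + rk k x) x = T (fk k) x + T (rk k) x" by (rule T_add[OF L2])
    then have "AE x in lebesgue. T f x = T (fk k) x + T (rk k) x" unfolding f_eq[of k, symmetric] .
    then have "AE x in lebesgue. x \<in> {x. lam < norm (T f x)} \<longrightarrow> x \<in> E1 \<union> E2"
    proof eventually_elim
      case (elim x)
      then show ?case using norm_triangle_ineq[of "T (fk k) x" "T (rk k) x"] by (auto simp: E1_def E2_def \<mu>_def)
    qed
    then have "emeasure lebesgue {x. lam < norm (T f x)} \<le> emeasure lebesgue (E1 \<union> E2)"
      by (rule emeasure_mono_AE) (use E in auto)
    also have "\<dots> \<le> emeasure lebesgue E1 + emeasure lebesgue E2" by (rule emeasure_subadditive[OF E])
    also have "\<dots> \<le> ennreal (weak_const / \<mu>) * ?N + ennreal (cT / \<mu>\<^sup>2) * L2_sq (rk k)"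
      unfolding E1_def E2_def by (intro add_mono wk T_level_bound L2 lam)
    finally show ?thesis .
  qed
  have "(\<lambda>k. ennreal (weak_const / \<mu>) * ?N + ennreal (cT / \<mu>\<^sup>2) * L2_sq (rk k)) \<longlonglongrightarrow> ennreal (weak_const / \<mu>) * ?N + ennreal (cT / \<mu>\<^sup>2) * 0"
    by (intro tendsto_add tendsto_const ennreal_tendsto_cmult lim) simp
  then have "emeasure lebesgue {x. lam < norm (T f x)} \<le> ennreal (weak_const / \<mu>) * ?N + ennreal (cT / \<mu>\<^sup>2) * 0"
    by (rule LIMSEQ_le_const) (use main in blast)
  then show ?thesis by (simp add: \<mu>_def mult.commute)
qed

end

section \<open>One step of the local decomposition\<close>

context czo
begin

text \<open>The first-variable counterpart of \<open>kernel_cancel\<close>, without cancellation.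
  Only averages centred at x0 enter, so x0 has to avoid the exceptional set of the maximal function
  while x may be any point within rho of x0.\<close>

lemma kernel_osc:
  assumes F: "integrable lebesgue F" and r: "0 < \<rho>" and supp: "\<And>y. F y \<noteq> 0 \<Longrightarrow> 2 * \<rho> < dist x0 y"
    and x: "dist x0 x \<le> \<rho>"
    and m: "\<And>r. 0 < r \<Longrightarrow> (\<integral>\<^sup>+y\<in>ball x0 r. ennreal (norm (F y)) \<partial>lebesgue) \<le> m * ennreal (r ^ CARD('n))"
  shows "ennreal (norm ((\<integral>y. K x y * F y \<partial>lebesgue) - (\<integral>y. K x0 y * F y \<partial>lebesgue))) \<le> ennreal (cK * tailc) * m"
proof -
  let ?k = "\<lambda>y. \<rho> powr \<delta> / dist x0 y powr (real CARD('n) + \<delta>)"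
  have [measurable]: "F \<in> borel_measurable lebesgue" using F by auto
  have i1: "integrable lebesgue (\<lambda>y. K x y * F y)"
  proof (rule K_integrable[OF F r])
    fix y assume "F y \<noteq> 0"
    then have "2 * \<rho> < dist x0 y" by (rule supp)
    then show "\<rho> \<le> dist x y" using x dist_triangle[of x0 y x] by linarith
  qed
  have i2: "integrable lebesgue (\<lambda>y. K x0 y * F y)"
  proof (rule K_integrable[OF F r])
    fix y assume "F y \<noteq> 0"
    then have "2 * \<rho> < dist x0 y" by (rule supp)
    then show "\<rho> \<le> dist x0 y" using r by simp
  qed
  have "ennreal (norm ((\<integral>y. K x y * F y \<partial>lebesgue) - (\<integral>y. K x0 y * F y \<partial>lebesgue)))
     = ennreal (norm (\<integral>y. K x y * F y - K x0 y * F y \<partial>lebesgue))"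
    by (simp only: Bochner_Integration.integral_diff[OF i1 i2])
  also have "\<dots> \<le> (\<integral>\<^sup>+y. ennreal (norm (K x y * F y - K x0 y * F y)) \<partial>lebesgue)"
    by (rule integral_norm_bound_ennreal[OF Bochner_Integration.integrable_diff[OF i1 i2]])
  also have "\<dots> \<le> (\<integral>\<^sup>+y. ennreal cK * (ennreal (norm (F y)) * ennreal (?k y) * indicator {y. \<rho> \<le> dist x0 y} y) \<partial>lebesgue)"
  proof (rule nn_integral_mono)
    fix y
    show "ennreal (norm (K x y * F y - K x0 y * F y)) \<le> ennreal cK * (ennreal (norm (F y)) * ennreal (?k y) * indicator {y. \<rho> \<le> dist x0 y} y)"
    proof (cases "F y = 0")
      case False
      then have d: "2 * \<rho> < dist x0 y" by (rule supp)
      have "norm (K x0 y - K x y) \<le> cK * (dist x0 x powr \<delta> / dist x0 y powr (real CARD('n) + \<delta>))"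
        using x d by (intro K_smooth1) auto
      also have "\<dots> \<le> cK * ?k y" using x delta cK by (intro mult_left_mono divide_right_mono powr_mono2) auto
      finally have "norm (K x y - K x0 y) * norm (F y) \<le> cK * ?k y * norm (F y)"
        by (intro mult_right_mono) (auto simp: norm_minus_commute)
      moreover have "norm (K x y * F y - K x0 y * F y) = norm (K x y - K x0 y) * norm (F y)"
        by (simp add: norm_mult[symmetric] left_diff_distrib)
      moreover have "cK * ?k y * norm (F y) = cK * (norm (F y) * ?k y)" by simp
      ultimately have "ennreal (norm (K x y * F y - K x0 y * F y)) \<le> ennreal (cK * (norm (F y) * ?k y))"
        by (intro ennreal_leI) (simp only:)
      also have "\<dots> = ennreal cK * (ennreal (norm (F y)) * ennreal (?k y))"
        using cK by (intro trans[OF ennreal_mult] arg_cong2[where f = "(*)"] refl ennreal_mult) auto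
      moreover have "indicator {y. \<rho> \<le> dist x0 y} y = (1 :: ennreal)" using d r by simp
      ultimately show ?thesis by (simp only: mult_1_right)
    qed simp
  qed
  also have "\<dots> = ennreal cK * (\<integral>\<^sup>+y\<in>{y. \<rho> \<le> dist x0 y}. ennreal (norm (F y)) * ennreal (?k y) \<partial>lebesgue)"
  proof (rule nn_integral_cmult)
    have "(\<lambda>y. ennreal (?k y) * indicator {y. \<rho> \<le> dist x0 y} y) \<in> borel_measurable borel" by measurable
    then have "(\<lambda>y. ennreal (?k y) * indicator {y. \<rho> \<le> dist x0 y} y) \<in> borel_measurable lebesgue"
      by (simp add: measurable_completion)
    moreover have "(\<lambda>y. ennreal (norm (F y))) \<in> borel_measurable lebesgue" by measurable
    ultimately have "(\<lambda>y. ennreal (norm (F y)) * (ennreal (?k y) * indicator {y. \<rho> \<le> dist x0 y} y)) \<in> borel_measurable lebesgue"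
      by (rule borel_measurable_times_ennreal[rotated])
    then show "(\<lambda>y. ennreal (norm (F y)) * ennreal (?k y) * indicator {y. \<rho> \<le> dist x0 y} y) \<in> borel_measurable lebesgue"
      by (simp only: mult.assoc)
  qed
  also have "\<dots> \<le> ennreal cK * (ennreal tailc * m)"
  proof (rule mult_left_mono)
    show "(\<integral>\<^sup>+y\<in>{y. \<rho> \<le> dist x0 y}. ennreal (norm (F y)) * ennreal (?k y) \<partial>lebesgue) \<le> ennreal tailc * m"
      unfolding tailc_def by (rule tail_bound[OF delta r _ m]) auto
  qed simp
  also have "\<dots> = ennreal (cK * tailc) * m" using cK tailc_pos by (simp add: ennreal_mult mult.assoc)
  finally show ?thesis .
qed

text \<open>The weak type bound for the centred maximal function, normalised by r^n instead of the
  volume of the ball. E is a measurable set containing all points where it exceeds t.\<close>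

lemma maximal_bad_set:
  fixes f :: "real^'n \<Rightarrow> complex"
  assumes f: "f \<in> borel_measurable lebesgue" and N: "(\<integral>\<^sup>+y. ennreal (norm (f y)) \<partial>lebesgue) = ennreal N" "0 \<le> N" and t: "0 < t"
  shows "\<exists>E\<in>sets lebesgue. emeasure lebesgue E \<le> ennreal (5 ^ CARD('n) * unit_ball_vol (real CARD('n)) * N / t) \<and>
     (\<forall>x r. x \<notin> E \<longrightarrow> 0 < r \<longrightarrow> (\<integral>\<^sup>+y\<in>ball x r. ennreal (norm (f y)) \<partial>lebesgue) \<le> ennreal t * ennreal (r ^ CARD('n)))"
proof -
  let ?n = "CARD('n)" and ?v = "unit_ball_vol (real CARD('n))"
  define S :: "(real^'n) set" where "S = {x. \<exists>r>0. ennreal t * ennreal (r ^ ?n) < (\<integral>\<^sup>+y\<in>ball x r. ennreal (norm (f y)) \<partial>lebesgue)}"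
  have "\<exists>E\<in>sets lebesgue. S \<subseteq> E \<and> emeasure lebesgue E \<le> ennreal (5 ^ ?n * ?v * (1 / t)) * (\<integral>\<^sup>+y. ennreal (norm (f y)) \<partial>lebesgue)"
  proof (rule vitali_bound)
    fix x assume "x \<in> S"
    then obtain r where r: "0 < r" "ennreal t * ennreal (r ^ ?n) < (\<integral>\<^sup>+y\<in>ball x r. ennreal (norm (f y)) \<partial>lebesgue)"
      by (auto simp: S_def)
    have "ennreal (r ^ ?n) = ennreal (1 / t) * (ennreal t * ennreal (r ^ ?n))"
      using t r(1) by (simp add: mult.assoc[symmetric] ennreal_mult[symmetric])
    also have "\<dots> \<le> ennreal (1 / t) * (\<integral>\<^sup>+y\<in>ball x r. ennreal (norm (f y)) \<partial>lebesgue)"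
      using r(2) by (intro mult_left_mono) auto
    finally show "\<exists>r>0. ennreal (r ^ ?n) \<le> ennreal (1 / t) * (\<integral>\<^sup>+y\<in>ball x r. ennreal (norm (f y)) \<partial>lebesgue)"
      using r(1) by blast
  qed (use f N t in auto)
  then obtain E where E: "E \<in> sets lebesgue" "S \<subseteq> E"
    "emeasure lebesgue E \<le> ennreal (5 ^ ?n * ?v * (1 / t)) * ennreal N" unfolding N(1) by blast
  have "ennreal (5 ^ ?n * ?v * (1 / t)) * ennreal N = ennreal (5 ^ ?n * ?v * N / t)"
    using N t by (simp add: ennreal_mult[symmetric])
  moreover have "(\<integral>\<^sup>+y\<in>ball x r. ennreal (norm (f y)) \<partial>lebesgue) \<le> ennreal t * ennreal (r ^ ?n)"
    if "x \<notin> E" "0 < r" for x r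
  proof (rule ccontr)
    assume "\<not> ?thesis"
    then have "x \<in> S" using that(2) by (auto simp: S_def not_le)
    then show False using that(1) E(2) by blast
  qed
  ultimately show ?thesis using E(1,3) by (intro bexI[of _ E] conjI allI impI) (simp_all only:)
qed

text \<open>Three sets of relative measure \<open>eps_cover\<close> make up U in
  \<open>one_step\<close>: the exceptional sets of T and of the maximal function, and the excess of
  the open superset. Their sum is half of the stopping density 2^(-n)/2 of
  \<open>stopping_cubes\<close>.\<close>

definition eps_cover :: real where "eps_cover = (1 / 2 ^ CARD('n)) / 12"
text \<open>This level and the next are solved for in the weak type bounds of T and of the maximal
  function, so that each exceptional set takes at most the fraction \<open>eps_cover\<close> of the
  cube. The summand 1 gives positivity from \<open>weak_const_nonneg\<close>.\<close>

definition level_T :: real where "level_T = 2 * weak_const / eps_cover + 1"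
definition level_max :: real where "level_max = 5 ^ CARD('n) * unit_ball_vol (real CARD('n)) / eps_cover"
text \<open>Twice the bound of \<open>dist_dstar_le\<close> in units of the side, so that an open
  ball about any point of a cube contains its dilate.\<close>

definition rad :: real where "rad = 2 * real CARD('n) * (dil TYPE('n) + 1)"
text \<open>The level at which the weak type bound for f restricted to the dilate of a subcube
  leaves an exceptional set of at most a quarter of the subcube.\<close>

definition level_T_sub :: real where "level_T_sub = 8 * weak_const * level_max * rad ^ CARD('n) + 1"
text \<open>The first two terms bound the far part at the good point of a subcube, the third its
  oscillation over the subcube.\<close>

definition step_const :: real where "step_const = level_T + level_T_sub + cK * tailc * level_max"

lemma one_step_consts: "0 < eps_cover" "0 < level_T" "0 < level_max" "0 < rad" "0 < level_T_sub" "0 < step_const"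
proof -
  show e: "0 < eps_cover" by (simp add: eps_cover_def)
  show l1: "0 < level_T" using e weak_const_nonneg unfolding level_T_def by (intro add_nonneg_pos divide_nonneg_nonneg) auto
  show l2: "0 < level_max" using e by (simp add: level_max_def)
  show r: "0 < rad" unfolding rad_def by (intro mult_pos_pos add_nonneg_pos) auto
  show l3: "0 < level_T_sub" using l2 r weak_const_nonneg unfolding level_T_sub_def by (intro add_nonneg_pos mult_nonneg_nonneg) auto
  show "0 < step_const" using l1 l2 l3 cK tailc_pos unfolding step_const_def
    by (intro add_pos_nonneg add_pos_pos mult_nonneg_nonneg) auto
qed

text \<open>Stopping on an open superset of the exceptional set makes every point of it lie in a stopping
  cube, without a density theorem.\<close>

lemma stopping_cubes:
  fixes q :: "nat \<times> ('n \<Rightarrow> int)"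
  assumes L: "0 < L" and U: "open U" and small: "emeasure lebesgue (U \<inter> dcube L q) \<le> ennreal (3 * eps_cover) * emeasure lebesgue (dcube L q)"
  shows "\<exists>I. disjoint_family_on (dcube L) I \<and> (\<forall>p\<in>I. fst q < fst p \<and> dcube L p \<subseteq> dcube L q \<and>
      2 * emeasure lebesgue (dcube L p \<inter> U) \<le> emeasure lebesgue (dcube L p)) \<and>
    2 * emeasure lebesgue (\<Union>p\<in>I. dcube L p) \<le> emeasure lebesgue (dcube L q) \<and>
    U \<inter> dcube L q \<subseteq> (\<Union>p\<in>I. dcube L p)"
proof -
  let ?n = "CARD('n)" and ?D = "dcube L :: nat \<times> ('n \<Rightarrow> int) \<Rightarrow> (real^'n) set"
  \<comment> \<open>The density of U in a cube is at most 2^n times that in its parent. As the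
    parent of a stopping cube has density at most \<open>\<theta>\<close>, the stopping cube has
    density at most 1/2.\<close>
  define \<theta> :: real where "\<theta> = (1 / 2 ^ ?n) / 2"
  have th: "0 < \<theta>" "6 * eps_cover = \<theta>" "\<theta> < 1"
  proof -
    have "(1::real) / 2 ^ ?n \<le> 1" by simp
    moreover have "t / 2 < 1" if "t \<le> 1" for t :: real using that by simp
    ultimately show "\<theta> < 1" unfolding \<theta>_def by blast
  qed (auto simp: \<theta>_def eps_cover_def)
  have Dm[measurable]: "?D q \<in> sets lebesgue" for q using L by simp
  have Um[measurable]: "U \<in> sets lebesgue" using U by simp
  have De: "emeasure lebesgue (?D q) = ennreal (dside L q ^ ?n)" for q using L by (rule emeasure_dcube)
  define P where "P p \<longleftrightarrow> fst q < fst p \<and> ?D p \<subseteq> ?D q \<and> ennreal \<theta> * emeasure lebesgue (?D p) < emeasure lebesgue (?D p \<inter> U)" for p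
  let ?I = "dmax L P"
  have pU: "2 * emeasure lebesgue (?D p \<inter> U) \<le> emeasure lebesgue (?D p)" if p: "p \<in> ?I" for p
  proof -
    have Pp: "P p" using p by (rule dmaxD)
    then obtain j where j: "fst p = Suc j" "fst q \<le> j" by (cases "fst p") (auto simp: P_def)
    define x :: "real^'n" where "x = dcorner L p"
    have x: "x \<in> ?D p" unfolding x_def by (rule dcorner_mem[OF L])
    have xq: "x \<in> ?D q" using x Pp by (auto simp: P_def)
    define p' where "p' = (j, didx L j x)"
    have np: "\<not> P p'" unfolding p'_def by (rule dmax_ancestor[OF p x]) (simp add: j)
    have sub: "?D p \<subseteq> ?D p'"
      using dcube_mono[of j "Suc j" L x] dcube_eqD[OF x] unfolding p'_def j by simp
    have sub': "?D p' \<subseteq> ?D q"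
      using dcube_mono[OF j(2), of L x] dcube_eqD[OF xq] unfolding p'_def by simp
    have "emeasure lebesgue (?D p' \<inter> U) \<le> ennreal \<theta> * emeasure lebesgue (?D p')"
    \<comment> \<open>The parent may be q itself, which the strict level condition in P excludes
      from selection; there the bound comes from \<open>small\<close>.\<close>
    proof (cases "fst q = j")
      case True
      then have "p' = q" using dcube_eqD[OF xq] by (simp add: p'_def)
      then have "emeasure lebesgue (?D p' \<inter> U) \<le> ennreal (3 * eps_cover) * emeasure lebesgue (?D p')"
        using small by (simp add: Int_commute)
      also have "\<dots> \<le> ennreal \<theta> * emeasure lebesgue (?D p')"
        using th one_step_consts(1) by (intro mult_right_mono ennreal_leI) auto
      finally show ?thesis .
    next
      case False
      then have "fst q < fst p'" using j by (simp add: p'_def)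
      then show ?thesis using np sub' by (auto simp: P_def not_less)
    qed
    then have "emeasure lebesgue (?D p \<inter> U) \<le> ennreal \<theta> * emeasure lebesgue (?D p')"
      using sub by (intro order_trans[OF emeasure_mono[of "?D p \<inter> U" "?D p' \<inter> U"]]) auto
    also have "\<dots> = ennreal (\<theta> * dside L p' ^ ?n)" unfolding De using th dside_pos[OF L, of p'] by (simp add: ennreal_mult)
    also have "dside L p' = 2 * dside L p" by (simp add: dside_def p'_def j)
    also have "\<theta> * (2 * dside L p) ^ ?n = dside L p ^ ?n / 2" by (simp add: power_mult_distrib \<theta>_def)
    finally have "2 * emeasure lebesgue (?D p \<inter> U) \<le> ennreal 2 * ennreal (dside L p ^ ?n / 2)"
      by (simp add: mult_left_mono)
    also have "\<dots> = emeasure lebesgue (?D p)"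
      unfolding De using dside_pos[OF L, of p] by (subst ennreal_mult[symmetric]) auto
    finally show ?thesis .
  qed
  \<comment> \<open>Each stopping cube is filled by U to more than the fraction
    \<open>\<theta>\<close>, while U fills at most \<open>\<theta>\<close>/2 of q.\<close>
  have tot: "2 * emeasure lebesgue (\<Union>p\<in>?I. ?D p) \<le> emeasure lebesgue (?D q)"
  proof -
    have "ennreal \<theta> * emeasure lebesgue (\<Union>p\<in>?I. ?D p) = (\<integral>\<^sup>+p. ennreal \<theta> * emeasure lebesgue (?D p) \<partial>count_space ?I)"
      by (subst emeasure_UN_countable[OF Dm countable_dyadic dmax_disjoint], subst nn_integral_cmult) auto
    also have "\<dots> \<le> (\<integral>\<^sup>+p. emeasure lebesgue (?D p \<inter> U) \<partial>count_space ?I)"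
      by (rule nn_integral_mono) (use dmaxD[of _ L P] in \<open>auto simp: P_def simp del: emeasure_completion intro: less_imp_le\<close>)
    also have "\<dots> = emeasure lebesgue (\<Union>p\<in>?I. ?D p \<inter> U)"
    proof (rule emeasure_UN_countable[symmetric])
      show "disjoint_family_on (\<lambda>p. ?D p \<inter> U) ?I"
        using dmax_disjoint[of L P] unfolding disjoint_family_on_def by blast
    qed auto
    also have "\<dots> \<le> emeasure lebesgue (U \<inter> ?D q)"
      using dmaxD[of _ L P] by (intro emeasure_mono) (auto simp: P_def)
    also have "\<dots> \<le> ennreal (3 * eps_cover) * emeasure lebesgue (?D q)" by (rule small)
    finally have "ennreal (2 / \<theta>) * (ennreal \<theta> * emeasure lebesgue (\<Union>p\<in>?I. ?D p))
        \<le> ennreal (2 / \<theta>) * (ennreal (3 * eps_cover) * emeasure lebesgue (?D q))" by (rule mult_left_mono) simp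
    moreover have "ennreal (2 / \<theta>) * ennreal \<theta> = ennreal 2" using th(1) by (simp add: ennreal_mult[symmetric])
    moreover have "ennreal (2 / \<theta>) * ennreal (3 * eps_cover) = ennreal 1"
      unfolding th(2)[symmetric] using one_step_consts(1) by (simp add: ennreal_mult[symmetric])
    ultimately show ?thesis by (simp only: mult.assoc[symmetric]) simp
  qed
  have cov: "U \<inter> ?D q \<subseteq> (\<Union>p\<in>?I. ?D p)"
  proof
    fix x assume x: "x \<in> U \<inter> ?D q"
    then obtain j where j: "fst q < j" "?D (j, didx L j x) \<subseteq> U"
      using dcube_in_open[OF L U, of x "fst q"] by auto
    define p where "p = (j, didx L j x)"
    have "?D p \<subseteq> ?D q"
      using dcube_mono[of "fst q" j L x] dcube_eqD[of x L q] x j(1) by (simp add: p_def)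
    \<comment> \<open>A cube inside U has density 1, above the threshold.\<close>
    moreover have "ennreal \<theta> * emeasure lebesgue (?D p) < emeasure lebesgue (?D p)"
    proof -
      have "0 < dside L p ^ ?n" using dside_pos[OF L, of p] by simp
      then have "\<theta> * dside L p ^ ?n < 1 * dside L p ^ ?n" using th(3) by (intro mult_strict_right_mono)
      then show ?thesis unfolding De using th(1) dside_pos[OF L, of p]
        by (simp add: ennreal_mult[symmetric] ennreal_less_iff)
    qed
    moreover have "?D p \<inter> U = ?D p" using j(2) by (auto simp: p_def)
    moreover have "fst q < fst p" using j(1) by (simp add: p_def)
    ultimately have "P p" unfolding P_def by (simp only:)
    then have "P (j, didx L j x)" by (simp only: p_def)
    then show "x \<in> (\<Union>p\<in>?I. ?D p)" using dmax_cover[of P j L x] by blast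
  qed
  show ?thesis
  proof (intro exI[of _ ?I] conjI ballI)
    fix p assume p: "p \<in> ?I"
    then show "fst q < fst p" "?D p \<subseteq> ?D q" using dmaxD[of p L P] by (simp_all add: P_def)
    show "2 * emeasure lebesgue (?D p \<inter> U) \<le> emeasure lebesgue (?D p)" using p by (rule pU)
  qed (rule dmax_disjoint tot cov)+
qed

text \<open>A is the mass of f on the dilate divided by the volume of the undilated cube. Off the
  stopping cubes the bound is the definition of the exceptional set. On a stopping cube p, f 1_q'
  splits into f1, living on the dilate of p, and the far part F. T F is bounded at one good point x0
  as the difference of T f0 and T f1, and \<open>kernel_osc\<close> carries this to all of
  p.\<close>

lemma one_step:
  fixes q :: "nat \<times> ('n \<Rightarrow> int)"
  assumes L: "0 < L" and f: "in_L2 f"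
    and A: "(\<integral>\<^sup>+y\<in>dstar L q. ennreal (norm (f y)) \<partial>lebesgue) = ennreal (A * dside L q ^ CARD('n))" and A0: "0 \<le> A"
  shows "\<exists>I. disjoint_family_on (dcube L) I \<and> (\<forall>p\<in>I. fst q < fst p \<and> dcube L p \<subseteq> dcube L q) \<and>
    2 * emeasure lebesgue (\<Union>p\<in>I. dcube L p) \<le> emeasure lebesgue (dcube L q) \<and>
    (AE x in lebesgue. x \<in> dcube L q \<longrightarrow> x \<notin> (\<Union>p\<in>I. dcube L p) \<longrightarrow>
      norm (T (\<lambda>y. indicator (dstar L q) y * f y) x) \<le> step_const * A) \<and>
    (\<forall>p\<in>I. AE x in lebesgue. x \<in> dcube L p \<longrightarrow>
      norm (T (\<lambda>y. indicator (dstar L q) y * f y) x) \<le> step_const * A + norm (T (\<lambda>y. indicator (dstar L p) y * f y) x))"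
proof -
  let ?n = "CARD('n)" and ?D = "dcube L :: nat \<times> ('n \<Rightarrow> int) \<Rightarrow> (real^'n) set"
  let ?S = "dstar L :: nat \<times> ('n \<Rightarrow> int) \<Rightarrow> (real^'n) set"
  define f0 where "f0 = (\<lambda>y. indicator (?S q) y * f y)"
  have [measurable]: "f \<in> borel_measurable lebesgue" using f by (rule in_L2_meas)
  have L2f0: "in_L2 f0" unfolding f0_def by (rule in_L2_indicator[OF f]) simp
  have [measurable]: "f0 \<in> borel_measurable lebesgue" using L2f0 by (rule in_L2_meas)
  have Dm[measurable]: "?D q \<in> sets lebesgue" for q using L by simp
  have De: "emeasure lebesgue (?D q) = ennreal (dside L q ^ ?n)" for q using L by (rule emeasure_dcube)
  have s: "0 < dside L q" for q :: "nat \<times> ('n \<Rightarrow> int)" using L by (rule dside_pos)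
  define s0 where "s0 = dside L q ^ ?n"
  have s0: "0 < s0" unfolding s0_def using s[of q] by simp
  have f01: "(\<integral>\<^sup>+y. ennreal (norm (f0 y)) \<partial>lebesgue) = ennreal (A * s0)"
    unfolding s0_def A[symmetric] by (intro nn_integral_cong) (auto simp: f0_def indicator_def)
  have Tm[measurable]: "T f0 \<in> borel_measurable lebesgue" using L2f0 by (rule T_meas)
  show ?thesis
  proof (cases "A = 0")
    \<comment> \<open>The weak type bounds need positive levels, multiples of A. For A = 0 the
      restricted function is null, hence so is its image, and the empty family works.\<close>
    case True
    then have "(\<integral>\<^sup>+y. ennreal (norm (f0 y)) \<partial>lebesgue) = 0" using f01 by simp
    then have "AE x in lebesgue. ennreal (norm (f0 x)) = 0" by (subst (asm) nn_integral_0_iff_AE) auto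
    then have "AE x in lebesgue. f0 x = 0" by eventually_elim simp
    then have "AE x in lebesgue. T f0 x = 0" by (rule T_cong0[OF L2f0])
    then have "AE x in lebesgue. x \<in> ?D q \<longrightarrow> norm (T f0 x) \<le> step_const * A" by eventually_elim (simp add: True)
    then show ?thesis unfolding f0_def by (intro exI[of _ "{}"]) (auto simp: disjoint_family_on_def)
  next
    case False
    then have A1: "0 < A" using A0 by simp
    define E1 where "E1 = {x. level_T * A < norm (T f0 x)}"
    have E1m: "E1 \<in> sets lebesgue"
      using measurable_sets[of "\<lambda>x. norm (T f0 x)" lebesgue borel "{level_T * A<..}"] by (simp add: vimage_def E1_def)
    have E1e: "emeasure lebesgue E1 \<le> ennreal (eps_cover * s0)"
    proof -
      have "emeasure lebesgue E1 \<le> ennreal (2 * weak_const / (level_T * A)) * ennreal (A * s0)"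
        unfolding E1_def f01[symmetric] by (rule weak_type_1_1[OF L2f0]) (use f01 A1 one_step_consts in auto)
      also have "\<dots> = ennreal (2 * weak_const / (level_T * A) * (A * s0))"
        using A1 s0 weak_const_nonneg one_step_consts by (intro ennreal_mult[symmetric]) auto
      also have "2 * weak_const / (level_T * A) * (A * s0) = (2 * weak_const / level_T) * s0" using A1 by simp
      also have "ennreal \<dots> \<le> ennreal (eps_cover * s0)"
      proof (intro ennreal_leI mult_right_mono)
        have "2 * weak_const \<le> eps_cover * level_T" unfolding level_T_def using one_step_consts(1) by (simp add: algebra_simps)
        then show "2 * weak_const / level_T \<le> eps_cover" using one_step_consts(2) by (simp add: divide_le_eq mult.commute)
      qed (use s0 in auto)
      finally show ?thesis .
    qed
    obtain E2 where E2m: "E2 \<in> sets lebesgue"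
      and E2e: "emeasure lebesgue E2 \<le> ennreal (5 ^ ?n * unit_ball_vol (real ?n) * (A * s0) / (level_max * A))"
      and E2: "\<And>x r. x \<notin> E2 \<Longrightarrow> 0 < r \<Longrightarrow> (\<integral>\<^sup>+y\<in>ball x r. ennreal (norm (f0 y)) \<partial>lebesgue) \<le> ennreal (level_max * A) * ennreal (r ^ ?n)"
      using maximal_bad_set[OF _ f01, of "level_max * A"] A1 s0 one_step_consts(3) by auto
    have "5 ^ ?n * unit_ball_vol (real ?n) * (A * s0) / (level_max * A) = eps_cover * s0"
      using A1 one_step_consts(1) less_imp_neq[OF unit_ball_vol_pos[of "real ?n"]] by (simp add: level_max_def)
    with E2e have E2e: "emeasure lebesgue E2 \<le> ennreal (eps_cover * s0)" by simp
    obtain U where U: "open U" "E1 \<union> E2 \<subseteq> U" "(U - (E1 \<union> E2)) \<in> lmeasurable" "emeasure lebesgue (U - (E1 \<union> E2)) < ennreal (eps_cover * s0)"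
      by (rule sets_lebesgue_outer_open[of "E1 \<union> E2" "eps_cover * s0"]) (use E1m E2m s0 one_step_consts(1) in auto)
    have Um[measurable]: "U \<in> sets lebesgue" using U(1) by simp
    have Ue: "emeasure lebesgue (U \<inter> ?D q) \<le> ennreal (3 * eps_cover) * emeasure lebesgue (?D q)"
    proof -
      have "emeasure lebesgue (U \<inter> ?D q) \<le> emeasure lebesgue ((E1 \<union> E2) \<union> (U - (E1 \<union> E2)))"
        using E1m E2m Um by (intro emeasure_mono) auto
      also have "\<dots> \<le> emeasure lebesgue (E1 \<union> E2) + emeasure lebesgue (U - (E1 \<union> E2))"
        using E1m E2m Um by (intro emeasure_subadditive) auto
      also have "\<dots> \<le> (emeasure lebesgue E1 + emeasure lebesgue E2) + emeasure lebesgue (U - (E1 \<union> E2))"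
        using E1m E2m by (intro add_right_mono emeasure_subadditive) auto
      also have "\<dots> \<le> (ennreal (eps_cover * s0) + ennreal (eps_cover * s0)) + ennreal (eps_cover * s0)"
        using U(4) by (intro add_mono E1e E2e) auto
      also have "\<dots> = ennreal (3 * eps_cover * s0)" using s0 one_step_consts(1) by (simp add: ennreal_plus[symmetric] del: ennreal_plus)
      also have "\<dots> = ennreal (3 * eps_cover) * emeasure lebesgue (?D q)"
        unfolding De s0_def[symmetric] using s0 one_step_consts(1) by (intro ennreal_mult) auto
      finally show ?thesis .
    qed
    obtain I where I: "disjoint_family_on ?D I" "\<And>p. p \<in> I \<Longrightarrow> fst q < fst p" "\<And>p. p \<in> I \<Longrightarrow> ?D p \<subseteq> ?D q"
        "\<And>p. p \<in> I \<Longrightarrow> 2 * emeasure lebesgue (?D p \<inter> U) \<le> emeasure lebesgue (?D p)"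
        "2 * emeasure lebesgue (\<Union>p\<in>I. ?D p) \<le> emeasure lebesgue (?D q)" "U \<inter> ?D q \<subseteq> (\<Union>p\<in>I. ?D p)"
      using stopping_cubes[OF L U(1) Ue] by blast
    have level_T_A: "level_T * A \<le> step_const * A"
      unfolding step_const_def using A1 one_step_consts cK tailc_pos by (intro mult_right_mono) auto
    have off: "norm (T f0 x) \<le> step_const * A" if "x \<in> ?D q" "x \<notin> (\<Union>p\<in>I. ?D p)" for x
    proof -
      have "x \<notin> E1" using that I(6) U(2) by blast
      then have "norm (T f0 x) \<le> level_T * A" by (simp add: E1_def)
      with level_T_A show ?thesis by linarith
    qed
    have on: "AE x in lebesgue. x \<in> ?D p \<longrightarrow> norm (T f0 x) \<le> step_const * A + norm (T (\<lambda>y. indicator (?S p) y * f y) x)"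
      if p: "p \<in> I" for p
    proof -
      define f1 where "f1 = (\<lambda>y. indicator (?S p) y * f y)"
      define F where "F = (\<lambda>y. indicator (?S q - ?S p) y * f y)"
      have sub: "?S p \<subseteq> ?S q" by (rule dstar_mono[OF L I(3)[OF p] I(2)[OF p]])
      have L2: "in_L2 f1" "in_L2 F" unfolding f1_def F_def by (intro in_L2_indicator f; simp)+
      have Tm1[measurable]: "T f1 \<in> borel_measurable lebesgue" using L2(1) by (rule T_meas)
      have Fi: "integrable lebesgue F" unfolding F_def
      proof (rule in_L2_integrable_on[OF f])
        have "emeasure lebesgue (?S q - ?S p) \<le> emeasure lebesgue (?S q)" by (intro emeasure_mono) auto
        also have "\<dots> < \<infinity>" unfolding emeasure_dstar[OF L] by simp
        finally show "emeasure lebesgue (?S q - ?S p) < \<infinity>" .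
      qed simp
      define \<rho> where "\<rho> = real ?n * dside L p"
      have r: "0 < \<rho>" using s[of p] by (simp add: \<rho>_def)
      have Fsupp: "2 * \<rho> < dist x y" if "F y \<noteq> 0" "x \<in> ?D p" for x y
      proof -
        have "y \<notin> ?S p" using that(1) by (auto simp: F_def indicator_def split: if_splits)
        from dist_not_dstar[OF L that(2) this] show ?thesis unfolding \<rho>_def by (simp only: mult.assoc)
      qed
      have ker: "AE x in lebesgue. x \<in> ?D p \<longrightarrow> T F x = (\<integral>y. K x y * F y \<partial>lebesgue)"
      proof -
        have "closure {y. F y \<noteq> 0} \<subseteq> ?S q"
          by (rule closure_minimal) (auto simp: F_def indicator_def dstar_def Let_def closed_cbox)
        moreover have "compact (?S q)" by (simp add: dstar_def Let_def)
        ultimately have "compact (closure {y. F y \<noteq> 0})"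
          by (metis closed_closure compact_Int_closed inf.absorb_iff2)
        then have "AE x in lebesgue. x \<notin> closure {y. F y \<noteq> 0} \<longrightarrow> T F x = (\<integral>y. K x y * F y \<partial>lebesgue)"
          using T_kernel L2(2) unfolding has_kernel_def by blast
        then show ?thesis
        proof eventually_elim
          case (elim x)
          show ?case
          proof
            assume x: "x \<in> ?D p"
            have "closure {y. F y \<noteq> 0} \<subseteq> - ball x \<rho>"
            proof (rule closure_minimal)
              show "{y. F y \<noteq> 0} \<subseteq> - ball x \<rho>" using Fsupp[OF _ x] r by fastforce
            qed (simp add: closed_Compl)
            then have "x \<notin> closure {y. F y \<noteq> 0}" using r by auto
            then show "T F x = (\<integral>y. K x y * F y \<partial>lebesgue)" using elim by blast
          qed
        qed
      qed
      have f0_eq: "f0 = (\<lambda>y. f1 y + F y)" using sub by (auto simp: f0_def f1_def F_def indicator_def fun_eq_iff)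
      have "AE x in lebesgue. T (\<lambda>y. f1 y + F y) x = T f1 x + T F x" by (rule T_add[OF L2])
      then have add: "AE x in lebesgue. T f0 x = T f1 x + T F x" unfolding f0_eq[symmetric] .
      have sp: "0 < dside L p ^ ?n" using s[of p] by simp
      have DpU: "emeasure lebesgue (?D p \<inter> U) \<le> ennreal (dside L p ^ ?n / 2)"
      proof -
        have "ennreal (1 / 2) * (2 * emeasure lebesgue (?D p \<inter> U)) \<le> ennreal (1 / 2) * ennreal (dside L p ^ ?n)"
          using I(4)[OF p] unfolding De by (rule mult_left_mono) simp
        moreover have "ennreal (1 / 2) * (2 * emeasure lebesgue (?D p \<inter> U)) = (ennreal (1 / 2) * ennreal 2) * emeasure lebesgue (?D p \<inter> U)"
          by (simp add: mult.assoc)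
        moreover have "ennreal (1 / 2) * ennreal 2 = 1" by (subst ennreal_mult[symmetric]) auto
        moreover have "ennreal (1 / 2) * ennreal (dside L p ^ ?n) = ennreal (dside L p ^ ?n / 2)"
          using sp by (subst ennreal_mult[symmetric]) auto
        ultimately show ?thesis by simp
      qed
      \<comment> \<open>This yields a preliminary good point x1. Control of the maximal function
        there bounds the mass of f1, which is what the weak type bound for T f1 needs. The point x0
        must also avoid the resulting set \<open>E3\<close> and can be chosen only
        afterwards.\<close>
      have "\<not> ?D p \<subseteq> U"
      proof
        assume "?D p \<subseteq> U"
        then have "?D p \<inter> U = ?D p" by auto
        then have "ennreal (dside L p ^ ?n) \<le> ennreal (dside L p ^ ?n / 2)" using DpU De[of p] by simp
        then show False using sp by simp
      qed
      then obtain x1 where x1: "x1 \<in> ?D p" "x1 \<notin> U" by auto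
      have f1N: "(\<integral>\<^sup>+y. ennreal (norm (f1 y)) \<partial>lebesgue) \<le> ennreal (level_max * A * (rad ^ ?n * dside L p ^ ?n))"
      proof -
        have bd: "dist x1 y < rad * dside L p" if "y \<in> ?S p" for y
        proof -
          have "dist x1 y \<le> real ?n * ((dil TYPE('n) + 1) * dside L p)" by (rule dist_dstar_le[OF L x1(1) that])
          also have "\<dots> < 2 * (real ?n * ((dil TYPE('n) + 1) * dside L p))" using s[of p] by (simp add: add_pos_pos)
          finally show ?thesis by (simp only: rad_def mult_ac)
        qed
        have "(\<integral>\<^sup>+y. ennreal (norm (f1 y)) \<partial>lebesgue) \<le> (\<integral>\<^sup>+y\<in>ball x1 (rad * dside L p). ennreal (norm (f0 y)) \<partial>lebesgue)"
        proof (rule nn_integral_mono)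
          fix y
          show "ennreal (norm (f1 y)) \<le> ennreal (norm (f0 y)) * indicator (ball x1 (rad * dside L p)) y"
            using bd[of y] sub by (cases "y \<in> ?S p") (auto simp: f1_def f0_def indicator_def)
        qed
        also have "\<dots> \<le> ennreal (level_max * A) * ennreal ((rad * dside L p) ^ ?n)"
          by (rule E2) (use x1 U(2) one_step_consts(4) s[of p] in auto)
        also have "\<dots> = ennreal (level_max * A * (rad ^ ?n * dside L p ^ ?n))"
          using A1 one_step_consts s[of p] by (simp add: ennreal_mult[symmetric] power_mult_distrib)
        finally show ?thesis .
      qed
      define E3 where "E3 = {x. level_T_sub * A < norm (T f1 x)}"
      have E3m: "E3 \<in> sets lebesgue"
        using measurable_sets[of "\<lambda>x. norm (T f1 x)" lebesgue borel "{level_T_sub * A<..}"] by (simp add: vimage_def E3_def)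
      have E3e: "emeasure lebesgue E3 \<le> ennreal (dside L p ^ ?n / 4)"
      proof -
        have "emeasure lebesgue E3 \<le> ennreal (2 * weak_const / (level_T_sub * A)) * (\<integral>\<^sup>+y. ennreal (norm (f1 y)) \<partial>lebesgue)"
          unfolding E3_def
        proof (rule weak_type_1_1[OF L2(1)])
          show "(\<integral>\<^sup>+y. ennreal (norm (f1 y)) \<partial>lebesgue) < \<infinity>" using f1N by (rule order_le_less_trans) simp
        qed (use A1 one_step_consts in auto)
        also have "\<dots> \<le> ennreal (2 * weak_const / (level_T_sub * A)) * ennreal (level_max * A * (rad ^ ?n * dside L p ^ ?n))"
          by (rule mult_left_mono[OF f1N]) simp
        also have "\<dots> = ennreal (2 * weak_const / (level_T_sub * A) * (level_max * A * (rad ^ ?n * dside L p ^ ?n)))"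
          using A1 weak_const_nonneg one_step_consts s[of p] by (intro ennreal_mult[symmetric]) auto
        also have "2 * weak_const / (level_T_sub * A) * (level_max * A * (rad ^ ?n * dside L p ^ ?n)) = (2 * weak_const * level_max * rad ^ ?n / level_T_sub) * dside L p ^ ?n"
          using A1 by simp
        also have "ennreal \<dots> \<le> ennreal (1 / 4 * dside L p ^ ?n)"
        proof (intro ennreal_leI mult_right_mono)
          have "2 * weak_const * level_max * rad ^ ?n \<le> 1 / 4 * level_T_sub" unfolding level_T_sub_def by simp
          then show "2 * weak_const * level_max * rad ^ ?n / level_T_sub \<le> 1 / 4" using one_step_consts(5) by (simp add: divide_le_eq)
        qed (use sp in auto)
        finally show ?thesis by simp
      qed
      \<comment> \<open>U takes at most one half of the cube, \<open>E3\<close> at most one quarter,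
        and the two identities fail on null sets only; so a point is left.\<close>
      have "\<exists>x0\<in>?D p. x0 \<notin> U \<and> x0 \<notin> E3 \<and> T f0 x0 = T f1 x0 + T F x0 \<and> T F x0 = (\<integral>y. K x0 y * F y \<partial>lebesgue)"
      proof (rule ccontr)
        assume neg: "\<not> ?thesis"
        have "AE x in lebesgue. x \<in> ?D p \<longrightarrow> x \<in> (?D p \<inter> U) \<union> E3"
          using add ker by eventually_elim (use neg in blast)
        then have "emeasure lebesgue (?D p) \<le> emeasure lebesgue ((?D p \<inter> U) \<union> E3)"
          by (rule emeasure_mono_AE) (use E3m in auto)
        also have "\<dots> \<le> emeasure lebesgue (?D p \<inter> U) + emeasure lebesgue E3"
          using E3m by (intro emeasure_subadditive) auto
        also have "\<dots> \<le> ennreal (dside L p ^ ?n / 2) + ennreal (dside L p ^ ?n / 4)"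
          by (intro add_mono DpU E3e)
        also have "\<dots> = ennreal (dside L p ^ ?n / 2 + dside L p ^ ?n / 4)" using sp by (intro ennreal_plus[symmetric]) auto
        finally have "dside L p ^ ?n \<le> dside L p ^ ?n / 2 + dside L p ^ ?n / 4" unfolding De using sp by simp
        then show False using sp by simp
      qed
      then obtain x0 where x0: "x0 \<in> ?D p" "x0 \<notin> U" "x0 \<notin> E3" "T f0 x0 = T f1 x0 + T F x0"
        "T F x0 = (\<integral>y. K x0 y * F y \<partial>lebesgue)" by blast
      have "x0 \<notin> E1" using x0(2) U(2) by blast
      then have "norm (T f0 x0) \<le> level_T * A" by (simp add: E1_def)
      moreover have "norm (T f1 x0) \<le> level_T_sub * A" using x0(3) by (auto simp: E3_def)
      moreover have "T F x0 = T f0 x0 - T f1 x0" using x0(4) by simp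
      ultimately have TFx0: "norm (T F x0) \<le> level_T * A + level_T_sub * A"
        using norm_triangle_ineq4[of "T f0 x0" "T f1 x0"] by simp
      show ?thesis unfolding f1_def[symmetric] using add ker
      proof eventually_elim
        case (elim x)
        show ?case
        proof
          assume x: "x \<in> ?D p"
          have "ennreal (norm ((\<integral>y. K x y * F y \<partial>lebesgue) - (\<integral>y. K x0 y * F y \<partial>lebesgue))) \<le> ennreal (cK * tailc) * ennreal (level_max * A)"
          proof (rule kernel_osc[OF Fi r])
            show "2 * \<rho> < dist x0 y" if "F y \<noteq> 0" for y using that x0(1) by (rule Fsupp)
            show "dist x0 x \<le> \<rho>" unfolding \<rho>_def by (rule dist_dcube_le[OF L x0(1) x])
            fix t :: real assume t: "0 < t"
            have "(\<integral>\<^sup>+y\<in>ball x0 t. ennreal (norm (F y)) \<partial>lebesgue) \<le> (\<integral>\<^sup>+y\<in>ball x0 t. ennreal (norm (f0 y)) \<partial>lebesgue)"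
              by (intro nn_integral_mono mult_right_mono ennreal_leI) (auto simp: F_def f0_def indicator_def)
            also have "\<dots> \<le> ennreal (level_max * A) * ennreal (t ^ ?n)" by (rule E2) (use x0(2) U(2) t in auto)
            finally show "(\<integral>\<^sup>+y\<in>ball x0 t. ennreal (norm (F y)) \<partial>lebesgue) \<le> ennreal (level_max * A) * ennreal (t ^ ?n)" .
          qed
          also have "\<dots> = ennreal (cK * tailc * level_max * A)"
            using cK tailc_pos one_step_consts A1 by (simp add: ennreal_mult[symmetric] mult.assoc)
          finally have "norm ((\<integral>y. K x y * F y \<partial>lebesgue) - (\<integral>y. K x0 y * F y \<partial>lebesgue)) \<le> cK * tailc * level_max * A"
            using cK tailc_pos one_step_consts A1 by simp
          then have d: "norm (T F x - T F x0) \<le> cK * tailc * level_max * A" using elim x x0(5) by simp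
          have "norm (T F x) \<le> norm (T F x0) + norm (T F x - T F x0)" using norm_triangle_ineq[of "T F x0" "T F x - T F x0"] by simp
          also have "\<dots> \<le> step_const * A" unfolding step_const_def using TFx0 d by (simp add: algebra_simps)
          finally have "norm (T F x) \<le> step_const * A" .
          then show "norm (T f0 x) \<le> step_const * A + norm (T f1 x)"
            using elim norm_triangle_ineq[of "T f1 x" "T F x"] by simp
        qed
      qed
    qed
    show ?thesis unfolding f0_def[symmetric]
      by (intro exI[of _ I] conjI ballI I AE_I2 impI off on)
  qed
qed

end

section \<open>Orlicz averages\<close>

text \<open>Superlevel sets are closed upwards, hence rays starting at their infimum, with or
  without the endpoint.\<close>

lemma borel_measurable_mono_ennreal:
  fixes \<Phi> :: "ennreal \<Rightarrow> ennreal"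
  assumes "mono \<Phi>"
  shows "\<Phi> \<in> borel_measurable borel"
proof (rule borel_measurableI_greater)
  fix y
  define S where "S = {x. y < \<Phi> x}"
  have up: "z \<in> S" if "x \<in> S" "x \<le> z" for x z
    using that monoD[OF assms, of x z] by (auto simp: S_def)
  have "S = (if Inf S \<in> S then {Inf S..} else {Inf S<..})"
  proof (cases "Inf S \<in> S")
    case True
    then show ?thesis using up by (auto intro: Inf_lower)
  next
    case False
    have "x \<in> S" if x: "Inf S < x" for x
    proof -
      obtain z where "z \<in> S" "z < x" using x by (auto simp: Inf_less_iff)
      then show ?thesis using up[of z x] by simp
    qed
    moreover have "Inf S < x" if "x \<in> S" for x
    proof -
      have "Inf S \<le> x" using that by (rule Inf_lower)
      moreover have "Inf S \<noteq> x" using that False by auto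
      ultimately show ?thesis by simp
    qed
    ultimately show ?thesis using False by auto
  qed
  moreover have "(if Inf S \<in> S then {Inf S..} else {Inf S<..}) \<in> sets borel" by simp
  ultimately have "S \<in> sets borel" by simp
  then show "{x \<in> space borel. y < \<Phi> x} \<in> sets borel" by (simp add: S_def)
qed

section \<open>Young functions and their complements\<close>

lemma young_mono: "young_function A \<Longrightarrow> mono A"
  by (simp add: young_function_def)

text \<open>Convexity and A 0 = 0 make A t / t nondecreasing, so beyond a point with positive value
  A grows at least linearly.\<close>

lemma young_linear_growth:
  assumes A: "young_function A"
  shows "\<exists>t0 \<alpha>. 0 < t0 \<and> 0 < \<alpha> \<and> (\<forall>t\<ge>t0. ennreal (\<alpha> * (t / t0)) \<le> A (ennreal t))"
proof -
  have A0: "A 0 = 0" and conv: "\<And>a b s t. a + b = 1 \<Longrightarrow> A (a * s + b * t) \<le> a * A s + b * A t"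
    using A unfolding young_function_def by blast+
  obtain \<tau> where \<tau>: "\<tau> < \<infinity>" "0 < A \<tau>" using A by (auto simp: young_function_def)
  obtain t0 where t0: "\<tau> = ennreal t0" "0 \<le> t0" using \<tau>(1) by (cases \<tau>) auto
  have t0p: "0 < t0" using t0 \<tau>(2) A0 by (cases "t0 = 0") auto
  \<comment> \<open>A may already be infinite at \<open>\<tau>\<close>; the minimum with 1 provides
    a finite slope.\<close>
  obtain \<alpha> where \<alpha>: "min 1 (A \<tau>) = ennreal \<alpha>" "0 \<le> \<alpha>" by (cases "min 1 (A \<tau>)") (auto simp: min_def split: if_splits)
  have \<alpha>p: "0 < \<alpha>" using \<alpha> \<tau>(2) by (cases "\<alpha> = 0") (auto simp: min_def split: if_splits)
  have "ennreal (\<alpha> * (t / t0)) \<le> A (ennreal t)" if t: "t0 \<le> t" for t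
  proof -
    have eq: "ennreal (t0 / t) * ennreal t + ennreal (1 - t0 / t) * 0 = \<tau>"
      using t t0p t0 by (simp add: ennreal_mult[symmetric])
    have "ennreal (t0 / t) + ennreal (1 - t0 / t) = 1"
      using t t0p by (subst ennreal_plus[symmetric]) auto
    from conv[OF this, of "ennreal t" 0] have "A \<tau> \<le> ennreal (t0 / t) * A (ennreal t)"
      unfolding eq by (simp add: A0)
    moreover have "ennreal \<alpha> \<le> A \<tau>" using \<alpha>(1) by (metis min.cobounded2)
    ultimately have "ennreal (t / t0) * ennreal \<alpha> \<le> ennreal (t / t0) * (ennreal (t0 / t) * A (ennreal t))"
      by (intro mult_left_mono) auto
    also have "\<dots> = (ennreal (t / t0) * ennreal (t0 / t)) * A (ennreal t)" by (simp only: mult.assoc)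
    also have "ennreal (t / t0) * ennreal (t0 / t) = 1" using t t0p by (simp add: ennreal_mult[symmetric])
    finally show ?thesis using t t0p \<alpha>p by (simp add: ennreal_mult[symmetric] mult.commute)
  qed
  with t0p \<alpha>p show ?thesis by blast
qed

text \<open>Linear growth forces the value at infinity. This is what turns a finite Orlicz average
  into almost everywhere finiteness in \<open>orlicz_holder\<close>.\<close>

lemma young_top:
  assumes A: "young_function A" shows "A \<infinity> = \<infinity>"
proof (rule ccontr)
  assume "A \<infinity> \<noteq> \<infinity>"
  then obtain r where r: "A \<infinity> = ennreal r" "0 \<le> r" by (cases "A \<infinity>") auto
  obtain t0 \<alpha> where t: "0 < t0" "0 < \<alpha>" "\<And>t. t0 \<le> t \<Longrightarrow> ennreal (\<alpha> * (t / t0)) \<le> A (ennreal t)"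
    using young_linear_growth[OF A] by blast
  define s where "s = max t0 ((r + 1) * t0 / \<alpha>)"
  have "ennreal (\<alpha> * (s / t0)) \<le> A \<infinity>"
    using t(3)[of s] monoD[OF young_mono[OF A], of "ennreal s" \<infinity>] by (auto simp: s_def)
  then have "\<alpha> * (s / t0) \<le> r" using r by simp
  moreover have "\<alpha> * (((r + 1) * t0 / \<alpha>) / t0) \<le> \<alpha> * (s / t0)"
    using t by (intro mult_left_mono divide_right_mono) (auto simp: s_def)
  ultimately show False using t by simp
qed

lemma complementary_mono: "mono (complementary A)"
  unfolding complementary_def
  by (intro monoI SUP_subset_mono order_refl ennreal_minus_mono mult_right_mono) auto

lemma young_ineq:
  assumes "t < \<infinity>" shows "s * t \<le> A t + complementary A s"
proof -
  have "s * t - A t \<le> complementary A s"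
    unfolding complementary_def using assms by (intro SUP_upper) auto
  then show ?thesis unfolding ennreal_minus_le_iff by simp
qed

text \<open>With s0 <= alpha/t0, linear growth of A makes s0 t - A t vanish for t >= t0; with s0 <=
  1/(2 t0), s0 t is at most 1/2 below t0. The value 1/2 is what \<open>orlicz_max_level\<close> can
  afford to lose out of a mean of 1.\<close>

lemma complementary_small:
  assumes A: "young_function A"
  shows "\<exists>s0>0. complementary A (ennreal s0) \<le> ennreal (1 / 2)"
proof -
  obtain t0 \<alpha> where t: "0 < t0" "0 < \<alpha>" "\<And>t. t0 \<le> t \<Longrightarrow> ennreal (\<alpha> * (t / t0)) \<le> A (ennreal t)"
    using young_linear_growth[OF A] by blast
  define s0 where "s0 = min (\<alpha> / t0) (1 / (2 * t0))"
  have s0: "0 < s0" using t by (simp add: s0_def)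
  have "complementary A (ennreal s0) \<le> ennreal (1 / 2)"
    unfolding complementary_def
  proof (rule SUP_least)
    fix \<tau> :: ennreal assume "\<tau> \<in> {t. t < \<infinity>}"
    then obtain r where r: "\<tau> = ennreal r" "0 \<le> r" by (cases \<tau>) auto
    have m: "ennreal s0 * \<tau> = ennreal (s0 * r)" using r s0 by (simp add: ennreal_mult)
    show "ennreal s0 * \<tau> - A \<tau> \<le> ennreal (1 / 2)"
    proof (cases "t0 \<le> r")
      case True
      have "s0 * r \<le> \<alpha> / t0 * r" using r by (intro mult_right_mono) (auto simp: s0_def)
      then have "ennreal s0 * \<tau> \<le> A \<tau>" unfolding m using t(3)[OF True] r(1)
        by (simp add: order_trans[OF ennreal_leI])
      then show ?thesis unfolding ennreal_minus_le_iff m by (simp add: add_increasing2)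
    next
      case False
      have "s0 * r \<le> 1 / (2 * t0) * t0" using r False s0 t by (intro mult_mono) (auto simp: s0_def)
      then have "ennreal s0 * \<tau> \<le> ennreal (1 / 2)" unfolding m using t by (intro ennreal_leI) simp
      then show ?thesis by (rule order_trans[OF diff_le_self_ennreal])
    qed
  qed
  with s0 show ?thesis by blast
qed

section \<open>Luxemburg averages and Hoelder's inequality\<close>

lemma luxemburg_avg_upper:
  assumes "0 < l" "(\<integral>\<^sup>+x\<in>Q. A (f x / ennreal l) \<partial>lebesgue) / emeasure lebesgue Q \<le> 1"
  shows "luxemburg_avg A Q f \<le> ennreal l"
  unfolding luxemburg_avg_def using assms by (intro Inf_lower) auto

lemma divide_le_one_iff_ennreal:
  fixes a b :: ennreal
  assumes "0 < b" "b < \<infinity>" shows "a / b \<le> 1 \<longleftrightarrow> a \<le> b"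
proof -
  have "a / b \<le> 1 \<longleftrightarrow> \<not> 1 < a / b" by (simp add: not_less)
  obtain r where r: "b = ennreal r" "0 < r" using assms by (cases b) auto
  show ?thesis
  proof (cases a)
    case (real s)
    then show ?thesis using r by (simp add: divide_ennreal)
  next
    case top
    then show ?thesis using r by (simp add: ennreal_top_divide top_unique)
  qed
qed

lemma luxemburg_gt:
  assumes l: "0 < l" "ennreal l < luxemburg_avg A Q f" and Q: "0 < emeasure lebesgue Q" "emeasure lebesgue Q < \<infinity>"
  shows "emeasure lebesgue Q < (\<integral>\<^sup>+x\<in>Q. A (f x / ennreal l) \<partial>lebesgue)"
proof (rule ccontr)
  assume "\<not> ?thesis"
  then have "luxemburg_avg A Q f \<le> ennreal l"
    using Q by (intro luxemburg_avg_upper l) (simp add: divide_le_one_iff_ennreal not_less)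
  then show False using l(2) by simp
qed

text \<open>Stated with a strict bound \<open>b\<close> instead of the first average in order to avoid products
  \<open>0 * \<infinity>\<close>.\<close>

lemma orlicz_holder:
  fixes \<phi> \<psi> :: "real^'n \<Rightarrow> ennreal"
  assumes B: "young_function B" and Q[measurable]: "Q \<in> sets lebesgue" and Qp: "0 < emeasure lebesgue Q" "emeasure lebesgue Q < \<infinity>"
    and [measurable]: "\<phi> \<in> borel_measurable lebesgue" "\<psi> \<in> borel_measurable lebesgue"
    and b: "luxemburg_avg B Q \<phi> < ennreal b" "0 < b"
  shows "(AE x in lebesgue. x \<in> Q \<longrightarrow> \<phi> x < \<infinity>)"
    and "(\<integral>\<^sup>+x\<in>Q. \<phi> x * \<psi> x \<partial>lebesgue) \<le> ennreal (2 * b) * emeasure lebesgue Q * luxemburg_avg (complementary B) Q \<psi>"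
proof -
  let ?C = "complementary B"
  have [measurable]: "B \<in> borel_measurable borel" "?C \<in> borel_measurable borel"
    by (rule borel_measurable_mono_ennreal young_mono[OF B] complementary_mono)+
  obtain l where l: "0 < l" "ennreal l < ennreal b" "(\<integral>\<^sup>+x\<in>Q. B (\<phi> x / ennreal l) \<partial>lebesgue) / emeasure lebesgue Q \<le> 1"
    using b(1) unfolding luxemburg_avg_def by (auto simp: Inf_less_iff)
  have lb: "l < b" using l by (simp add: ennreal_less_iff)
  have "(\<integral>\<^sup>+x\<in>Q. B (\<phi> x / ennreal b) \<partial>lebesgue) \<le> (\<integral>\<^sup>+x\<in>Q. B (\<phi> x / ennreal l) \<partial>lebesgue)"
  proof (intro nn_integral_mono mult_right_mono monoD[OF young_mono[OF B]])
    fix x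
    have "inverse (ennreal b) \<le> inverse (ennreal l)" using lb l(1) by (simp add: inverse_ennreal ennreal_leI)
    then show "\<phi> x / ennreal b \<le> \<phi> x / ennreal l" unfolding divide_ennreal_def by (rule mult_left_mono) simp
  qed simp
  also have "\<dots> \<le> emeasure lebesgue Q" using l(3) Qp by (simp add: divide_le_one_iff_ennreal)
  finally have Bb: "(\<integral>\<^sup>+x\<in>Q. B (\<phi> x / ennreal b) \<partial>lebesgue) \<le> emeasure lebesgue Q" .
  have "AE x in lebesgue. B (\<phi> x / ennreal b) * indicator Q x \<noteq> \<infinity>"
    by (rule nn_integral_PInf_AE) (use Bb Qp in \<open>auto simp: top_unique\<close>)
  \<comment> \<open>Where phi is infinite, so is B (phi / b), by \<open>young_top\<close>; the
    finite integral \<open>Bb\<close> leaves only a null set for this in Q.\<close>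
  then show fin: "AE x in lebesgue. x \<in> Q \<longrightarrow> \<phi> x < \<infinity>"
  proof eventually_elim
    case (elim x)
    then show ?case using young_top[OF B] b(2)
      by (cases "\<phi> x") (auto simp: ennreal_top_divide indicator_def split: if_splits)
  qed
  \<comment> \<open>Young's inequality for phi/b and psi/m, multiplied by b m; each of the two
    resulting integrals is at most |Q|, hence the factor 2.\<close>
  have key: "(\<integral>\<^sup>+x\<in>Q. \<phi> x * \<psi> x \<partial>lebesgue) \<le> ennreal (2 * b) * emeasure lebesgue Q * ennreal m"
    if m: "0 < m" "(\<integral>\<^sup>+x\<in>Q. ?C (\<psi> x / ennreal m) \<partial>lebesgue) / emeasure lebesgue Q \<le> 1" for m
  proof -
    have "(\<integral>\<^sup>+x\<in>Q. \<phi> x * \<psi> x \<partial>lebesgue) \<le> (\<integral>\<^sup>+x. ennreal (b * m) * (B (\<phi> x / ennreal b) * indicator Q x + ?C (\<psi> x / ennreal m) * indicator Q x) \<partial>lebesgue)"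
    proof (rule nn_integral_mono_AE)
      show "AE x in lebesgue. \<phi> x * \<psi> x * indicator Q x \<le> ennreal (b * m) * (B (\<phi> x / ennreal b) * indicator Q x + ?C (\<psi> x / ennreal m) * indicator Q x)"
        using fin
      proof eventually_elim
        case (elim x)
        show ?case
        proof (cases "x \<in> Q")
          case True
          then have fx: "\<phi> x < \<infinity>" using elim by simp
          then have "\<phi> x / ennreal b < \<infinity>" using b(2) by (cases "\<phi> x") (auto simp: divide_ennreal)
          then have "(\<psi> x / ennreal m) * (\<phi> x / ennreal b) \<le> B (\<phi> x / ennreal b) + ?C (\<psi> x / ennreal m)"
            by (rule young_ineq)
          then have "ennreal (b * m) * ((\<psi> x / ennreal m) * (\<phi> x / ennreal b)) \<le> ennreal (b * m) * (B (\<phi> x / ennreal b) + ?C (\<psi> x / ennreal m))"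
            by (rule mult_left_mono) simp
          moreover have "ennreal (b * m) * ((\<psi> x / ennreal m) * (\<phi> x / ennreal b)) = (\<phi> x / ennreal b * ennreal b) * (\<psi> x / ennreal m * ennreal m)"
            using b(2) m(1) by (simp add: ennreal_mult mult_ac)
          moreover have "\<phi> x / ennreal b * ennreal b = \<phi> x" "\<psi> x / ennreal m * ennreal m = \<psi> x"
            using b(2) m(1) by (auto simp: ennreal_divide_times ennreal_mult_divide_eq)
          ultimately show ?thesis using True by simp
        qed auto
      qed
    qed
    also have "\<dots> = ennreal (b * m) * ((\<integral>\<^sup>+x\<in>Q. B (\<phi> x / ennreal b) \<partial>lebesgue) + (\<integral>\<^sup>+x\<in>Q. ?C (\<psi> x / ennreal m) \<partial>lebesgue))"
      by (subst nn_integral_cmult, measurable, subst nn_integral_add) auto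
    also have "\<dots> \<le> ennreal (b * m) * (emeasure lebesgue Q + emeasure lebesgue Q)"
      using m(2) Qp by (intro mult_left_mono add_mono Bb) (auto simp: divide_le_one_iff_ennreal)
    also have "\<dots> = ennreal (b * m) * (ennreal 2 * emeasure lebesgue Q)" by (simp add: mult_2)
    also have "\<dots> = ennreal (2 * b) * emeasure lebesgue Q * ennreal m"
      using b(2) m(1) by (simp add: ennreal_mult mult_ac)
    finally show ?thesis .
  qed
  \<comment> \<open>Division by this positive finite number moves the bound \<open>key\<close> under
    the infimum over admissible m.\<close>
  define c where "c = ennreal (2 * b) * emeasure lebesgue Q"
  have c: "c \<noteq> 0" "c \<noteq> \<infinity>" using b Qp by (auto simp: c_def ennreal_mult_eq_top_iff)
  have "(\<integral>\<^sup>+x\<in>Q. \<phi> x * \<psi> x \<partial>lebesgue) / c \<le> luxemburg_avg ?C Q \<psi>"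
    unfolding luxemburg_avg_def
  proof (rule Inf_greatest)
    fix y assume "y \<in> {ennreal l |l. 0 < l \<and> (\<integral>\<^sup>+x\<in>Q. ?C (\<psi> x / ennreal l) \<partial>lebesgue) / emeasure lebesgue Q \<le> 1}"
    then obtain m where m: "y = ennreal m" "0 < m" "(\<integral>\<^sup>+x\<in>Q. ?C (\<psi> x / ennreal m) \<partial>lebesgue) / emeasure lebesgue Q \<le> 1" by blast
    have "(\<integral>\<^sup>+x\<in>Q. \<phi> x * \<psi> x \<partial>lebesgue) / c \<le> (c * ennreal m) / c"
      using key[OF m(2,3)] unfolding c_def[symmetric] by (rule divide_right_mono_ennreal)
    also have "\<dots> = y" using c m(1) by (simp add: mult.commute[of c] ennreal_mult_divide_eq)
    finally show "(\<integral>\<^sup>+x\<in>Q. \<phi> x * \<psi> x \<partial>lebesgue) / c \<le> y" .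
  qed
  then have "c * ((\<integral>\<^sup>+x\<in>Q. \<phi> x * \<psi> x \<partial>lebesgue) / c) \<le> c * luxemburg_avg ?C Q \<psi>" by (rule mult_left_mono) simp
  moreover have "c * ((\<integral>\<^sup>+x\<in>Q. \<phi> x * \<psi> x \<partial>lebesgue) / c) = (\<integral>\<^sup>+x\<in>Q. \<phi> x * \<psi> x \<partial>lebesgue)"
    using c by (simp add: ennreal_times_divide mult.commute[of c] ennreal_mult_divide_eq)
  ultimately show "(\<integral>\<^sup>+x\<in>Q. \<phi> x * \<psi> x \<partial>lebesgue) \<le> ennreal (2 * b) * emeasure lebesgue Q * luxemburg_avg ?C Q \<psi>"
    by (simp add: c_def)
qed

text \<open>The averages are over dilates, but the supremum runs over the dyadic cubes containing x.
  Each term is thus constant on the cubes of its level, which gives measurability at once.\<close>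

definition orlicz_max :: "real \<Rightarrow> (ennreal \<Rightarrow> ennreal) \<Rightarrow> (real^'n \<Rightarrow> ennreal) \<Rightarrow> real^'n \<Rightarrow> ennreal" where
  "orlicz_max L \<Phi> h x = (SUP j. luxemburg_avg \<Phi> (dstar L (j, didx L j x)) h)"

lemma orlicz_max_measurable:
  assumes L: "0 < L" shows "orlicz_max L \<Phi> h \<in> borel_measurable lebesgue"
  unfolding orlicz_max_def
proof (rule borel_measurable_SUP)
  fix j
  show "(\<lambda>x. luxemburg_avg \<Phi> (dstar L (j, didx L j x)) h) \<in> borel_measurable lebesgue"
  proof (rule measurableI)
    fix A :: "ennreal set"
    have "(\<lambda>x. luxemburg_avg \<Phi> (dstar L (j, didx L j x)) h) -` A =
      (\<Union>m\<in>{m. luxemburg_avg \<Phi> (dstar L (j, m)) h \<in> A}. dcube L (j, m))"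
      by (auto simp: dcube_def)
    moreover have "\<dots> \<in> sets lebesgue"
      using L by (intro sets.countable_UN') auto
    ultimately show "(\<lambda>x. luxemburg_avg \<Phi> (dstar L (j, didx L j x)) h) -` A \<inter> space lebesgue \<in> sets lebesgue" by simp
  qed auto
qed auto

lemma luxemburg_le_orlicz_max:
  assumes "x \<in> dcube L q" shows "luxemburg_avg \<Phi> (dstar L q) h \<le> orlicz_max L \<Phi> h x"
proof -
  have "luxemburg_avg \<Phi> (dstar L (fst q, didx L (fst q) x)) h \<le> orlicz_max L \<Phi> h x"
    unfolding orlicz_max_def by (rule SUP_upper) simp
  then show ?thesis using dcube_eqD[OF assms] by simp
qed

section \<open>The dyadic Orlicz maximal function\<close>

text \<open>Discretisation of the integral in the B_p condition along a i = c' 2^i: on each interval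
  from a i to 2 a i the monotone function is at least its value at the left end, and the remaining
  factor is comparable to a power of 2^i.\<close>

lemma Bp_sum:
  fixes s p :: real
  assumes \<Phi>: "mono \<Phi>" and Bp: "Bp_condition p \<Phi>" and p: "0 < p"
  shows "(\<Sum>i. \<Phi> (ennreal (s * 2 ^ i)) * ennreal ((2 powr - p) ^ i)) < \<infinity>"
proof -
  obtain c :: real where c: "0 < c" and J: "(\<integral>\<^sup>+t\<in>{c<..}. \<Phi> (ennreal t) / ennreal (t powr p) / ennreal t \<partial>lborel) < \<infinity>"
    using Bp by (auto simp: Bp_condition_def)
  define \<psi> where "\<psi> t = \<Phi> (ennreal t) / ennreal (t powr p) / ennreal t" for t
  have [measurable]: "\<Phi> \<in> borel_measurable borel" by (rule borel_measurable_mono_ennreal[OF \<Phi>])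
  have \<psi>m[measurable]: "\<psi> \<in> borel_measurable lborel" unfolding \<psi>_def by measurable
  \<comment> \<open>At least s, so that a i dominates s 2^i, and above c, so that the intervals stay
    in the domain of the integral.\<close>
  define c' where "c' = max s (c + 1)"
  have c': "0 < c'" "c < c'" "s \<le> c'" using c by (auto simp: c'_def)
  define a where "a i = c' * 2 ^ i" for i :: nat
  have a: "0 < a i" "c < a i" for i
  proof -
    have "c' * 1 \<le> a i" unfolding a_def using c' by (intro mult_left_mono) auto
    then show "0 < a i" "c < a i" using c' by auto
  qed
  \<comment> \<open>Chosen so that D, the least value k of 1/t^(p+1) on the interval, and its length
    a i multiply to exactly 2^(-p i).\<close>
  define D where "D = 2 * (2 * c') powr p"
  have tm: "\<Phi> (ennreal (s * 2 ^ i)) * ennreal ((2 powr - p) ^ i) \<le> ennreal D * (\<integral>\<^sup>+t\<in>{a i..<a (Suc i)}. \<psi> t \<partial>lborel)" for i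
  proof -
    define k where "k = 1 / ((2 * a i) powr p * (2 * a i))"
    have k: "0 < k" using a[of i] by (simp add: k_def)
    have "\<Phi> (ennreal (a i)) * ennreal k * indicator {a i..<a (Suc i)} t \<le> \<psi> t * indicator {a i..<a (Suc i)} t" for t
    proof (cases "t \<in> {a i..<a (Suc i)}")
      case True
      then have t: "a i \<le> t" "t < 2 * a i" by (auto simp: a_def)
      have t0: "0 < t" using t(1) a(1)[of i] by simp
      have "k \<le> 1 / (t powr p * t)" unfolding k_def
        using t t0 p by (intro divide_left_mono mult_mono powr_mono2 mult_pos_pos) auto
      then have "\<Phi> (ennreal (a i)) * ennreal k \<le> \<Phi> (ennreal t) * ennreal (1 / (t powr p * t))"
        using t by (intro mult_mono monoD[OF \<Phi>] ennreal_leI) auto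
      also have "\<dots> = \<psi> t" unfolding \<psi>_def using t0
        by (simp add: divide_ennreal_def inverse_ennreal ennreal_mult[symmetric] mult.assoc field_simps)
      finally show ?thesis using True by simp
    qed auto
    then have "(\<integral>\<^sup>+t. \<Phi> (ennreal (a i)) * ennreal k * indicator {a i..<a (Suc i)} t \<partial>lborel) \<le> (\<integral>\<^sup>+t\<in>{a i..<a (Suc i)}. \<psi> t \<partial>lborel)"
      by (intro nn_integral_mono) auto
    also have "(\<integral>\<^sup>+t. \<Phi> (ennreal (a i)) * ennreal k * indicator {a i..<a (Suc i)} t \<partial>lborel) = \<Phi> (ennreal (a i)) * ennreal k * ennreal (a i)"
      using a(1)[of i] by (subst nn_integral_cmult_indicator) (auto simp: a_def)
    finally have h1: "ennreal D * (\<Phi> (ennreal (a i)) * ennreal k * ennreal (a i)) \<le> ennreal D * (\<integral>\<^sup>+t\<in>{a i..<a (Suc i)}. \<psi> t \<partial>lborel)"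
      by (rule mult_left_mono) simp
    have h2: "ennreal D * (\<Phi> (ennreal (a i)) * ennreal k * ennreal (a i)) = \<Phi> (ennreal (a i)) * ennreal ((2 powr - p) ^ i)"
    proof -
      have "ennreal D * (\<Phi> (ennreal (a i)) * ennreal k * ennreal (a i)) = \<Phi> (ennreal (a i)) * (ennreal D * ennreal k * ennreal (a i))"
        unfolding mult.assoc by (rule mult.left_commute)
      also have "ennreal D * ennreal k * ennreal (a i) = ennreal (D * k * a i)"
        using k a(1)[of i] by (simp add: ennreal_mult D_def)
      also have "D * k * a i = (2 * c') powr p / (2 * a i) powr p"
        using a(1)[of i] by (simp add: D_def k_def)
      also have "(2 * a i) powr p = (2 * c') powr p * (2 ^ i) powr p"
        unfolding a_def mult.assoc[symmetric] by (rule powr_mult)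
      also have "(2 * c') powr p / ((2 * c') powr p * (2 ^ i) powr p) = inverse ((2 ^ i) powr p)"
        using c' by (simp add: inverse_eq_divide)
      also have "inverse ((2 ^ i) powr p) = (2 powr real i) powr (- p)" by (simp add: powr_realpow powr_minus)
      also have "\<dots> = (2 powr - p) powr real i" by (simp add: powr_powr mult.commute)
      also have "\<dots> = (2 powr - p) ^ i" by (simp add: powr_realpow)
      finally show ?thesis .
    qed
    have h3: "\<Phi> (ennreal (s * 2 ^ i)) * ennreal ((2 powr - p) ^ i) \<le> \<Phi> (ennreal (a i)) * ennreal ((2 powr - p) ^ i)"
      using c'(3) by (intro mult_right_mono monoD[OF \<Phi>] ennreal_leI) (auto simp: a_def)
    show ?thesis using h3 h1 unfolding h2 by (rule order_trans)
  qed
  have disj: "disjoint_family_on (\<lambda>i. {a i..<a (Suc i)}) UNIV"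
  proof -
    have "{a i..<a (Suc i)} \<inter> {a j..<a (Suc j)} = {}" if "i < j" for i j
    proof -
      have "(2::real) ^ Suc i \<le> 2 ^ j" using that by (intro power_increasing) auto
      then have "a (Suc i) \<le> a j" unfolding a_def using c'(1) by (intro mult_left_mono) auto
      then show ?thesis by auto
    qed
    then show ?thesis unfolding disjoint_family_on_def by (metis Int_commute nat_neq_iff)
  qed
  have "(\<Sum>i. \<Phi> (ennreal (s * 2 ^ i)) * ennreal ((2 powr - p) ^ i)) \<le> (\<Sum>i. ennreal D * (\<integral>\<^sup>+t\<in>{a i..<a (Suc i)}. \<psi> t \<partial>lborel))"
    by (intro suminf_le tm) auto
  also have "\<dots> = ennreal D * (\<Sum>i. \<integral>\<^sup>+t\<in>{a i..<a (Suc i)}. \<psi> t \<partial>lborel)" by simp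
  also have "(\<Sum>i. \<integral>\<^sup>+t\<in>{a i..<a (Suc i)}. \<psi> t \<partial>lborel) = (\<integral>\<^sup>+t\<in>(\<Union>i. {a i..<a (Suc i)}). \<psi> t \<partial>lborel)"
    unfolding nn_integral_count_space_nat[symmetric] by (rule nn_integral_disjoint_UN[OF _ disj, symmetric]) auto
  also have "ennreal D * \<dots> \<le> ennreal D * (\<integral>\<^sup>+t\<in>{c<..}. \<psi> t \<partial>lborel)"
  proof (rule mult_left_mono[OF nn_integral_mono])
    fix t
    have "c < t" if "t \<in> (\<Union>i. {a i..<a (Suc i)})" for t using that a(2) by (auto intro: less_le_trans)
    then show "\<psi> t * indicator (\<Union>i. {a i..<a (Suc i)}) t \<le> \<psi> t * indicator {c<..} t"
      by (intro mult_left_mono) (auto simp: indicator_def)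
  qed auto
  also have "\<dots> < \<infinity>" using J by (auto simp: \<psi>_def ennreal_mult_less_top)
  finally show ?thesis .
qed

text \<open>The power function on \<open>[0,\<infinity>]\<close>, as \<open>powr\<close> is not available on \<^typ>\<open>ennreal\<close>.\<close>

definition epow :: "real \<Rightarrow> ennreal \<Rightarrow> ennreal" where
  "epow p x = (if x = \<infinity> then \<infinity> else ennreal (enn2real x powr p))"

text \<open>Young's inequality after rescaling, with an arbitrarily small weight on the second
  factor; that factor will be the one absorbed.\<close>

lemma young_eps:
  assumes p: "1 < p" and e: "0 < e"
  shows "\<exists>c>0. \<forall>a b. a * b \<le> ennreal c * epow p a + ennreal e * epow (p / (p - 1)) b"
proof -
  define q where "q = p / (p - 1)"
  have q: "1 < q" "1 / p + 1 / q = 1" using p by (auto simp: q_def field_simps)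
  \<comment> \<open>Writing a b as (a/eta)(eta b) with eta^q = e puts the weight e on b^q.\<close>
  define \<eta> where "\<eta> = e powr (1 / q)"
  have \<eta>: "0 < \<eta>" "\<eta> powr q = e" using e q by (auto simp: \<eta>_def powr_powr)
  define c where "c = (1 / \<eta>) powr p"
  have c: "0 < c" using \<eta> by (simp add: c_def)
  have real: "a * b \<le> c * a powr p + e * b powr q" if "0 \<le> a" "0 \<le> b" for a b
  proof -
    have "a * b = (1 / \<eta> * a) * (\<eta> * b)" using \<eta> by simp
    also have "\<dots> \<le> (1 / \<eta> * a) powr p / p + (\<eta> * b) powr q / q"
      using that \<eta> by (intro Youngs_inequality p q) auto
    also have "\<dots> \<le> (1 / \<eta> * a) powr p + (\<eta> * b) powr q"
      using p q by (intro add_mono) (auto simp: divide_le_eq mult_le_cancel_left1)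
    also have "\<dots> = c * a powr p + e * b powr q"
      unfolding c_def using that \<eta> powr_mult[of "1 / \<eta>" a p] powr_mult[of \<eta> b q] by (simp only: less_imp_le divide_nonneg_nonneg zero_le_one)
    finally show ?thesis .
  qed
  have "a * b \<le> ennreal c * epow p a + ennreal e * epow q b" for a b
  proof (cases "a = \<infinity> \<or> b = \<infinity>")
    case True
    then show ?thesis using c e
      by (auto simp: epow_def ennreal_mult_top ennreal_top_mult)
  next
    case False
    then obtain r s where rs: "a = ennreal r" "0 \<le> r" "b = ennreal s" "0 \<le> s" by (cases a; cases b) auto
    then have "a * b = ennreal (r * s)" by (simp add: ennreal_mult)
    also have "\<dots> \<le> ennreal (c * r powr p + e * s powr q)" using rs by (intro ennreal_leI real)
    also have "\<dots> = ennreal c * epow p a + ennreal e * epow q b"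
      using rs c e by (simp add: epow_def ennreal_mult)
    finally show ?thesis .
  qed
  with c show ?thesis unfolding q_def by blast
qed

text \<open>A dyadic layer cake: the single j with 2^j < y <= 2^(j+1) already dominates a finite
  positive y, and for infinite y the terms are unbounded.\<close>

lemma epow_le_dyadic_sum:
  assumes p: "0 < p"
  shows "epow p y \<le> (\<integral>\<^sup>+j. ennreal ((2 powr (real_of_int j + 1)) powr p) * of_bool (ennreal (2 powr real_of_int j) < y) \<partial>count_space UNIV)"
    (is "_ \<le> ?I")
proof -
  have point: "ennreal ((2 powr (real_of_int j + 1)) powr p) \<le> ?I" if "ennreal (2 powr real_of_int j) < y" for j
    using nn_integral_ge_point[of j UNIV "\<lambda>j. ennreal ((2 powr (real_of_int j + 1)) powr p) * of_bool (ennreal (2 powr real_of_int j) < y)"] that by simp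
  show ?thesis
  proof (cases "y = \<infinity>")
    case True
    have "?I = \<infinity>"
    proof (rule ccontr)
      assume "?I \<noteq> \<infinity>"
      then obtain r where r: "?I = ennreal r" "0 \<le> r" by (cases ?I) auto
      obtain n where n: "r < (2 powr p) ^ n" using real_arch_pow[of "2 powr p" r] p by auto
      have "(2 powr p) ^ n \<le> (2 powr p) ^ Suc n" using p by (intro power_increasing) (auto simp: ge_one_powr_ge_zero)
      also have "(2 powr p) ^ Suc n = (2 powr p) powr real (Suc n)" by (simp only: powr_realpow powr_gt_zero simp_thms)
      also have "\<dots> = (2 powr (real_of_int (int n) + 1)) powr p" by (simp add: powr_powr mult.commute add.commute)
      finally have "ennreal r < ennreal ((2 powr (real_of_int (int n) + 1)) powr p)" using n r by (intro ennreal_lessI) auto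
      also have "\<dots> \<le> ?I" by (rule point) (simp add: True)
      finally show False using r by simp
    qed
    then show ?thesis by simp
  next
    case False
    then obtain r where r: "y = ennreal r" "0 \<le> r" by (cases y) auto
    show ?thesis
    proof (cases "r = 0")
      case True
      then show ?thesis using r p by (simp add: epow_def)
    next
      case False
      then have r0: "0 < r" using r by simp
      define j where "j = \<lceil>log 2 r\<rceil> - 1"
      have j: "real_of_int j < log 2 r" "log 2 r \<le> real_of_int j + 1" unfolding j_def by linarith+
      have "2 powr real_of_int j < r" using j(1) r0 by (simp add: less_log_iff)
      then have lt: "ennreal (2 powr real_of_int j) < y" using r by (simp add: ennreal_less_iff)
      have "r \<le> 2 powr (real_of_int j + 1)" using j(2) r0 by (simp add: log_le_iff)
      then have "epow p y \<le> ennreal ((2 powr (real_of_int j + 1)) powr p)"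
        using r p by (auto simp: epow_def intro!: ennreal_leI powr_mono2)
      also have "\<dots> \<le> ?I" by (rule point[OF lt])
      finally show ?thesis .
    qed
  qed
qed

text \<open>Levels with s0 2^j >= y contribute nothing. Counting i steps down from the last possible
  level m, the argument y / 2^(m-i) is at most 2 s0 2^i and the weight is at most (2 y/s0)^p 2^(-p
  i): the series of \<open>Bp_sum\<close>.\<close>

lemma dyadic_sum_le:
  assumes \<Phi>: "mono \<Phi>" and s0: "0 < s0" and p: "0 < p" and y: "0 \<le> y"
  shows "(\<integral>\<^sup>+j. ennreal ((2 powr (real_of_int j + 1)) powr p) * (of_bool (s0 * 2 powr real_of_int j < y) * \<Phi> (ennreal y / ennreal (2 powr real_of_int j))) \<partial>count_space UNIV)
    \<le> ennreal ((2 / s0) powr p) * (\<Sum>i. \<Phi> (ennreal (2 * s0 * 2 ^ i)) * ennreal ((2 powr - p) ^ i)) * ennreal (y powr p)"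
proof (cases "y = 0")
  case True
  then have "\<not> s0 * 2 powr real_of_int j < y" for j using s0 by (simp add: not_less)
  then show ?thesis by simp
next
  case False
  then have y0: "0 < y" using y by simp
  define f where "f j = ennreal ((2 powr (real_of_int j + 1)) powr p) * (of_bool (s0 * 2 powr real_of_int j < y) * \<Phi> (ennreal y / ennreal (2 powr real_of_int j)))" for j
  define m where "m = \<lfloor>log 2 (y / s0)\<rfloor>"
  have m: "real_of_int m \<le> log 2 (y / s0)" "log 2 (y / s0) < real_of_int m + 1" unfolding m_def by linarith+
  have ys: "0 < y / s0" using y0 s0 by simp
  have m1: "2 powr real_of_int m \<le> y / s0" using m(1) ys by (simp add: le_log_iff)
  have m2: "y / s0 < 2 powr (real_of_int m + 1)" using m(2) ys by (simp add: log_less_iff)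
  have zero: "f j = 0" if "m < j" for j
  proof -
    have "2 powr (real_of_int m + 1) \<le> 2 powr real_of_int j" using that by (intro powr_mono) auto
    then have "y / s0 < 2 powr real_of_int j" by (rule less_le_trans[OF m2])
    then have "\<not> s0 * 2 powr real_of_int j < y" using s0 by (simp add: field_simps)
    then show ?thesis by (simp add: f_def)
  qed
  have "(\<integral>\<^sup>+j. f j \<partial>count_space UNIV) = (\<integral>\<^sup>+j. f j \<partial>count_space {..m})"
    by (rule nn_integral_count_space_eq) (use zero in auto)
  also have "\<dots> = (\<integral>\<^sup>+i. f (m - int i) \<partial>count_space UNIV)"
  proof (rule nn_integral_bij_count_space[symmetric])
    show "bij_betw (\<lambda>i::nat. m - int i) UNIV {..m}"
      by (rule bij_betwI[where g = "\<lambda>j. nat (m - j)"]) auto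
  qed
  also have "\<dots> = (\<Sum>i. f (m - int i))" by (rule nn_integral_count_space_nat)
  also have "\<dots> \<le> (\<Sum>i. ennreal ((2 / s0) powr p * y powr p) * (\<Phi> (ennreal (2 * s0 * 2 ^ i)) * ennreal ((2 powr - p) ^ i)))"
  proof (intro suminf_le)
    fix i
    have e: "2 powr (real_of_int (m - int i) + 1) = 2 * 2 powr real_of_int m * 2 powr (- real i)"
    proof -
      have "real_of_int (m - int i) + 1 = 1 + real_of_int m + - real i" by simp
      then show ?thesis by (simp only: powr_add powr_one_gt_zero_iff) simp
    qed
    have e': "2 powr (real_of_int (m - int i)) = 2 powr real_of_int m * 2 powr (- real i)"
      by (simp add: powr_diff powr_minus divide_inverse)
    have 1: "(2 powr (real_of_int (m - int i) + 1)) powr p \<le> (2 / s0) powr p * y powr p * (2 powr - p) ^ i"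
    proof -
      have "(2 powr (real_of_int (m - int i) + 1)) powr p \<le> (2 * (y / s0) * 2 powr (- real i)) powr p"
        unfolding e using m1 p by (intro powr_mono2 mult_right_mono mult_left_mono) auto
      also have "2 * (y / s0) * 2 powr (- real i) = (2 / s0 * y) * 2 powr (- real i)" by simp
      also have "((2 / s0 * y) * 2 powr (- real i)) powr p = (2 / s0 * y) powr p * (2 powr (- real i)) powr p"
        by (rule powr_mult)
      also have "(2 / s0 * y) powr p = (2 / s0) powr p * y powr p" by (rule powr_mult)
      also have "(2 powr (- real i)) powr p = (2 powr - p) powr real i" by (simp add: powr_powr mult.commute)
      also have "\<dots> = (2 powr - p) ^ i" by (simp add: powr_realpow)
      finally show ?thesis .
    qed
    have 2: "\<Phi> (ennreal y / ennreal (2 powr real_of_int (m - int i))) \<le> \<Phi> (ennreal (2 * s0 * 2 ^ i))"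
    proof (rule monoD[OF \<Phi>])
      have "y / 2 powr real_of_int (m - int i) = y / 2 powr real_of_int m * 2 ^ i"
        unfolding e' by (simp add: powr_minus powr_realpow field_simps)
      also have "\<dots> \<le> 2 * s0 * 2 ^ i"
      proof (rule mult_right_mono)
        have "y < 2 powr (real_of_int m + 1) * s0" using m2 s0 by (simp add: field_simps)
        then show "y / 2 powr real_of_int m \<le> 2 * s0" by (simp add: powr_add field_simps)
      qed simp
      finally show "ennreal y / ennreal (2 powr real_of_int (m - int i)) \<le> ennreal (2 * s0 * 2 ^ i)"
        using y by (simp add: divide_ennreal ennreal_leI)
    qed
    have "f (m - int i) \<le> ennreal ((2 powr (real_of_int (m - int i) + 1)) powr p) * \<Phi> (ennreal y / ennreal (2 powr real_of_int (m - int i)))"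
      unfolding f_def by (intro mult_left_mono) auto
    also have "\<dots> \<le> ennreal ((2 / s0) powr p * y powr p * (2 powr - p) ^ i) * \<Phi> (ennreal (2 * s0 * 2 ^ i))"
      by (intro mult_mono 2 ennreal_leI 1) auto
    also have "ennreal ((2 / s0) powr p * y powr p * (2 powr - p) ^ i) = ennreal ((2 / s0) powr p * y powr p) * ennreal ((2 powr - p) ^ i)"
      by (rule ennreal_mult) auto
    finally show "f (m - int i) \<le> ennreal ((2 / s0) powr p * y powr p) * (\<Phi> (ennreal (2 * s0 * 2 ^ i)) * ennreal ((2 powr - p) ^ i))"
      by (simp only: mult_ac)
  qed auto
  also have "\<dots> = ennreal ((2 / s0) powr p * y powr p) * (\<Sum>i. \<Phi> (ennreal (2 * s0 * 2 ^ i)) * ennreal ((2 powr - p) ^ i))"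
    by (rule ennreal_suminf_cmult)
  also have "\<dots> = ennreal ((2 / s0) powr p) * (\<Sum>i. \<Phi> (ennreal (2 * s0 * 2 ^ i)) * ennreal ((2 powr - p) ^ i)) * ennreal (y powr p)"
    by (subst ennreal_mult) (auto simp only: mult_ac powr_ge_zero)
  finally show ?thesis unfolding f_def .
qed

text \<open>If the Luxemburg average over a dilate exceeds t, the mean of Phi(h/t) there exceeds 1.
  Points with h <= s0 t account for at most 1/2, so points with h > s0 t carry mass at least half
  the volume, and \<open>vitali_bound\<close> applies to a ball about x containing the
  dilate.\<close>

lemma orlicz_max_level:
  fixes h :: "real^'n \<Rightarrow> real"
  assumes L: "0 < L" and \<Phi>: "mono \<Phi>" and s0: "\<Phi> (ennreal s0) \<le> ennreal (1 / 2)" and t: "0 < t"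
    and h[measurable]: "h \<in> borel_measurable lebesgue"
  shows "emeasure lebesgue {x. ennreal t < orlicz_max L \<Phi> (\<lambda>x. ennreal (h x)) x} \<le>
    ennreal (5 ^ CARD('n) * unit_ball_vol (real CARD('n)) * (2 * real CARD('n) ^ CARD('n) * 2 ^ CARD('n))) *
      (\<integral>\<^sup>+x. of_bool (s0 * t < h x) * \<Phi> (ennreal (h x) / ennreal t) \<partial>lebesgue)"
    (is "emeasure lebesgue ?E \<le> ennreal ?V * (\<integral>\<^sup>+x. ?F x \<partial>lebesgue)")
proof (cases "(\<integral>\<^sup>+x. ?F x \<partial>lebesgue) = \<infinity>")
  case True
  have "ennreal v * \<infinity> = \<infinity>" if "0 < v" for v using that by (simp add: ennreal_mult_top)
  from this[of ?V] have "ennreal ?V * \<infinity> = \<infinity>" by (simp only: unit_ball_vol_pos zero_less_mult_iff) simp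
  then show ?thesis unfolding True by (simp only: infinity_ennreal_def top_greatest)
next
  case False
  let ?n = "CARD('n)"
  have [measurable]: "\<Phi> \<in> borel_measurable borel" by (rule borel_measurable_mono_ennreal[OF \<Phi>])
  have Fm: "?F \<in> borel_measurable lebesgue" by measurable
  have "\<exists>S'\<in>sets lebesgue. ?E \<subseteq> S' \<and> emeasure lebesgue S' \<le> ennreal ?V * (\<integral>\<^sup>+x. ?F x \<partial>lebesgue)"
  proof (rule vitali_bound[OF Fm])
    show "(\<integral>\<^sup>+x. ?F x \<partial>lebesgue) < \<infinity>" using False by (simp add: less_top)
    fix x assume "x \<in> ?E"
    then obtain j where j: "ennreal t < luxemburg_avg \<Phi> (dstar L (j, didx L j x)) (\<lambda>x. ennreal (h x))"
      unfolding orlicz_max_def by (auto simp: less_SUP_iff)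
    define q where "q = (j, didx L j x)"
    have xq: "x \<in> dcube L q" unfolding q_def by (rule dcube_self)
    have s: "0 < dside L q" using L by (rule dside_pos)
    define l where "l = 2 * dil TYPE('n) * dside L q"
    have l: "0 < l" using s by (simp add: l_def add_nonneg_pos)
    have Qe: "emeasure lebesgue (dstar L q) = ennreal (l ^ ?n)" unfolding l_def by (rule emeasure_dstar[OF L])
    have "emeasure lebesgue (dstar L q) < (\<integral>\<^sup>+y\<in>dstar L q. \<Phi> (ennreal (h y) / ennreal t) \<partial>lebesgue)"
      using j t l unfolding q_def[symmetric] by (intro luxemburg_gt) (auto simp: Qe)
    also have "\<dots> \<le> (\<integral>\<^sup>+y. ennreal (1 / 2) * indicator (dstar L q) y + ?F y * indicator (dstar L q) y \<partial>lebesgue)"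
    proof (rule nn_integral_mono)
      fix y
      have "\<Phi> (ennreal (h y) / ennreal t) \<le> ennreal (1 / 2) + ?F y"
      proof (cases "s0 * t < h y")
        case False
        have "ennreal (h y) / ennreal t \<le> ennreal s0"
        proof (cases "0 \<le> h y")
          case True
          then show ?thesis using False t by (simp add: divide_ennreal divide_le_eq ennreal_leI)
        next
          case False
          then show ?thesis by (simp add: ennreal_neg)
        qed
        then have "\<Phi> (ennreal (h y) / ennreal t) \<le> \<Phi> (ennreal s0)" by (rule monoD[OF \<Phi>])
        also note s0
        finally show ?thesis by (simp add: add_increasing2)
      qed (simp add: add_increasing)
      then show "\<Phi> (ennreal (h y) / ennreal t) * indicator (dstar L q) y \<le> ennreal (1 / 2) * indicator (dstar L q) y + ?F y * indicator (dstar L q) y"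
        by (auto simp: indicator_def)
    qed
    also have "\<dots> = ennreal (1 / 2) * emeasure lebesgue (dstar L q) + (\<integral>\<^sup>+y\<in>dstar L q. ?F y \<partial>lebesgue)"
      using Fm by (subst nn_integral_add) (auto simp: nn_integral_cmult_indicator simp del: emeasure_completion intro!: borel_measurable_times_ennreal)
    finally have lt: "ennreal (l ^ ?n) < ennreal (1 / 2) * ennreal (l ^ ?n) + (\<integral>\<^sup>+y\<in>dstar L q. ?F y \<partial>lebesgue)"
      unfolding Qe .
    \<comment> \<open>With l the side of the dilate, n l exceeds its extent seen from x; the factor
      2 makes the inclusion in the open ball strict. Then r^n = 2 n^n 2^n (l^n / 2), the constant in
      the statement.\<close>
    define r where "r = 2 * (real ?n * l)"
    have lr: "l \<le> r" "0 < r"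
    proof -
      have "1 * l \<le> real ?n * l" using l card_ge_1[where 'n='n] by (intro mult_right_mono) auto
      then show "l \<le> r" "0 < r" using l unfolding r_def by linarith+
    qed
    have sub: "dstar L q \<subseteq> ball x r"
    proof
      fix y assume "y \<in> dstar L q"
      then have "dist x y \<le> real ?n * ((dil TYPE('n) + 1) * dside L q)" by (rule dist_dstar_le[OF L xq])
      also have "\<dots> \<le> real ?n * l" unfolding l_def using s by (intro mult_left_mono mult_right_mono) auto
      also have "\<dots> < r" using l unfolding r_def by simp
      finally show "y \<in> ball x r" by simp
    qed
    have half: "ennreal (l ^ ?n / 2) \<le> (\<integral>\<^sup>+y\<in>dstar L q. ?F y \<partial>lebesgue)"
    proof (rule ccontr)
      assume "\<not> ?thesis"
      then have "(\<integral>\<^sup>+y\<in>dstar L q. ?F y \<partial>lebesgue) \<le> ennreal (l ^ ?n / 2)" by simp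
      then have "ennreal (l ^ ?n) < ennreal (1 / 2) * ennreal (l ^ ?n) + ennreal (l ^ ?n / 2)"
        using lt by (meson add_left_mono less_le_trans)
      also have "ennreal (1 / 2) * ennreal (l ^ ?n) = ennreal (l ^ ?n / 2)"
        using l by (subst ennreal_mult[symmetric]) auto
      also have "ennreal (l ^ ?n / 2) + ennreal (l ^ ?n / 2) = ennreal (l ^ ?n)"
        using l by (subst ennreal_plus[symmetric]) auto
      finally show False by simp
    qed
    have "ennreal (r ^ ?n) = ennreal (2 * real ?n ^ ?n * 2 ^ ?n) * ennreal (l ^ ?n / 2)"
      using l by (simp add: r_def power_mult_distrib ennreal_mult[symmetric] mult_ac)
    also have "\<dots> \<le> ennreal (2 * real ?n ^ ?n * 2 ^ ?n) * (\<integral>\<^sup>+y\<in>dstar L q. ?F y \<partial>lebesgue)"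
      by (rule mult_left_mono[OF half]) simp
    also have "\<dots> \<le> ennreal (2 * real ?n ^ ?n * 2 ^ ?n) * (\<integral>\<^sup>+y\<in>ball x r. ?F y \<partial>lebesgue)"
      using sub by (intro mult_left_mono nn_integral_mono) (auto simp: indicator_def)
    finally show "\<exists>r>0. ennreal (r ^ ?n) \<le> ennreal (2 * real ?n ^ ?n * 2 ^ ?n) * (\<integral>\<^sup>+y\<in>ball x r. ?F y \<partial>lebesgue)"
      using lr(2) by blast
  qed simp
  then show ?thesis by (meson emeasure_mono order_trans)
qed

text \<open>Marcinkiewicz-type integration of the level estimates over dyadic levels; after
  exchanging sum and integral, \<open>dyadic_sum_le\<close> sums them pointwise. The constant is
  chosen before the grid scale L and the function.\<close>

lemma orlicz_max_bound:
  assumes \<Phi>: "mono \<Phi>" and Bp: "Bp_condition p \<Phi>" and p: "0 < p" and s0: "0 < s0" "\<Phi> (ennreal s0) \<le> ennreal (1 / 2)"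
  shows "\<exists>C\<ge>0. \<forall>L (h :: real^'n \<Rightarrow> real). 0 < L \<longrightarrow> h \<in> borel_measurable lebesgue \<longrightarrow> (\<forall>x. 0 \<le> h x) \<longrightarrow>
    (\<integral>\<^sup>+x. epow p (orlicz_max L \<Phi> (\<lambda>x. ennreal (h x)) x) \<partial>lebesgue) \<le> ennreal C * (\<integral>\<^sup>+x. ennreal (h x powr p) \<partial>lebesgue)"
proof -
  define V where "V = 5 ^ CARD('n) * unit_ball_vol (real CARD('n)) * (2 * real CARD('n) ^ CARD('n) * 2 ^ CARD('n))"
  have V: "0 \<le> V" by (simp add: V_def)
  define S where "S = (\<Sum>i. \<Phi> (ennreal (2 * s0 * 2 ^ i)) * ennreal ((2 powr - p) ^ i))"
  have "S < \<infinity>" unfolding S_def by (rule Bp_sum[OF \<Phi> Bp p])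
  then obtain S' where S': "S = ennreal S'" "0 \<le> S'" by (cases S) auto
  define C where "C = V * ((2 / s0) powr p * S')"
  have C: "0 \<le> C" using V S' by (simp add: C_def)
  have [measurable]: "\<Phi> \<in> borel_measurable borel" by (rule borel_measurable_mono_ennreal[OF \<Phi>])
  have "(\<integral>\<^sup>+x. epow p (orlicz_max L \<Phi> (\<lambda>x. ennreal (h x)) x) \<partial>lebesgue) \<le> ennreal C * (\<integral>\<^sup>+x. ennreal (h x powr p) \<partial>lebesgue)"
    if L: "0 < L" and h[measurable]: "h \<in> borel_measurable lebesgue" and h0: "\<And>x. 0 \<le> h x" for L and h :: "real^'n \<Rightarrow> real"
  proof -
    let ?M = "orlicz_max L \<Phi> (\<lambda>x. ennreal (h x))"
    define w where "w j = ennreal ((2 powr (real_of_int j + 1)) powr p)" for j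
    define F where "F j x = of_bool (s0 * 2 powr real_of_int j < h x) * \<Phi> (ennreal (h x) / ennreal (2 powr real_of_int j))" for j x
    have Mm[measurable]: "?M \<in> borel_measurable lebesgue" by (rule orlicz_max_measurable[OF L])
    have Em: "{x. ennreal t < ?M x} \<in> sets lebesgue" for t
      using measurable_sets[OF Mm, of "{ennreal t<..}"] by (simp add: vimage_def)
    have Fm: "F j \<in> borel_measurable lebesgue" for j unfolding F_def by measurable
    have "(\<integral>\<^sup>+x. epow p (?M x) \<partial>lebesgue) \<le> (\<integral>\<^sup>+x. \<integral>\<^sup>+j. w j * of_bool (ennreal (2 powr real_of_int j) < ?M x) \<partial>count_space UNIV \<partial>lebesgue)"
      unfolding w_def by (intro nn_integral_mono epow_le_dyadic_sum p)
    also have "\<dots> = (\<integral>\<^sup>+j. \<integral>\<^sup>+x. w j * of_bool (ennreal (2 powr real_of_int j) < ?M x) \<partial>lebesgue \<partial>count_space UNIV)"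
      by (rule nn_integral_count_space_nn_integral) auto
    also have "\<dots> \<le> (\<integral>\<^sup>+j. ennreal V * \<integral>\<^sup>+x. w j * F j x \<partial>lebesgue \<partial>count_space UNIV)"
    proof (rule nn_integral_mono)
      fix j
      have "(\<integral>\<^sup>+x. w j * of_bool (ennreal (2 powr real_of_int j) < ?M x) \<partial>lebesgue) = (\<integral>\<^sup>+x. w j * indicator {x. ennreal (2 powr real_of_int j) < ?M x} x \<partial>lebesgue)"
        by (intro nn_integral_cong) (auto simp: indicator_def)
      also have "\<dots> = w j * emeasure lebesgue {x. ennreal (2 powr real_of_int j) < ?M x}"
        by (rule nn_integral_cmult_indicator[OF Em])
      also have "\<dots> \<le> w j * (ennreal V * (\<integral>\<^sup>+x. F j x \<partial>lebesgue))"
        unfolding V_def F_def by (intro mult_left_mono orlicz_max_level L \<Phi> s0 h) auto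
      also have "\<dots> = ennreal V * (w j * (\<integral>\<^sup>+x. F j x \<partial>lebesgue))" by (rule mult.left_commute)
      also have "\<dots> = ennreal V * (\<integral>\<^sup>+x. w j * F j x \<partial>lebesgue)" by (subst nn_integral_cmult[OF Fm]) simp
      finally show "(\<integral>\<^sup>+x. w j * of_bool (ennreal (2 powr real_of_int j) < ?M x) \<partial>lebesgue) \<le> \<dots>" .
    qed
    also have "\<dots> = ennreal V * (\<integral>\<^sup>+j. \<integral>\<^sup>+x. w j * F j x \<partial>lebesgue \<partial>count_space UNIV)"
      by (rule nn_integral_cmult) auto
    also have "(\<integral>\<^sup>+j. \<integral>\<^sup>+x. w j * F j x \<partial>lebesgue \<partial>count_space UNIV) = (\<integral>\<^sup>+x. \<integral>\<^sup>+j. w j * F j x \<partial>count_space UNIV \<partial>lebesgue)"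
      by (rule nn_integral_count_space_nn_integral[symmetric]) (use Fm in auto)
    also have "ennreal V * \<dots> \<le> ennreal V * (\<integral>\<^sup>+x. ennreal ((2 / s0) powr p) * S * ennreal (h x powr p) \<partial>lebesgue)"
      unfolding w_def F_def S_def by (intro mult_left_mono nn_integral_mono dyadic_sum_le[OF \<Phi> s0(1) p h0]) auto
    also have "(\<integral>\<^sup>+x. ennreal ((2 / s0) powr p) * S * ennreal (h x powr p) \<partial>lebesgue) = ennreal ((2 / s0) powr p) * S * (\<integral>\<^sup>+x. ennreal (h x powr p) \<partial>lebesgue)"
      by (rule nn_integral_cmult) measurable
    also have "ennreal V * \<dots> = ennreal C * (\<integral>\<^sup>+x. ennreal (h x powr p) \<partial>lebesgue)"
      unfolding S' C_def using V S' by (simp add: ennreal_mult mult.assoc)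
    finally show ?thesis .
  qed
  with C show ?thesis by blast
qed

section \<open>Iterating the local decomposition\<close>

lemma ennreal_mult3:
  assumes "0 \<le> a" "0 \<le> b" "0 \<le> c" "0 \<le> d"
  shows "ennreal (a * b * (c * d)) = ennreal a * ennreal b * (ennreal c * ennreal d)"
  using assms by (simp add: ennreal_mult)

lemma ennreal_mult3':
  assumes "0 \<le> a" "0 \<le> b" "0 \<le> c"
  shows "ennreal (a * b * c) = ennreal a * ennreal b * ennreal c"
  using assms by (simp add: ennreal_mult)

lemma borel_measurable_nn_integral_countable:
  fixes f :: "'i :: countable \<Rightarrow> 'a \<Rightarrow> ennreal"
  assumes f: "\<And>i. i \<in> I \<Longrightarrow> f i \<in> borel_measurable M"
  shows "(\<lambda>x. \<integral>\<^sup>+i. f i x \<partial>count_space I) \<in> borel_measurable M"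
proof -
  have bij: "bij_betw (from_nat :: nat \<Rightarrow> 'i) (to_nat ` I) I"
    by (rule bij_betwI[where g = to_nat]) auto
  have "(\<integral>\<^sup>+i. f i x \<partial>count_space I) = (\<Sum>n. f (from_nat n) x * indicator (to_nat ` I) n)" for x
  proof -
    have "(\<integral>\<^sup>+i. f i x \<partial>count_space I) = (\<integral>\<^sup>+n. f (from_nat n) x \<partial>count_space (to_nat ` I))"
      by (rule nn_integral_bij_count_space[OF bij, symmetric])
    also have "\<dots> = (\<integral>\<^sup>+n. f (from_nat n) x * indicator (to_nat ` I) n \<partial>count_space UNIV)"
      by (rule nn_integral_count_space_indicator) simp
    finally show ?thesis by (simp add: nn_integral_count_space_nat)
  qed
  moreover have "(\<lambda>x. \<Sum>n. f (from_nat n) x * indicator (to_nat ` I) n) \<in> borel_measurable M"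
  proof (rule borel_measurable_suminf_order)
    fix n
    show "(\<lambda>x. f (from_nat n) x * indicator (to_nat ` I) n) \<in> borel_measurable M"
      using f by (cases "n \<in> to_nat ` I") auto
  qed
  ultimately show ?thesis by simp
qed

context czo
begin

text \<open>G stands for the product of the two maximal functions, but only H matters: it bounds the
  product of the masses of f and w by the value of G at every point of the cube. The constant
  survives the iteration because the parts treated in successive rounds are disjoint, so their
  integrals of G add up to that over the cube.\<close>

lemma local_bound:
  fixes f :: "real^'n \<Rightarrow> complex" and w G :: "real^'n \<Rightarrow> ennreal"
  assumes L: "0 < L" and f: "in_L2 f"
    and w[measurable]: "w \<in> borel_measurable lebesgue" and G[measurable]: "G \<in> borel_measurable lebesgue" and B: "0 \<le> B"
    and H: "\<And>q x. x \<in> dcube L q \<Longrightarrow> (\<integral>\<^sup>+y\<in>dstar L q. ennreal (norm (f y)) \<partial>lebesgue) * (\<integral>\<^sup>+y\<in>dcube L q. w y \<partial>lebesgue)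
       \<le> ennreal B * (emeasure lebesgue (dcube L q))\<^sup>2 * G x"
  shows "(\<integral>\<^sup>+x\<in>dcube L q. ennreal (norm (T (\<lambda>y. indicator (dstar L q) y * f y) x)) * w x \<partial>lebesgue)
    \<le> ennreal (2 * step_const * B) * (\<integral>\<^sup>+x\<in>dcube L q. G x \<partial>lebesgue)"
proof -
  let ?n = "CARD('n)" and ?D = "dcube L :: nat \<times> ('n \<Rightarrow> int) \<Rightarrow> (real^'n) set"
  let ?k = "ennreal (2 * step_const * B)"
  define Tq where "Tq q x = ennreal (norm (T (\<lambda>y. indicator (dstar L q) y * f y) x))" for q :: "nat \<times> ('n \<Rightarrow> int)" and x
  have [measurable]: "f \<in> borel_measurable lebesgue" using f by (rule in_L2_meas)
  have Dm[measurable]: "?D q \<in> sets lebesgue" for q using L by simp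
  have De: "emeasure lebesgue (?D q) = ennreal (dside L q ^ ?n)" for q using L by (rule emeasure_dcube)
  have s: "0 < dside L q" for q :: "nat \<times> ('n \<Rightarrow> int)" using L by (rule dside_pos)
  have fq2: "in_L2 (\<lambda>y. indicator (dstar L q) y * f y)" for q by (rule in_L2_indicator[OF f]) simp
  have Tqm[measurable]: "Tq q \<in> borel_measurable lebesgue" for q
    unfolding Tq_def using T_meas[OF fq2] by measurable
  \<comment> \<open>\<open>\<Omega>\<close> is the part not yet treated after N rounds; for N = 0 it
    is the whole cube and the bound is trivial. One more round applies the hypothesis inside each
    stopping cube.\<close>
  have step: "\<exists>\<Omega>\<in>sets lebesgue. 2 ^ N * emeasure lebesgue \<Omega> \<le> emeasure lebesgue (?D q) \<and>
      (\<integral>\<^sup>+x\<in>?D q - \<Omega>. Tq q x * w x \<partial>lebesgue) \<le> ?k * (\<integral>\<^sup>+x\<in>?D q. G x \<partial>lebesgue)" for N q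
  proof (induction N arbitrary: q)
    case 0
    show ?case by (intro bexI[of _ "?D q"]) auto
  next
    case (Suc N)
    define A where "A = enn2real (\<integral>\<^sup>+y\<in>dstar L q. ennreal (norm (f y)) \<partial>lebesgue) / dside L q ^ ?n"
    define W where "W = (\<integral>\<^sup>+y\<in>?D q. w y \<partial>lebesgue)"
    define S where "S = dside L q ^ ?n"
    have S: "0 < S" unfolding S_def using s[of q] by simp
    have A0: "0 \<le> A" using s[of q] by (simp add: A_def)
    have "(\<integral>\<^sup>+y\<in>dstar L q. ennreal (norm (f y)) \<partial>lebesgue) < \<infinity>"
    proof -
      have "integrable lebesgue (\<lambda>x. indicator (dstar L q) x * f x)"
        by (rule in_L2_integrable_on[OF f]) (auto simp: emeasure_dstar[OF L] simp del: emeasure_completion)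
      then have "(\<integral>\<^sup>+x. ennreal (norm (indicator (dstar L q) x * f x)) \<partial>lebesgue) < \<infinity>"
        unfolding integrable_iff_bounded by blast
      also have "(\<integral>\<^sup>+x. ennreal (norm (indicator (dstar L q) x * f x)) \<partial>lebesgue) = (\<integral>\<^sup>+y\<in>dstar L q. ennreal (norm (f y)) \<partial>lebesgue)"
        by (intro nn_integral_cong) (auto simp: indicator_def)
      finally show ?thesis .
    qed
    then have A: "(\<integral>\<^sup>+y\<in>dstar L q. ennreal (norm (f y)) \<partial>lebesgue) = ennreal (A * dside L q ^ ?n)"
      using s[of q] by (simp add: A_def)
    obtain I where I: "disjoint_family_on ?D I" "\<And>p. p \<in> I \<Longrightarrow> ?D p \<subseteq> ?D q"
        "2 * emeasure lebesgue (\<Union>p\<in>I. ?D p) \<le> emeasure lebesgue (?D q)"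
      and off: "AE x in lebesgue. x \<in> ?D q \<longrightarrow> x \<notin> (\<Union>p\<in>I. ?D p) \<longrightarrow>
          norm (T (\<lambda>y. indicator (dstar L q) y * f y) x) \<le> step_const * A"
      and on: "\<And>p. p \<in> I \<Longrightarrow> AE x in lebesgue. x \<in> ?D p \<longrightarrow>
          norm (T (\<lambda>y. indicator (dstar L q) y * f y) x) \<le> step_const * A + norm (T (\<lambda>y. indicator (dstar L p) y * f y) x)"
      using one_step[OF L f A A0] by blast
    define V where "V = ?D q - (\<Union>p\<in>I. ?D p)"
    have Um[measurable]: "(\<Union>p\<in>I. ?D p) \<in> sets lebesgue" by (intro sets.countable_UN') auto
    have Vm[measurable]: "V \<in> sets lebesgue" unfolding V_def by simp
    have Dq: "?D q = V \<union> (\<Union>p\<in>I. ?D p)" "V \<inter> (\<Union>p\<in>I. ?D p) = {}" using I(2) by (auto simp: V_def)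
    \<comment> \<open>The stopping cubes take at most half of q, so V keeps at least half.\<close>
    have SV: "ennreal S \<le> 2 * emeasure lebesgue V"
    proof -
      have e: "emeasure lebesgue (?D q) = emeasure lebesgue V + emeasure lebesgue (\<Union>p\<in>I. ?D p)"
        by (subst Dq(1), subst plus_emeasure[symmetric]) (use Dq(2) in auto)
      have fin: "emeasure lebesgue V < \<infinity>" "emeasure lebesgue (\<Union>p\<in>I. ?D p) < \<infinity>"
        using De[of q] unfolding e by (metis ennreal_less_top less_top ennreal_add_eq_top infinity_ennreal_def)+
      obtain a b where ab: "emeasure lebesgue V = ennreal a" "0 \<le> a" "emeasure lebesgue (\<Union>p\<in>I. ?D p) = ennreal b" "0 \<le> b"
        using fin by (cases "emeasure lebesgue V"; cases "emeasure lebesgue (\<Union>p\<in>I. ?D p)") auto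
      have "ennreal (2 * b) \<le> ennreal (a + b)" using I(3) unfolding e ab using ab(2,4) by (simp add: ennreal_mult)
      then have "2 * b \<le> a + b" using ab(2,4) by (subst (asm) ennreal_le_iff) auto
      then have "b \<le> a" by simp
      have "ennreal S = ennreal (a + b)" using De[of q] unfolding e ab S_def using ab by simp
      also have "\<dots> \<le> ennreal (2 * a)" using \<open>b \<le> a\<close> by (intro ennreal_leI) simp
      finally show ?thesis unfolding ab using ab(2) by (simp add: ennreal_mult)
    qed
    have HX: "ennreal (step_const * A) * W \<le> ennreal (step_const * B * S) * G x" if x: "x \<in> ?D q" for x
    proof -
      have "ennreal (step_const / S) * (ennreal (A * S) * W) \<le> ennreal (step_const / S) * (ennreal B * (ennreal S)\<^sup>2 * G x)"
        using H[OF x] unfolding A De W_def[symmetric] S_def[symmetric] by (rule mult_left_mono) simp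
      moreover have "ennreal (step_const / S) * (ennreal (A * S) * W) = ennreal (step_const * A) * W"
        using S A0 one_step_consts(6) by (simp add: mult.assoc[symmetric] ennreal_mult[symmetric])
      moreover have "ennreal (step_const / S) * (ennreal B * (ennreal S)\<^sup>2 * G x) = ennreal (step_const * B * S) * G x"
      proof -
        have "ennreal (step_const / S) * (ennreal B * (ennreal S)\<^sup>2 * G x) = ennreal (step_const / S) * ennreal B * (ennreal S * ennreal S) * G x"
          by (simp only: power2_eq_square mult.assoc)
        also have "ennreal (step_const / S) * ennreal B * (ennreal S * ennreal S) = ennreal (step_const / S * B * (S * S))"
          using S B one_step_consts(6)
          by (intro ennreal_mult3[symmetric]) auto
        also have "step_const / S * B * (S * S) = step_const * B * S" using S by simp
        finally show ?thesis .
      qed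
      ultimately show ?thesis by simp
    qed
    \<comment> \<open>\<open>HX\<close> bounds a constant by G at each point. Integrating over V
      alone, at least half of q, replaces G by its integral over V; the factor 2 in
      \<open>?k\<close> is the price.\<close>
    have X: "ennreal (step_const * A) * W \<le> ?k * (\<integral>\<^sup>+x\<in>V. G x \<partial>lebesgue)"
    proof -
      let ?X = "ennreal (step_const * A) * W"
      have "?X * emeasure lebesgue V = (\<integral>\<^sup>+x. ?X * indicator V x \<partial>lebesgue)" by (simp add: nn_integral_cmult_indicator)
      also have "\<dots> \<le> (\<integral>\<^sup>+x. ennreal (step_const * B * S) * (G x * indicator V x) \<partial>lebesgue)"
        using HX by (intro nn_integral_mono) (auto simp: V_def indicator_def)
      also have "\<dots> = ennreal (step_const * B * S) * (\<integral>\<^sup>+x\<in>V. G x \<partial>lebesgue)" by (rule nn_integral_cmult) simp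
      finally have 1: "?X * emeasure lebesgue V \<le> ennreal (step_const * B * S) * (\<integral>\<^sup>+x\<in>V. G x \<partial>lebesgue)" .
      have "?X = ennreal (1 / S) * (?X * ennreal S)"
        using S by (simp add: mult.left_commute[of "ennreal (1 / S)"] ennreal_mult[symmetric])
      also have "\<dots> \<le> ennreal (1 / S) * (?X * (2 * emeasure lebesgue V))" by (intro mult_left_mono SV) auto
      also have "\<dots> = ennreal (1 / S) * (2 * (?X * emeasure lebesgue V))" by (simp add: mult_ac)
      also have "\<dots> \<le> ennreal (1 / S) * (2 * (ennreal (step_const * B * S) * (\<integral>\<^sup>+x\<in>V. G x \<partial>lebesgue)))"
        by (intro mult_left_mono 1) auto
      also have "\<dots> = (ennreal (1 / S) * ennreal 2 * ennreal (step_const * B * S)) * (\<integral>\<^sup>+x\<in>V. G x \<partial>lebesgue)" by (simp add: mult.assoc)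
      also have "ennreal (1 / S) * ennreal 2 * ennreal (step_const * B * S) = ennreal (1 / S * 2 * (step_const * B * S))"
        using S B one_step_consts(6) by (intro ennreal_mult3'[symmetric]) auto
      also have "1 / S * 2 * (step_const * B * S) = 2 * step_const * B" using S by simp
      finally show ?thesis .
    qed
    have "\<exists>Om. \<forall>p. Om p \<in> sets lebesgue \<and> 2 ^ N * emeasure lebesgue (Om p) \<le> emeasure lebesgue (?D p) \<and>
        (\<integral>\<^sup>+x\<in>?D p - Om p. Tq p x * w x \<partial>lebesgue) \<le> ?k * (\<integral>\<^sup>+x\<in>?D p. G x \<partial>lebesgue)"
      by (rule choice, rule allI) (use Suc.IH in blast)
    then obtain Om where Om: "\<And>p. Om p \<in> sets lebesgue" "\<And>p. 2 ^ N * emeasure lebesgue (Om p) \<le> emeasure lebesgue (?D p)"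
        "\<And>p. (\<integral>\<^sup>+x\<in>?D p - Om p. Tq p x * w x \<partial>lebesgue) \<le> ?k * (\<integral>\<^sup>+x\<in>?D p. G x \<partial>lebesgue)"
      by blast
    define \<Omega> where "\<Omega> = (\<Union>p\<in>I. Om p)"
    have \<Omega>m[measurable]: "\<Omega> \<in> sets lebesgue" unfolding \<Omega>_def using Om(1) by (intro sets.countable_UN') auto
    have \<Omega>e: "2 ^ Suc N * emeasure lebesgue \<Omega> \<le> emeasure lebesgue (?D q)"
    proof -
      have "2 ^ Suc N * emeasure lebesgue \<Omega> \<le> 2 ^ Suc N * (\<integral>\<^sup>+p. emeasure lebesgue (Om p) \<partial>count_space I)"
        unfolding \<Omega>_def by (intro mult_left_mono emeasure_UN_countable_le Om(1)) auto
      also have "\<dots> = 2 * (\<integral>\<^sup>+p. 2 ^ N * emeasure lebesgue (Om p) \<partial>count_space I)"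
        by (subst nn_integral_cmult) (auto simp: mult.assoc)
      also have "\<dots> \<le> 2 * (\<integral>\<^sup>+p. emeasure lebesgue (?D p) \<partial>count_space I)"
        by (intro mult_left_mono nn_integral_mono Om(2)) auto
      also have "\<dots> = 2 * emeasure lebesgue (\<Union>p\<in>I. ?D p)"
        by (subst emeasure_UN_countable[OF Dm _ I(1)]) auto
      also note I(3)
      finally show ?thesis .
    qed
    have "AE x in lebesgue. \<forall>p\<in>I. x \<in> ?D p \<longrightarrow> norm (T (\<lambda>y. indicator (dstar L q) y * f y) x) \<le> step_const * A + norm (T (\<lambda>y. indicator (dstar L p) y * f y) x)"
      using on by (subst AE_ball_countable) auto
    then have "AE x in lebesgue. Tq q x * w x * indicator (?D q - \<Omega>) x \<le>
        ennreal (step_const * A) * (w x * indicator (?D q) x) + (\<integral>\<^sup>+p. Tq p x * w x * indicator (?D p - Om p) x \<partial>count_space I)"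
      using off
    proof eventually_elim
      case (elim x)
      show ?case
      proof (cases "x \<in> ?D q - \<Omega>")
        case True
        show ?thesis
        proof (cases "x \<in> (\<Union>p\<in>I. ?D p)")
          case False
          then have "Tq q x \<le> ennreal (step_const * A)" using elim True by (auto simp: Tq_def intro: ennreal_leI)
          then have "Tq q x * w x \<le> ennreal (step_const * A) * w x" by (rule mult_right_mono) simp
          then show ?thesis using True by (simp add: add_increasing2)
        next
          case inU: True
          then obtain p where p: "p \<in> I" "x \<in> ?D p" by auto
          have "norm (T (\<lambda>y. indicator (dstar L q) y * f y) x) \<le> step_const * A + norm (T (\<lambda>y. indicator (dstar L p) y * f y) x)"
            using elim p by blast
          then have "Tq q x \<le> ennreal (step_const * A + norm (T (\<lambda>y. indicator (dstar L p) y * f y) x))"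
            unfolding Tq_def by (rule ennreal_leI)
          also have "\<dots> = ennreal (step_const * A) + Tq p x"
            unfolding Tq_def using A0 one_step_consts(6) by (intro ennreal_plus) auto
          finally have "Tq q x \<le> ennreal (step_const * A) + Tq p x" .
          then have "Tq q x * w x \<le> (ennreal (step_const * A) + Tq p x) * w x" by (rule mult_right_mono) simp
          also have "\<dots> = ennreal (step_const * A) * w x + Tq p x * w x" by (rule distrib_right)
          also have "Tq p x * w x = Tq p x * w x * indicator (?D p - Om p) x" using True p by (auto simp: \<Omega>_def)
          also have "\<dots> \<le> (\<integral>\<^sup>+p. Tq p x * w x * indicator (?D p - Om p) x \<partial>count_space I)"
            by (rule nn_integral_ge_point[OF p(1), of "\<lambda>p. Tq p x * w x * indicator (?D p - Om p) x"])
          finally show ?thesis using True by (simp add: add_left_mono)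
        qed
      qed auto
    qed
    then have "(\<integral>\<^sup>+x\<in>?D q - \<Omega>. Tq q x * w x \<partial>lebesgue) \<le>
        (\<integral>\<^sup>+x. ennreal (step_const * A) * (w x * indicator (?D q) x) + (\<integral>\<^sup>+p. Tq p x * w x * indicator (?D p - Om p) x \<partial>count_space I) \<partial>lebesgue)"
      by (rule nn_integral_mono_AE)
    also have "\<dots> = ennreal (step_const * A) * W + (\<integral>\<^sup>+x. \<integral>\<^sup>+p. Tq p x * w x * indicator (?D p - Om p) x \<partial>count_space I \<partial>lebesgue)"
    proof (subst nn_integral_add)
      show "(\<lambda>x. \<integral>\<^sup>+p. Tq p x * w x * indicator (?D p - Om p) x \<partial>count_space I) \<in> borel_measurable lebesgue"
        using Om(1) by (intro borel_measurable_nn_integral_countable) auto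
    qed (auto simp: nn_integral_cmult W_def)
    also have "(\<integral>\<^sup>+x. \<integral>\<^sup>+p. Tq p x * w x * indicator (?D p - Om p) x \<partial>count_space I \<partial>lebesgue)
       = (\<integral>\<^sup>+p. (\<integral>\<^sup>+x\<in>?D p - Om p. Tq p x * w x \<partial>lebesgue) \<partial>count_space I)"
      by (rule nn_integral_count_space_nn_integral) (use Om(1) in auto)
    also have "ennreal (step_const * A) * W + \<dots> \<le> ?k * (\<integral>\<^sup>+x\<in>V. G x \<partial>lebesgue) + (\<integral>\<^sup>+p. ?k * (\<integral>\<^sup>+x\<in>?D p. G x \<partial>lebesgue) \<partial>count_space I)"
      by (intro add_mono X nn_integral_mono Om(3))
    also have "\<dots> = ?k * ((\<integral>\<^sup>+x\<in>V. G x \<partial>lebesgue) + (\<integral>\<^sup>+x\<in>(\<Union>p\<in>I. ?D p). G x \<partial>lebesgue))"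
      by (subst nn_integral_cmult, simp, subst nn_integral_disjoint_UN[OF _ I(1)]) (auto simp: distrib_left)
    also have "(\<integral>\<^sup>+x\<in>V. G x \<partial>lebesgue) + (\<integral>\<^sup>+x\<in>(\<Union>p\<in>I. ?D p). G x \<partial>lebesgue) = (\<integral>\<^sup>+x\<in>?D q. G x \<partial>lebesgue)"
    proof -
      have "G x * indicator V x + G x * indicator (\<Union>p\<in>I. ?D p) x = G x * indicator (?D q) x" for x
      proof (cases "x \<in> (\<Union>p\<in>I. ?D p)")
        case True
        then have "x \<in> ?D q" "x \<notin> V" using Dq by blast+
        with True show ?thesis by simp
      next
        case False
        then have "x \<in> ?D q \<longleftrightarrow> x \<in> V" using Dq by blast
        with False show ?thesis by (simp add: indicator_def)
      qed
      then show ?thesis by (subst nn_integral_add[symmetric]) simp_all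
    qed
    finally show ?case using \<Omega>e by (intro bexI[of _ \<Omega>]) auto
  qed
  have "\<exists>Om. \<forall>N. Om N \<in> sets lebesgue \<and> 2 ^ N * emeasure lebesgue (Om N) \<le> emeasure lebesgue (?D q) \<and>
      (\<integral>\<^sup>+x\<in>?D q - Om N. Tq q x * w x \<partial>lebesgue) \<le> ?k * (\<integral>\<^sup>+x\<in>?D q. G x \<partial>lebesgue)"
    by (rule choice, rule allI) (use step in blast)
  then obtain Om where Om: "\<And>N. Om N \<in> sets lebesgue" "\<And>N. 2 ^ N * emeasure lebesgue (Om N) \<le> emeasure lebesgue (?D q)"
      "\<And>N. (\<integral>\<^sup>+x\<in>?D q - Om N. Tq q x * w x \<partial>lebesgue) \<le> ?k * (\<integral>\<^sup>+x\<in>?D q. G x \<partial>lebesgue)"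
    by blast
  have Ome: "emeasure lebesgue (Om N) \<le> ennreal (dside L q ^ ?n * (1 / 2) ^ N)" for N
  proof -
    have "ennreal ((1 / 2) ^ N) * (2 ^ N * emeasure lebesgue (Om N)) \<le> ennreal ((1 / 2) ^ N) * ennreal (dside L q ^ ?n)"
      using Om(2)[of N] unfolding De by (rule mult_left_mono) simp
    moreover have "ennreal ((1 / 2) ^ N) * (2 ^ N * emeasure lebesgue (Om N)) = (ennreal ((1 / 2) ^ N) * ennreal (2 ^ N)) * emeasure lebesgue (Om N)"
      by (simp add: mult.assoc ennreal_power[symmetric])
    moreover have "ennreal ((1 / 2) ^ N) * ennreal (2 ^ N) = 1"
      by (subst ennreal_mult[symmetric]) (auto simp: power_mult_distrib[symmetric])
    moreover have "ennreal ((1 / 2) ^ N) * ennreal (dside L q ^ ?n) = ennreal (dside L q ^ ?n * (1 / 2) ^ N)"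
      using s[of q] by (subst ennreal_mult[symmetric]) (auto simp: mult.commute)
    ultimately show ?thesis by simp
  qed
  \<comment> \<open>The leftover sets come from separate choices, with no nesting. Their measures
    are summable, so almost every point lies in only finitely many of them.\<close>
  have "AE x in lebesgue. eventually (\<lambda>N. x \<in> space lebesgue - Om N) sequentially"
  proof (rule borel_cantelli_AE1[OF Om(1)])
    show "emeasure lebesgue (Om N) < \<infinity>" for N using Ome[of N] by (rule order_le_less_trans) simp
    show "summable (\<lambda>N. measure lebesgue (Om N))"
    proof (rule summable_comparison_test)
      show "summable (\<lambda>N. dside L q ^ ?n * (1 / 2) ^ N)" by (intro summable_mult summable_geometric) simp
      have "measure lebesgue (Om N) \<le> dside L q ^ ?n * (1 / 2) ^ N" for N
        unfolding measure_def using Ome[of N] s[of q] by (intro enn2real_leI) auto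
      then show "\<exists>N0. \<forall>N\<ge>N0. norm (measure lebesgue (Om N)) \<le> dside L q ^ ?n * (1 / 2) ^ N" by auto
    qed
  qed
  then have "AE x in lebesgue. Tq q x * w x * indicator (?D q) x \<le> liminf (\<lambda>N. Tq q x * w x * indicator (?D q - Om N) x)"
  proof eventually_elim
    case (elim x)
    have "(\<lambda>N. Tq q x * w x * indicator (?D q - Om N) x) \<longlonglongrightarrow> Tq q x * w x * indicator (?D q) x"
      by (rule tendsto_eventually) (use elim in eventually_elim, auto simp: indicator_def)
    then show ?case by (simp add: lim_imp_Liminf)
  qed
  then have "(\<integral>\<^sup>+x\<in>?D q. Tq q x * w x \<partial>lebesgue) \<le> (\<integral>\<^sup>+x. liminf (\<lambda>N. Tq q x * w x * indicator (?D q - Om N) x) \<partial>lebesgue)"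
    by (rule nn_integral_mono_AE)
  also have "\<dots> \<le> liminf (\<lambda>N. \<integral>\<^sup>+x\<in>?D q - Om N. Tq q x * w x \<partial>lebesgue)"
    by (rule nn_integral_liminf) (use Om(1) in auto)
  also have "\<dots> \<le> ?k * (\<integral>\<^sup>+x\<in>?D q. G x \<partial>lebesgue)"
    by (rule Liminf_le) (use Om(3) in auto)
  finally show ?thesis by (simp add: Tq_def)
qed

end

text \<open>Hoelder against the constant 1, whose complementary average is finite by
  \<open>complementary_small\<close>; the strict bound b on the average of phi may be taken
  arbitrarily small.\<close>

lemma luxemburg_zero:
  fixes \<phi> :: "real^'n \<Rightarrow> ennreal"
  assumes A: "young_function A" and Q: "Q \<in> sets lebesgue" "0 < emeasure lebesgue Q" "emeasure lebesgue Q < \<infinity>"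
    and \<phi>[measurable]: "\<phi> \<in> borel_measurable lebesgue" and z: "luxemburg_avg A Q \<phi> = 0"
  shows "AE x in lebesgue. x \<in> Q \<longrightarrow> \<phi> x = 0"
proof -
  obtain s0 where s0: "0 < s0" "complementary A (ennreal s0) \<le> ennreal (1 / 2)" using complementary_small[OF A] by blast
  have "ennreal (1 / 2) \<le> ennreal 1" by (rule ennreal_leI) simp
  then have "ennreal (1 / 2) \<le> 1" unfolding ennreal_1 .
  with s0(2) have s1: "complementary A (ennreal s0) \<le> 1" by (rule order_trans)
  have "luxemburg_avg (complementary A) Q (\<lambda>x. 1) \<le> ennreal (1 / s0)"
  proof (rule luxemburg_avg_upper)
    have "1 / ennreal (1 / s0) = ennreal s0" using s0 by (simp add: divide_ennreal_def inverse_ennreal)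
    then have "(\<integral>\<^sup>+x\<in>Q. complementary A (1 / ennreal (1 / s0)) \<partial>lebesgue) \<le> (\<integral>\<^sup>+x. 1 * indicator Q x \<partial>lebesgue)"
      using s1 by (intro nn_integral_mono mult_right_mono) (auto simp del: ennreal_1)
    then show "(\<integral>\<^sup>+x\<in>Q. complementary A (1 / ennreal (1 / s0)) \<partial>lebesgue) / emeasure lebesgue Q \<le> 1"
      using Q by (simp add: divide_le_one_iff_ennreal)
  qed (use s0 in simp)
  then obtain c where c: "luxemburg_avg (complementary A) Q (\<lambda>x. 1) = ennreal c" "0 \<le> c"
    by (cases "luxemburg_avg (complementary A) Q (\<lambda>x. 1 :: ennreal)") (auto simp: top_unique)
  obtain m where m: "emeasure lebesgue Q = ennreal m" "0 \<le> m" using Q by (cases "emeasure lebesgue Q") auto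
  have bd: "(\<integral>\<^sup>+x\<in>Q. \<phi> x \<partial>lebesgue) \<le> ennreal (2 * b * m * c)" if "0 < b" for b
    using orlicz_holder(2)[OF A Q \<phi> _ _ that, of "\<lambda>x. 1"] z that c(2) m(2) unfolding c m by (simp add: ennreal_mult)
  have "(\<integral>\<^sup>+x\<in>Q. \<phi> x \<partial>lebesgue) \<le> 0 + ennreal e" if e: "0 < e" for e
  proof -
    have "2 * (e / (2 * m * c + 1)) * m * c \<le> e"
    proof -
      have "2 * m * c \<le> 2 * m * c + 1" by simp
      then have "e * (2 * m * c) \<le> e * (2 * m * c + 1)" using e by (intro mult_left_mono) auto
      moreover have "0 < 2 * m * c + 1" using m c by (simp add: add_nonneg_pos)
      ultimately show ?thesis by (simp add: field_simps)
    qed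
    moreover have "0 < e / (2 * m * c + 1)" using e m c by (simp add: add_nonneg_pos)
    ultimately show ?thesis using bd[of "e / (2 * m * c + 1)"] by (auto intro: order_trans ennreal_leI)
  qed
  then have "(\<integral>\<^sup>+x\<in>Q. \<phi> x \<partial>lebesgue) \<le> 0" by (rule ennreal_le_epsilon) auto
  then have "AE x in lebesgue. \<phi> x * indicator Q x = 0" using Q(1) by (subst nn_integral_0_iff_AE[symmetric]) auto
  then show ?thesis by eventually_elim (auto simp: indicator_def split: if_splits)
qed

section \<open>The two-weight estimate\<close>

lemma weight_nonneg: "weight w \<Longrightarrow> 0 \<le> w x"
  by (simp add: weight_def)

lemma weight_integrable:
  assumes "weight w" "compact S"
  shows "integrable lebesgue (\<lambda>x. indicator S x *\<^sub>R w x)"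
  using assms by (simp add: weight_def set_integrable_def)

lemma weight_measurable:
  fixes w :: "real^'n \<Rightarrow> real"
  assumes w: "weight w" shows "w \<in> borel_measurable lebesgue"
proof (rule borel_measurable_LIMSEQ_real)
  show "(\<lambda>x. indicator (cball 0 (real k)) x *\<^sub>R w x) \<in> borel_measurable lebesgue" for k
    using weight_integrable[OF w compact_cball] by auto
  fix x :: "real^'n"
  obtain k0 :: nat where "norm x \<le> real k0" using real_arch_simple by blast
  then show "(\<lambda>k. indicator (cball 0 (real k)) x *\<^sub>R w x) \<longlonglongrightarrow> w x"
    by (intro tendsto_eventually eventually_sequentiallyI[of k0]) (auto simp: indicator_def)
qed

text \<open>If the average of \<open>v powr (- 1 / p)\<close> is infinite, then the bump condition forces \<open>u = 0\<close> almost
  everywhere on \<open>Q\<close>, and the left-hand side vanishes.\<close>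

lemma bump_holder:
  fixes u v g :: "real^'n \<Rightarrow> real" and f :: "real^'n \<Rightarrow> complex"
  assumes A: "young_function A" and B: "young_function B" and K: "0 \<le> K"
    and Q: "Q \<in> sets lebesgue" "0 < emeasure lebesgue Q" "emeasure lebesgue Q < \<infinity>"
    and meas[measurable]: "u \<in> borel_measurable lebesgue" "v \<in> borel_measurable lebesgue" "g \<in> borel_measurable lebesgue" "f \<in> borel_measurable lebesgue"
    and g0: "\<And>x. 0 \<le> g x"
    and bump: "luxemburg_avg A Q (\<lambda>x. ennreal (u x powr (1 / p))) * luxemburg_avg B Q (\<lambda>x. inverse (ennreal (v x powr (1 / p)))) \<le> ennreal K"
  shows "(\<integral>\<^sup>+x\<in>Q. ennreal (norm (f x)) \<partial>lebesgue) * (\<integral>\<^sup>+x\<in>Q. ennreal (g x * u x powr (1 / p)) \<partial>lebesgue) \<le>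
    ennreal (4 * (4 * K + 1)) * (emeasure lebesgue Q)\<^sup>2 *
      (luxemburg_avg (complementary B) Q (\<lambda>x. ennreal (norm (f x) * v x powr (1 / p))) * luxemburg_avg (complementary A) Q (\<lambda>x. ennreal (g x)))"
proof -
  define \<alpha> where "\<alpha> = luxemburg_avg A Q (\<lambda>x. ennreal (u x powr (1 / p)))"
  define \<beta> where "\<beta> = luxemburg_avg B Q (\<lambda>x. inverse (ennreal (v x powr (1 / p))))"
  have \<alpha>\<beta>: "\<alpha> * \<beta> \<le> ennreal K" using bump by (simp add: \<alpha>_def \<beta>_def)
  have um: "(\<lambda>x. ennreal (u x powr (1 / p))) \<in> borel_measurable lebesgue" by measurable
  have vm: "(\<lambda>x. inverse (ennreal (v x powr (1 / p)))) \<in> borel_measurable lebesgue" by measurable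
  \<comment> \<open>The inverse of a finite value is never 0, so a zero average would make Q a null
    set.\<close>
  have \<beta>0: "\<beta> \<noteq> 0"
  proof
    assume "\<beta> = 0"
    then have "AE x in lebesgue. x \<in> Q \<longrightarrow> inverse (ennreal (v x powr (1 / p))) = 0"
      unfolding \<beta>_def by (intro luxemburg_zero[OF B Q vm])
    then have "AE x in lebesgue. x \<notin> Q" by eventually_elim auto
    then have "emeasure lebesgue Q = 0" using Q(1) by (simp add: AE_iff_measurable[of Q] )
    then show False using Q(2) by simp
  qed
  show ?thesis
  proof (cases "\<beta> = \<infinity>")
    case True
    have "\<alpha> = 0"
    proof (rule ccontr)
      assume "\<alpha> \<noteq> 0"
      then have "\<alpha> * \<beta> = \<infinity>" using True by (simp add: ennreal_mult_top)
      then show False using \<alpha>\<beta> by (simp add: top_unique)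
    qed
    then have "AE x in lebesgue. x \<in> Q \<longrightarrow> ennreal (u x powr (1 / p)) = 0"
      unfolding \<alpha>_def by (intro luxemburg_zero[OF A Q um])
    then have "AE x in lebesgue. ennreal (g x * u x powr (1 / p)) * indicator Q x = 0"
      by eventually_elim (auto simp: indicator_def)
    then have "(\<integral>\<^sup>+x\<in>Q. ennreal (g x * u x powr (1 / p)) \<partial>lebesgue) = 0"
      using Q(1) by (subst nn_integral_0_iff_AE) auto
    then show ?thesis by simp
  next
    case False
    then obtain b' where b': "\<beta> = ennreal b'" "0 \<le> b'" by (cases \<beta>) auto
    have b'p: "0 < b'" using \<beta>0 b' by (cases "b' = 0") auto
    have "\<alpha> \<noteq> \<infinity>"
    proof
      assume "\<alpha> = \<infinity>"
      then have "\<alpha> * \<beta> = \<infinity>" using \<beta>0 by (simp add: ennreal_top_mult)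
      then show False using \<alpha>\<beta> by (simp add: top_unique)
    qed
    then obtain a' where a': "\<alpha> = ennreal a'" "0 \<le> a'" by (cases \<alpha>) auto
    have ab': "a' * b' \<le> K" using \<alpha>\<beta> K unfolding a' b' using a' b' by (simp add: ennreal_mult[symmetric])
    \<comment> \<open>Strict upper bounds for the two averages, as \<open>orlicz_holder\<close>
      requires. If the average of u vanishes, a is chosen with a b = 1; otherwise a b = 4 a' b'.
      Hence the bound 4 K + 1.\<close>
    define b where "b = 2 * b'"
    define a where "a = (if a' = 0 then 1 / (2 * b') else 2 * a')"
    have a: "0 < a" "\<alpha> < ennreal a" unfolding a'(1) using a'(2) b'p by (auto simp: a_def ennreal_less_iff)
    have b: "0 < b" "\<beta> < ennreal b" unfolding b'(1) using b'p by (auto simp: b_def ennreal_less_iff)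
    have ab: "a * b \<le> 4 * K + 1" using ab' K b'p by (auto simp: a_def b_def)
    let ?h = "\<lambda>x. ennreal (norm (f x) * v x powr (1 / p))"
    let ?m = "emeasure lebesgue Q"
    let ?X = "luxemburg_avg (complementary B) Q ?h" and ?Y = "luxemburg_avg (complementary A) Q (\<lambda>x. ennreal (g x))"
    have hm: "?h \<in> borel_measurable lebesgue" by measurable
    have gm: "(\<lambda>x. ennreal (g x)) \<in> borel_measurable lebesgue" by measurable
    \<comment> \<open>A finite average means v > 0 almost everywhere on Q, so |f| can be factored as
      v^(-1/p) times |f| v^(1/p).\<close>
    have "AE x in lebesgue. x \<in> Q \<longrightarrow> inverse (ennreal (v x powr (1 / p))) < \<infinity>"
      by (rule orlicz_holder(1)[OF B Q vm hm b(2)[unfolded \<beta>_def] b(1)])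
    then have "AE x in lebesgue. ennreal (norm (f x)) * indicator Q x = inverse (ennreal (v x powr (1 / p))) * ?h x * indicator Q x"
    proof eventually_elim
      case (elim x)
      show ?case
      proof (cases "x \<in> Q")
        case True
        then have "v x powr (1 / p) \<noteq> 0" using elim by auto
        then have "0 < v x powr (1 / p)" by simp
        then have "inverse (ennreal (v x powr (1 / p))) * ?h x = ennreal (norm (f x))"
          by (simp add: inverse_ennreal ennreal_mult[symmetric])
        then show ?thesis by simp
      qed simp
    qed
    then have "(\<integral>\<^sup>+x\<in>Q. ennreal (norm (f x)) \<partial>lebesgue) = (\<integral>\<^sup>+x\<in>Q. inverse (ennreal (v x powr (1 / p))) * ?h x \<partial>lebesgue)"
      by (rule nn_integral_cong_AE)
    also have "\<dots> \<le> ennreal (2 * b) * ?m * ?X"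
      by (rule orlicz_holder(2)[OF B Q vm hm b(2)[unfolded \<beta>_def] b(1)])
    finally have 1: "(\<integral>\<^sup>+x\<in>Q. ennreal (norm (f x)) \<partial>lebesgue) \<le> ennreal (2 * b) * ?m * ?X" .
    have "(\<integral>\<^sup>+x\<in>Q. ennreal (g x * u x powr (1 / p)) \<partial>lebesgue) = (\<integral>\<^sup>+x\<in>Q. ennreal (u x powr (1 / p)) * ennreal (g x) \<partial>lebesgue)"
      using g0 by (intro nn_integral_cong) (simp add: ennreal_mult mult.commute)
    also have "\<dots> \<le> ennreal (2 * a) * ?m * ?Y"
      by (rule orlicz_holder(2)[OF A Q um gm a(2)[unfolded \<alpha>_def] a(1)])
    finally have 2: "(\<integral>\<^sup>+x\<in>Q. ennreal (g x * u x powr (1 / p)) \<partial>lebesgue) \<le> ennreal (2 * a) * ?m * ?Y" .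
    have "(\<integral>\<^sup>+x\<in>Q. ennreal (norm (f x)) \<partial>lebesgue) * (\<integral>\<^sup>+x\<in>Q. ennreal (g x * u x powr (1 / p)) \<partial>lebesgue)
       \<le> (ennreal (2 * b) * ?m * ?X) * (ennreal (2 * a) * ?m * ?Y)"
      by (rule mult_mono[OF 1 2]) auto
    also have "\<dots> = (ennreal (2 * b) * ennreal (2 * a)) * ?m\<^sup>2 * (?X * ?Y)"
      by (simp only: power2_eq_square mult_ac)
    also have "\<dots> \<le> ennreal (4 * (4 * K + 1)) * ?m\<^sup>2 * (?X * ?Y)"
    proof (intro mult_right_mono)
      have "ennreal (2 * b) * ennreal (2 * a) = ennreal (2 * b * (2 * a))" using a b by (intro ennreal_mult[symmetric]) auto
      also have "\<dots> \<le> ennreal (4 * (4 * K + 1))" using ab by (intro ennreal_leI) (simp add: mult_ac)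
      finally show "ennreal (2 * b) * ennreal (2 * a) \<le> ennreal (4 * (4 * K + 1))" .
    qed auto
    finally show ?thesis .
  qed
qed

lemma root_dcube: "0 < L \<Longrightarrow> x \<in> dcube L (0, \<lambda>_. 0) \<longleftrightarrow> (\<forall>i. - L / 2 \<le> x $ i \<and> x $ i < L / 2)"
  by (simp add: mem_dcube_iff dcorner_def dside_def)

lemma root_dstar:
  fixes x :: "real^'n"
  assumes L: "0 < L" and x: "\<And>i. \<bar>x $ i\<bar> \<le> L / 2"
  shows "x \<in> dstar L (0, \<lambda>_. 0)"
  unfolding mem_dstar_iff
proof
  fix i
  have "\<bar>x $ i - dcorner L (0, \<lambda>_. 0) $ i\<bar> \<le> 1 * L" using x[of i] by (simp add: dcorner_def)
  also have "\<dots> \<le> dil TYPE('n) * L" using L by (intro mult_right_mono) auto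
  finally show "\<bar>x $ i - dcorner L (0, \<lambda>_. 0) $ i\<bar> \<le> dil TYPE('n) * dside L (0, \<lambda>_. 0)" by (simp add: dside_def)
qed

context czo
begin

text \<open>C is fixed before L, f and the truncation height k, which permits the limit in
  \<open>two_weight\<close>. The support condition on f makes T f coincide with the localised
  operator at the root cube, where \<open>local_bound\<close> starts.\<close>

lemma two_weight_local:
  fixes u v :: "real^'n \<Rightarrow> real"
  assumes p: "1 < p" and A: "young_function A" and B: "young_function B"
    and BA: "Bp_condition (p / (p - 1)) (complementary A)" and BB: "Bp_condition p (complementary B)"
    and u: "weight u" and v: "weight v"
    and bump: "(SUP Q\<in>cubes. luxemburg_avg A Q (\<lambda>x. ennreal (u x powr (1 / p))) *
                       luxemburg_avg B Q (\<lambda>x. inverse (ennreal (v x powr (1 / p))))) < \<infinity>"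
  shows "\<exists>C\<ge>0. \<forall>L f k. 0 < L \<longrightarrow> in_L2 f \<longrightarrow> f = (\<lambda>y. indicator (dstar L (0, \<lambda>_. 0)) y * f y) \<longrightarrow> 0 \<le> k \<longrightarrow>
    (\<integral>\<^sup>+x\<in>dcube L (0, \<lambda>_. 0) \<inter> {x. norm (T f x) \<le> k}. ennreal (norm (T f x) powr p * u x) \<partial>lebesgue)
      \<le> ennreal C * (\<integral>\<^sup>+x. ennreal (norm (f x) powr p * v x) \<partial>lebesgue)"
proof -
  let ?n = "CARD('n)" and ?p' = "p / (p - 1)" and ?\<Phi> = "complementary B" and ?\<Psi> = "complementary A"
  have p': "0 < ?p'" "0 < p" using p by auto
  have um[measurable]: "u \<in> borel_measurable lebesgue" by (rule weight_measurable[OF u])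
  have vm[measurable]: "v \<in> borel_measurable lebesgue" by (rule weight_measurable[OF v])
  have u0: "0 \<le> u x" and v0: "0 \<le> v x" for x using u v by (auto intro: weight_nonneg)
  obtain K where K: "0 \<le> K" "\<And>Q. Q \<in> cubes \<Longrightarrow> luxemburg_avg A Q (\<lambda>x. ennreal (u x powr (1 / p))) *
                       luxemburg_avg B Q (\<lambda>x. inverse (ennreal (v x powr (1 / p)))) \<le> ennreal K"
  proof -
    let ?S = "SUP Q\<in>cubes. luxemburg_avg A Q (\<lambda>x. ennreal (u x powr (1 / p))) * luxemburg_avg B Q (\<lambda>x. inverse (ennreal (v x powr (1 / p))))"
    obtain K where "?S = ennreal K" "0 \<le> K" using bump by (cases ?S) auto
    then show ?thesis using that[of K] SUP_upper[of _ cubes] by (metis (no_types, lifting))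
  qed
  obtain s1 where s1: "0 < s1" "?\<Phi> (ennreal s1) \<le> ennreal (1 / 2)" using complementary_small[OF B] by blast
  obtain s2 where s2: "0 < s2" "?\<Psi> (ennreal s2) \<le> ennreal (1 / 2)" using complementary_small[OF A] by blast
  obtain C\<Phi> where C\<Phi>: "0 \<le> C\<Phi>" "\<And>L (h :: real^'n \<Rightarrow> real). 0 < L \<Longrightarrow> h \<in> borel_measurable lebesgue \<Longrightarrow> (\<And>x. 0 \<le> h x) \<Longrightarrow>
    (\<integral>\<^sup>+x. epow p (orlicz_max L ?\<Phi> (\<lambda>x. ennreal (h x)) x) \<partial>lebesgue) \<le> ennreal C\<Phi> * (\<integral>\<^sup>+x. ennreal (h x powr p) \<partial>lebesgue)"
    using orlicz_max_bound[OF complementary_mono BB p'(2) s1] by blast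
  obtain C\<Psi> where C\<Psi>: "0 \<le> C\<Psi>" "\<And>L (h :: real^'n \<Rightarrow> real). 0 < L \<Longrightarrow> h \<in> borel_measurable lebesgue \<Longrightarrow> (\<And>x. 0 \<le> h x) \<Longrightarrow>
    (\<integral>\<^sup>+x. epow ?p' (orlicz_max L ?\<Psi> (\<lambda>x. ennreal (h x)) x) \<partial>lebesgue) \<le> ennreal C\<Psi> * (\<integral>\<^sup>+x. ennreal (h x powr ?p') \<partial>lebesgue)"
    using orlicz_max_bound[OF complementary_mono BA p'(1) s2] by blast
  \<comment> \<open>The volume of a dilate relative to its cube; it enters squared because both
    averages are taken over the dilate.\<close>
  define D where "D = (2 * dil TYPE('n)) ^ ?n"
  have D: "0 \<le> D" by (simp add: D_def)
  define Bc where "Bc = 4 * (4 * K + 1) * D\<^sup>2"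
  have Bc: "0 \<le> Bc" using K(1) by (simp add: Bc_def)
  define \<kappa> where "\<kappa> = 2 * step_const * Bc"
  have \<kappa>: "0 \<le> \<kappa>" using Bc one_step_consts(6) by (simp add: \<kappa>_def)
  \<comment> \<open>Small enough that X reappears on the right with a factor of at most 1/2.\<close>
  define e where "e = 1 / (2 * (\<kappa> * C\<Psi> + 1))"
  have kc: "0 < \<kappa> * C\<Psi> + 1" using \<kappa> C\<Psi>(1) by (simp add: add_nonneg_pos)
  have e: "0 < e" "\<kappa> * (e * C\<Psi>) \<le> 1 / 2" using kc by (auto simp: e_def field_simps)
  obtain c where c: "0 < c" "\<And>a b. a * b \<le> ennreal c * epow p a + ennreal e * epow ?p' b"
    using young_eps[OF p e(1)] by blast
  define C where "C = 2 * (\<kappa> * (c * C\<Phi>))"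
  have C: "0 \<le> C" using \<kappa> c C\<Phi> by (simp add: C_def)
  have main: "(\<integral>\<^sup>+x\<in>dcube L (0, \<lambda>_. 0) \<inter> {x. norm (T f x) \<le> k}. ennreal (norm (T f x) powr p * u x) \<partial>lebesgue)
      \<le> ennreal C * (\<integral>\<^sup>+x. ennreal (norm (f x) powr p * v x) \<partial>lebesgue)"
    if L: "0 < L" and f: "in_L2 f" and fs: "f = (\<lambda>y. indicator (dstar L (0, \<lambda>_. 0)) y * f y)" and k: "0 \<le> k" for L f k
  proof -
    let ?q0 = "(0, \<lambda>_. 0) :: nat \<times> ('n \<Rightarrow> int)"
    let ?D = "dcube L :: nat \<times> ('n \<Rightarrow> int) \<Rightarrow> (real^'n) set"
    have fm[measurable]: "f \<in> borel_measurable lebesgue" using f by (rule in_L2_meas)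
    have Tm[measurable]: "T f \<in> borel_measurable lebesgue" using f by (rule T_meas)
    have Dm[measurable]: "?D q \<in> sets lebesgue" for q using L by simp
    define Z where "Z = ?D ?q0 \<inter> {x. norm (T f x) \<le> k}"
    have "{x. norm (T f x) \<le> k} \<in> sets lebesgue"
      using measurable_sets[of "\<lambda>x. norm (T f x)" lebesgue borel "{..k}"] by (simp add: vimage_def)
    then have Zm[measurable]: "Z \<in> sets lebesgue" unfolding Z_def by simp
    define X where "X = (\<integral>\<^sup>+x\<in>Z. ennreal (norm (T f x) powr p * u x) \<partial>lebesgue)"
    \<comment> \<open>The extremal function of duality: both its pairing with |T f| u^(1/p)
      (\<open>gw\<close>) and the integral of its p'-th power (\<open>gp\<close>) reproduce
      X.\<close>
    define g where "g x = indicator Z x * (norm (T f x) powr (p - 1) * u x powr (1 - 1 / p))" for x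
    define h where "h x = norm (f x) * v x powr (1 / p)" for x
    have gm[measurable]: "g \<in> borel_measurable lebesgue" unfolding g_def by measurable
    have hm[measurable]: "h \<in> borel_measurable lebesgue" unfolding h_def by measurable
    have g0: "0 \<le> g x" and h0: "0 \<le> h x" for x by (auto simp: g_def h_def)
    have hp: "h x powr p = norm (f x) powr p * v x" for x
      using v0[of x] p by (simp add: h_def powr_mult powr_powr)
    have gp: "ennreal (g x powr ?p') = ennreal (norm (T f x) powr p * u x) * indicator Z x" for x
    proof -
      have e: "(p - 1) * ?p' = p" "(1 - 1 / p) * ?p' = 1" using p by (auto simp: field_simps)
      have "(norm (T f x) powr (p - 1) * u x powr (1 - 1 / p)) powr ?p' = norm (T f x) powr p * u x"
        unfolding powr_mult powr_powr e using u0[of x] by simp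
      then show ?thesis using p' by (auto simp: g_def indicator_def)
    qed
    have gw: "ennreal (norm (T f x)) * ennreal (g x * u x powr (1 / p)) = ennreal (norm (T f x) powr p * u x) * indicator Z x" for x
    proof (cases "x \<in> Z")
      case True
      have 1: "norm (T f x) * norm (T f x) powr (p - 1) = norm (T f x) powr p"
        by (cases "norm (T f x) = 0") (use p in \<open>auto simp: powr_mult_base\<close>)
      have 2: "u x powr (1 - 1 / p) * u x powr (1 / p) = u x"
        using u0[of x] by (simp add: powr_add[symmetric])
      have "norm (T f x) * (g x * u x powr (1 / p)) = (norm (T f x) * norm (T f x) powr (p - 1)) * (u x powr (1 - 1 / p) * u x powr (1 / p))"
        using True by (simp add: g_def)
      then have "norm (T f x) * (g x * u x powr (1 / p)) = norm (T f x) powr p * u x" unfolding 1 2 .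
      then show ?thesis using True g0[of x] by (simp add: ennreal_mult[symmetric])
    qed (simp add: g_def)
    \<comment> \<open>Local integrability of u and the cut at height k make X finite, so half of it
      can be subtracted.\<close>
    have Xfin: "X < \<infinity>"
    proof -
      have "compact (dstar L ?q0 :: (real^'n) set)" by (simp add: dstar_def Let_def)
      from weight_integrable[OF u this] have "(\<integral>\<^sup>+x. ennreal (norm (indicator (dstar L ?q0) x *\<^sub>R u x)) \<partial>lebesgue) < \<infinity>"
        unfolding integrable_iff_bounded by blast
      then have "ennreal (k powr p) * (\<integral>\<^sup>+x. ennreal (norm (indicator (dstar L ?q0) x *\<^sub>R u x)) \<partial>lebesgue) < \<infinity>"
        by (simp add: ennreal_mult_less_top)
      moreover have "X \<le> (\<integral>\<^sup>+x. ennreal (k powr p) * ennreal (norm (indicator (dstar L ?q0) x *\<^sub>R u x)) \<partial>lebesgue)"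
        unfolding X_def
      proof (rule nn_integral_mono)
        fix x
        show "ennreal (norm (T f x) powr p * u x) * indicator Z x \<le> ennreal (k powr p) * ennreal (norm (indicator (dstar L ?q0) x *\<^sub>R u x))"
        proof (cases "x \<in> Z")
          case True
          then have "x \<in> dstar L ?q0" "norm (T f x) \<le> k" using dcube_subset_dstar[OF L, of ?q0] by (auto simp: Z_def)
          moreover from this have "norm (T f x) powr p * u x \<le> k powr p * u x"
            using u0[of x] p by (intro mult_right_mono powr_mono2) auto
          ultimately show ?thesis using True u0[of x] by (simp add: ennreal_mult[symmetric] ennreal_leI)
        qed simp
      qed
      moreover have "(\<integral>\<^sup>+x. ennreal (k powr p) * ennreal (norm (indicator (dstar L ?q0) x *\<^sub>R u x)) \<partial>lebesgue)
        = ennreal (k powr p) * (\<integral>\<^sup>+x. ennreal (norm (indicator (dstar L ?q0) x *\<^sub>R u x)) \<partial>lebesgue)"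
        by (rule nn_integral_cmult) measurable
      ultimately show ?thesis by (simp add: order_le_less_trans)
    qed
    let ?M1 = "orlicz_max L ?\<Phi> (\<lambda>x. ennreal (h x))" and ?M2 = "orlicz_max L ?\<Psi> (\<lambda>x. ennreal (g x))"
    have M[measurable]: "?M1 \<in> borel_measurable lebesgue" "?M2 \<in> borel_measurable lebesgue" by (intro orlicz_max_measurable L)+
    have Hyp: "(\<integral>\<^sup>+y\<in>dstar L q. ennreal (norm (f y)) \<partial>lebesgue) * (\<integral>\<^sup>+y\<in>?D q. ennreal (g y * u y powr (1 / p)) \<partial>lebesgue)
       \<le> ennreal Bc * (emeasure lebesgue (?D q))\<^sup>2 * (?M1 x * ?M2 x)" if x: "x \<in> ?D q" for q x
    proof -
      let ?Q = "dstar L q :: (real^'n) set"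
      have s: "0 < dside L q" using L by (rule dside_pos)
      have Qe: "emeasure lebesgue ?Q = ennreal D * emeasure lebesgue (?D q)"
        unfolding emeasure_dstar[OF L] emeasure_dcube[OF L] D_def power_mult_distrib[of _ "dside L q"]
        using s by (intro ennreal_mult) auto
      have Q: "?Q \<in> sets lebesgue" "0 < emeasure lebesgue ?Q" "emeasure lebesgue ?Q < \<infinity>"
        unfolding emeasure_dstar[OF L] using s by (auto simp: add_nonneg_pos)
      have "(\<integral>\<^sup>+y\<in>?D q. ennreal (g y * u y powr (1 / p)) \<partial>lebesgue) \<le> (\<integral>\<^sup>+y\<in>?Q. ennreal (g y * u y powr (1 / p)) \<partial>lebesgue)"
        using dcube_subset_dstar[OF L, of q] by (intro nn_integral_mono) (auto simp: indicator_def)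
      then have "(\<integral>\<^sup>+y\<in>?Q. ennreal (norm (f y)) \<partial>lebesgue) * (\<integral>\<^sup>+y\<in>?D q. ennreal (g y * u y powr (1 / p)) \<partial>lebesgue)
        \<le> (\<integral>\<^sup>+y\<in>?Q. ennreal (norm (f y)) \<partial>lebesgue) * (\<integral>\<^sup>+y\<in>?Q. ennreal (g y * u y powr (1 / p)) \<partial>lebesgue)"
        by (rule mult_left_mono) simp
      also have "\<dots> \<le> ennreal (4 * (4 * K + 1)) * (emeasure lebesgue ?Q)\<^sup>2 *
         (luxemburg_avg ?\<Phi> ?Q (\<lambda>x. ennreal (norm (f x) * v x powr (1 / p))) * luxemburg_avg ?\<Psi> ?Q (\<lambda>x. ennreal (g x)))"
        by (rule bump_holder[OF A B K(1) Q um vm gm fm g0 K(2)[OF dstar_in_cubes[OF L]]])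
      also have "\<dots> \<le> ennreal (4 * (4 * K + 1)) * (emeasure lebesgue ?Q)\<^sup>2 * (?M1 x * ?M2 x)"
        unfolding h_def[symmetric] by (intro mult_left_mono mult_mono luxemburg_le_orlicz_max x) auto
      also have "ennreal (4 * (4 * K + 1)) * (emeasure lebesgue ?Q)\<^sup>2 = (ennreal (4 * (4 * K + 1)) * (ennreal D)\<^sup>2) * (emeasure lebesgue (?D q))\<^sup>2"
        unfolding Qe by (simp only: power_mult_distrib mult.assoc)
      also have "ennreal (4 * (4 * K + 1)) * (ennreal D)\<^sup>2 = ennreal Bc"
        unfolding Bc_def using K(1) D by (simp add: ennreal_mult ennreal_power)
      finally show ?thesis .
    qed
    have "X = (\<integral>\<^sup>+x\<in>?D ?q0. ennreal (norm (T f x)) * ennreal (g x * u x powr (1 / p)) \<partial>lebesgue)"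
      unfolding X_def gw by (intro nn_integral_cong) (auto simp: Z_def indicator_def)
    also have "\<dots> \<le> ennreal (2 * step_const * Bc) * (\<integral>\<^sup>+x\<in>?D ?q0. ?M1 x * ?M2 x \<partial>lebesgue)"
    proof -
      have "(\<integral>\<^sup>+x\<in>?D ?q0. ennreal (norm (T (\<lambda>y. indicator (dstar L ?q0) y * f y) x)) * ennreal (g x * u x powr (1 / p)) \<partial>lebesgue)
        \<le> ennreal (2 * step_const * Bc) * (\<integral>\<^sup>+x\<in>?D ?q0. ?M1 x * ?M2 x \<partial>lebesgue)"
        by (rule local_bound[OF L f _ _ Bc Hyp]) auto
      then show ?thesis unfolding fs[symmetric] .
    qed
    also have "\<dots> \<le> ennreal \<kappa> * (\<integral>\<^sup>+x. ennreal c * epow p (?M1 x) + ennreal e * epow ?p' (?M2 x) \<partial>lebesgue)"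
    proof -
      have "?M1 x * ?M2 x * indicator (?D ?q0) x \<le> ennreal c * epow p (?M1 x) + ennreal e * epow ?p' (?M2 x)" for x
        using c(2)[of "?M1 x" "?M2 x"] by (auto simp: indicator_def)
      then show ?thesis unfolding \<kappa>_def by (intro mult_left_mono nn_integral_mono) auto
    qed
    also have "(\<integral>\<^sup>+x. ennreal c * epow p (?M1 x) + ennreal e * epow ?p' (?M2 x) \<partial>lebesgue)
       = ennreal c * (\<integral>\<^sup>+x. epow p (?M1 x) \<partial>lebesgue) + ennreal e * (\<integral>\<^sup>+x. epow ?p' (?M2 x) \<partial>lebesgue)"
    proof -
      have [measurable]: "(\<lambda>x. epow r (m x)) \<in> borel_measurable lebesgue" if [measurable]: "m \<in> borel_measurable lebesgue" for r and m :: "real^'n \<Rightarrow> ennreal"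
        unfolding epow_def by measurable
      show ?thesis by (subst nn_integral_add, measurable, subst (1 2) nn_integral_cmult) auto
    qed
    also have "ennreal \<kappa> * \<dots> \<le> ennreal \<kappa> * (ennreal c * (ennreal C\<Phi> * (\<integral>\<^sup>+x. ennreal (h x powr p) \<partial>lebesgue))
        + ennreal e * (ennreal C\<Psi> * (\<integral>\<^sup>+x. ennreal (g x powr ?p') \<partial>lebesgue)))"
      by (intro mult_left_mono add_mono C\<Phi>(2) C\<Psi>(2) L hm gm g0 h0) auto
    also have "(\<integral>\<^sup>+x. ennreal (g x powr ?p') \<partial>lebesgue) = X" unfolding gp X_def ..
    finally have XX: "X \<le> ennreal \<kappa> * (ennreal c * (ennreal C\<Phi> * (\<integral>\<^sup>+x. ennreal (h x powr p) \<partial>lebesgue)) + ennreal e * (ennreal C\<Psi> * X))" .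
    define E where "E = (\<integral>\<^sup>+x. ennreal (h x powr p) \<partial>lebesgue)"
    have "X \<le> ennreal C * E"
    proof (cases "E = \<infinity>")
      case True
      show ?thesis
      \<comment> \<open>Since 0 times infinity is 0 in \<open>ennreal\<close>, the claim for C = 0
        is X = 0; here the first term of \<open>XX\<close> vanishes and absorption gives X <=
        X/2.\<close>
      proof (cases "C = 0")
        case True
        then have z: "ennreal \<kappa> * (ennreal c * (ennreal C\<Phi> * E)) = 0" using c by (auto simp: C_def)
        obtain x where x: "X = ennreal x" "0 \<le> x" using Xfin by (cases X) auto
        have "X \<le> ennreal \<kappa> * (ennreal e * (ennreal C\<Psi> * X))" using XX z unfolding E_def[symmetric] distrib_left by simp
        also have "\<dots> = ennreal (\<kappa> * (e * C\<Psi>) * x)" using x \<kappa> e C\<Psi>(1) by (simp add: ennreal_mult mult.assoc)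
        finally have "x \<le> \<kappa> * (e * C\<Psi>) * x" using x \<kappa> e C\<Psi>(1) by simp
        also have "\<dots> \<le> 1 / 2 * x" using e(2) x(2) by (rule mult_right_mono)
        finally show ?thesis using x by simp
      next
        case False
        then show ?thesis using \<open>E = \<infinity>\<close> C by (simp add: ennreal_mult_top)
      qed
    next
      case False
      then obtain y where y: "E = ennreal y" "0 \<le> y" by (cases E) auto
      obtain x where x: "X = ennreal x" "0 \<le> x" using Xfin by (cases X) auto
      have "ennreal x \<le> ennreal (\<kappa> * (c * (C\<Phi> * y) + e * (C\<Psi> * x)))"
        using XX unfolding E_def[symmetric] x(1) y(1) using x(2) y(2) \<kappa> c(1) e(1) C\<Phi>(1) C\<Psi>(1) by (simp add: ennreal_mult ennreal_plus)
      then have "x \<le> \<kappa> * (c * (C\<Phi> * y) + e * (C\<Psi> * x))"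
        using x(2) y(2) \<kappa> c(1) e(1) C\<Phi>(1) C\<Psi>(1) by simp
      also have "\<dots> = \<kappa> * (c * C\<Phi>) * y + \<kappa> * (e * C\<Psi>) * x" by (simp add: algebra_simps)
      also have "\<dots> \<le> \<kappa> * (c * C\<Phi>) * y + 1 / 2 * x" using e(2) x(2) by (intro add_left_mono mult_right_mono)
      finally have "x \<le> C * y" by (simp add: C_def)
      then show ?thesis unfolding x(1) y(1) using C y(2) by (simp add: ennreal_mult[symmetric] ennreal_leI)
    qed
    then show ?thesis unfolding X_def E_def hp Z_def .
  qed
  show ?thesis by (intro exI[of _ C] conjI C allI impI main)
qed


text \<open>f is cut to growing cubes. The remainders tend to 0 in square norm, hence so do their
  images, and along a subsequence these vanish almost everywhere; Fatou then passes the local bounds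
  to T f.\<close>

lemma two_weight:
  fixes u v :: "real^'n \<Rightarrow> real"
  assumes p: "1 < p" and A: "young_function A" and B: "young_function B"
    and BA: "Bp_condition (p / (p - 1)) (complementary A)" and BB: "Bp_condition p (complementary B)"
    and u: "weight u" and v: "weight v"
    and bump: "(SUP Q\<in>cubes. luxemburg_avg A Q (\<lambda>x. ennreal (u x powr (1 / p))) *
                       luxemburg_avg B Q (\<lambda>x. inverse (ennreal (v x powr (1 / p))))) < \<infinity>"
  shows "\<exists>C\<ge>0. \<forall>f. in_L2 f \<longrightarrow>
    (\<integral>\<^sup>+x. ennreal (norm (T f x) powr p * u x) \<partial>lebesgue) \<le> ennreal C * (\<integral>\<^sup>+x. ennreal (norm (f x) powr p * v x) \<partial>lebesgue)"
proof -
  obtain C where C: "0 \<le> C" and loc: "\<And>L f k. 0 < L \<Longrightarrow> in_L2 f \<Longrightarrow> f = (\<lambda>y. indicator (dstar L (0, \<lambda>_. 0)) y * f y) \<Longrightarrow> 0 \<le> k \<Longrightarrow>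
    (\<integral>\<^sup>+x\<in>dcube L (0, \<lambda>_. 0) \<inter> {x. norm (T f x) \<le> k}. ennreal (norm (T f x) powr p * u x) \<partial>lebesgue)
      \<le> ennreal C * (\<integral>\<^sup>+x. ennreal (norm (f x) powr p * v x) \<partial>lebesgue)"
    using two_weight_local[OF p A B BA BB u v bump] by blast
  have um[measurable]: "u \<in> borel_measurable lebesgue" by (rule weight_measurable[OF u])
  have u0: "0 \<le> u x" and v0: "0 \<le> v x" for x using u v by (auto intro: weight_nonneg)
  have "(\<integral>\<^sup>+x. ennreal (norm (T f x) powr p * u x) \<partial>lebesgue) \<le> ennreal C * (\<integral>\<^sup>+x. ennreal (norm (f x) powr p * v x) \<partial>lebesgue)"
    if f: "in_L2 f" for f
  proof -
    let ?q0 = "(0, \<lambda>_. 0) :: nat \<times> ('n \<Rightarrow> int)"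
    define S :: "nat \<Rightarrow> (real^'n) set" where "S k = cbox (\<chi> i. - (real k + 1)) (\<chi> i. real k + 1)" for k
    have S_iff: "x \<in> S k \<longleftrightarrow> (\<forall>i. \<bar>x $ i\<bar> \<le> real k + 1)" for x k
      unfolding S_def mem_box_cart vec_lambda_beta by (intro iff_allI) linarith
    have Sm[measurable]: "S k \<in> sets lebesgue" for k by (simp add: S_def)
    define L where "L k = 2 * (real k + 1)" for k :: nat
    have L: "0 < L k" for k by (simp add: L_def)
    have Lh: "L k / 2 = real k + 1" "- L k / 2 = - (real k + 1)" for k by (simp_all add: L_def field_simps)
    define fk where "fk k x = indicator (S k) x * f x" for k x
    define rk where "rk k x = indicator (- S k) x * f x" for k x
    have [measurable]: "f \<in> borel_measurable lebesgue" using f by (rule in_L2_meas)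
    have L2: "in_L2 (fk k)" "in_L2 (rk k)" for k
      unfolding fk_def rk_def by (intro in_L2_indicator f Sm lebesgue_Compl)+
    have m[measurable]: "T f \<in> borel_measurable lebesgue" "T (fk k) \<in> borel_measurable lebesgue" "T (rk k) \<in> borel_measurable lebesgue" for k
      using T_meas[OF f] T_meas[OF L2(1)] T_meas[OF L2(2)] by blast+
    have f_eq: "f = (\<lambda>x. fk k x + rk k x)" for k by (auto simp: fk_def rk_def indicator_def fun_eq_iff)
    have add: "AE x in lebesgue. \<forall>k. T f x = T (fk k) x + T (rk k) x"
      unfolding AE_all_countable
    proof
      fix k
      have "AE x in lebesgue. T (\<lambda>x. fk k x + rk k x) x = T (fk k) x + T (rk k) x" by (rule T_add[OF L2])
      then show "AE x in lebesgue. T f x = T (fk k) x + T (rk k) x" unfolding f_eq[of k, symmetric] .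
    qed
    have lim: "(\<lambda>k. L2_sq (rk k)) \<longlonglongrightarrow> 0"
    proof -
      have "(\<lambda>k. \<integral>\<^sup>+x. ennreal ((norm (rk k x))\<^sup>2) \<partial>lebesgue) \<longlonglongrightarrow> (\<integral>\<^sup>+x. 0 \<partial>(lebesgue :: (real^'n) measure))"
      proof (rule nn_integral_dominated_convergence[where w = "\<lambda>x. ennreal ((norm (f x))\<^sup>2)"])
        show "(\<integral>\<^sup>+x. ennreal ((norm (f x))\<^sup>2) \<partial>lebesgue) < \<infinity>" using f by (simp add: in_L2_iff L2_sq_def)
        show "AE x in lebesgue. (\<lambda>k. ennreal ((norm (rk k x))\<^sup>2)) \<longlonglongrightarrow> 0"
        proof (rule AE_I2)
          fix x :: "real^'n"
          obtain k0 :: nat where k0: "norm x \<le> real k0" using real_arch_simple by blast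
          have "x \<in> S k" if k: "k0 \<le> k" for k
            unfolding S_iff
          proof
            fix i
            have "real k0 \<le> real k" using k by simp
            then show "\<bar>x $ i\<bar> \<le> real k + 1" using component_le_norm_cart[of x i] k0 by linarith
          qed
          then show "(\<lambda>k. ennreal ((norm (rk k x))\<^sup>2)) \<longlonglongrightarrow> 0"
            by (intro tendsto_eventually eventually_sequentiallyI[of k0]) (simp add: rk_def)
        qed
      qed (auto simp: rk_def indicator_def)
      then show ?thesis by (simp add: L2_sq_def)
    qed
    have "(\<lambda>k. ennreal cT * L2_sq (rk k)) \<longlonglongrightarrow> ennreal cT * 0" by (intro ennreal_tendsto_cmult lim) simp
    then have lim0: "(\<lambda>k. ennreal cT * L2_sq (rk k)) \<longlonglongrightarrow> 0" by simp
    have limT: "(\<lambda>k. L2_sq (T (rk k))) \<longlonglongrightarrow> 0"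
      by (rule tendsto_sandwich[OF _ _ tendsto_const lim0]) (auto intro!: always_eventually T_bound L2)
    have Ti: "integrable lebesgue (\<lambda>x. (norm (T (rk k) x))\<^sup>2)" for k
      using T_L2[OF L2(2)[of k]] by (simp add: integrable_iff_bounded in_L2_iff L2_sq_def)
    have "(\<integral>x. norm ((norm (T (rk k) x))\<^sup>2) \<partial>lebesgue) = enn2real (L2_sq (T (rk k)))" for k
      unfolding L2_sq_def by (subst integral_eq_nn_integral) auto
    moreover have "(\<lambda>k. enn2real (L2_sq (T (rk k)))) \<longlonglongrightarrow> enn2real 0"
      using limT by (intro tendsto_enn2real) auto
    ultimately have "(\<lambda>k. \<integral>x. norm ((norm (T (rk k) x))\<^sup>2) \<partial>lebesgue) \<longlonglongrightarrow> 0" by simp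
    \<comment> \<open>Convergence in square norm gives pointwise convergence only along a
      subsequence, which is enough for Fatou.\<close>
    from tendsto_L1_AE_subseq[OF Ti this] obtain r where r: "strict_mono r"
      and rlim: "AE x in lebesgue. (\<lambda>n. (norm (T (rk (r n)) x))\<^sup>2) \<longlonglongrightarrow> 0" by blast
    define Z where "Z k = dcube (L k) ?q0 \<inter> {x. norm (T (fk k) x) \<le> real k + 1}" for k
    have Zm[measurable]: "Z k \<in> sets lebesgue" for k
    proof -
      have "{x. norm (T (fk k) x) \<le> real k + 1} \<in> sets lebesgue"
        using measurable_sets[of "\<lambda>x. norm (T (fk k) x)" lebesgue borel "{..real k + 1}"] by (simp add: vimage_def)
      then show ?thesis unfolding Z_def using L by simp
    qed
    define \<phi> where "\<phi> k x = ennreal (norm (T (fk k) x) powr p * u x) * indicator (Z k) x" for k x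
    have bound: "(\<integral>\<^sup>+x. \<phi> k x \<partial>lebesgue) \<le> ennreal C * (\<integral>\<^sup>+x. ennreal (norm (f x) powr p * v x) \<partial>lebesgue)" for k
    proof -
      have "(\<integral>\<^sup>+x. \<phi> k x \<partial>lebesgue) \<le> ennreal C * (\<integral>\<^sup>+x. ennreal (norm (fk k x) powr p * v x) \<partial>lebesgue)"
        unfolding \<phi>_def Z_def
      proof (rule loc[OF L L2(1)])
        have "x \<in> dstar (L k) ?q0" if "x \<in> S k" for x
          by (rule root_dstar[OF L]) (use that in \<open>simp only: S_iff Lh\<close>)
        then show "fk k = (\<lambda>y. indicator (dstar (L k) ?q0) y * fk k y)"
          by (auto simp: fk_def indicator_def fun_eq_iff)
      qed simp
      also have "\<dots> \<le> ennreal C * (\<integral>\<^sup>+x. ennreal (norm (f x) powr p * v x) \<partial>lebesgue)"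
        using v0 by (intro mult_left_mono nn_integral_mono ennreal_leI) (auto simp: fk_def indicator_def)
      finally show ?thesis .
    qed
    have "AE x in lebesgue. ennreal (norm (T f x) powr p * u x) \<le> liminf (\<lambda>n. \<phi> (r n) x)"
      using add rlim
    proof eventually_elim
      case (elim x)
      have "(\<lambda>n. sqrt ((norm (T (rk (r n)) x))\<^sup>2)) \<longlonglongrightarrow> sqrt 0" by (rule tendsto_real_sqrt) (rule elim)
      then have "(\<lambda>n. T (rk (r n)) x) \<longlonglongrightarrow> 0" by (simp add: tendsto_norm_zero_iff)
      then have "(\<lambda>n. T f x - T (rk (r n)) x) \<longlonglongrightarrow> T f x - 0" by (intro tendsto_diff tendsto_const)
      moreover have "T f x - T (rk k) x = T (fk k) x" for k
        using elim(1) by (metis add_diff_cancel_right')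
      ultimately have lf: "(\<lambda>n. T (fk (r n)) x) \<longlonglongrightarrow> T f x" by simp
      have "(\<lambda>n. ennreal (norm (T (fk (r n)) x) powr p * u x)) \<longlonglongrightarrow> ennreal (norm (T f x) powr p * u x)"
        using p by (intro tendsto_ennrealI tendsto_mult tendsto_const tendsto_powr' tendsto_norm lf) auto
      \<comment> \<open>The root cube and the truncation height grow together, so x eventually lies
        in the former and the convergent values T (fk) x eventually stay below the latter.\<close>
      moreover have "eventually (\<lambda>n. x \<in> Z (r n)) sequentially"
      proof -
        obtain n0 :: nat where n0: "norm x + norm (T f x) + 1 \<le> real n0" using real_arch_simple by blast
        have "eventually (\<lambda>n. norm (T (fk (r n)) x) < norm (T f x) + 1) sequentially"
          using order_tendstoD(2)[OF tendsto_norm[OF lf], of "norm (T f x) + 1"] by simp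
        moreover have "eventually (\<lambda>n. n0 \<le> n) sequentially" by (rule eventually_ge_at_top)
        ultimately show ?thesis
        proof eventually_elim
          case (elim n)
          have "n \<le> r n" using r by (rule seq_suble)
          then have rn: "real n0 \<le> real (r n)" using elim(2) by simp
          have "\<bar>x $ i\<bar> < real (r n) + 1" for i
          proof -
            have "\<bar>x $ i\<bar> \<le> norm x" by (rule component_le_norm_cart)
            also have "\<dots> < real (r n) + 1" using n0 rn norm_ge_zero[of "T f x"] by linarith
            finally show ?thesis .
          qed
          then have "x \<in> dcube (L (r n)) ?q0"
            unfolding root_dcube[OF L] Lh by (auto simp only: abs_less_iff minus_less_iff less_imp_le)
          moreover have "norm (T (fk (r n)) x) \<le> real (r n) + 1" using elim(1) n0 rn norm_ge_zero[of x] by linarith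
          ultimately show ?case by (simp add: Z_def)
        qed
      qed
      then have "eventually (\<lambda>n. ennreal (norm (T (fk (r n)) x) powr p * u x) = \<phi> (r n) x) sequentially"
        by eventually_elim (simp add: \<phi>_def)
      ultimately have "(\<lambda>n. \<phi> (r n) x) \<longlonglongrightarrow> ennreal (norm (T f x) powr p * u x)"
        by (rule Lim_transform_eventually)
      then show ?case by (simp add: lim_imp_Liminf)
    qed
    then have "(\<integral>\<^sup>+x. ennreal (norm (T f x) powr p * u x) \<partial>lebesgue) \<le> (\<integral>\<^sup>+x. liminf (\<lambda>n. \<phi> (r n) x) \<partial>lebesgue)"
      by (rule nn_integral_mono_AE)
    also have "\<dots> \<le> liminf (\<lambda>n. \<integral>\<^sup>+x. \<phi> (r n) x \<partial>lebesgue)"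
      by (rule nn_integral_liminf) (simp add: \<phi>_def)
    also have "\<dots> \<le> ennreal C * (\<integral>\<^sup>+x. ennreal (norm (f x) powr p * v x) \<partial>lebesgue)"
      by (rule Liminf_le) (use bound in auto)
    finally show ?thesis .
  qed
  with C show ?thesis by blast
qed

end

section \<open>Passage from the definitions to the locale, and conclusion\<close>

lemma calderon_zygmund_czo:
  fixes T :: "(real^'n \<Rightarrow> complex) \<Rightarrow> (real^'n \<Rightarrow> complex)"
  assumes "calderon_zygmund_operator T"
  shows "\<exists>K cK \<delta> cT. czo T K cK \<delta> cT"
proof -
  obtain K where T: "L2_bounded_operator T" and K: "standard_kernel K" and ker: "has_kernel T K"
    using assms by (auto simp: calderon_zygmund_operator_def)
  obtain c \<delta> where size: "\<And>x y. x \<noteq> y \<Longrightarrow> norm (K x y) \<le> c / norm (x - y) ^ CARD('n)" and \<delta>: "0 < \<delta>"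
    and smooth: "\<And>x x' y. norm (x - x') < norm (x - y) / 2 \<Longrightarrow> norm (K x y - K x' y) + norm (K y x - K y x')
            \<le> c * (norm (x - x') powr \<delta> / norm (x - y) powr (real CARD('n) + \<delta>))"
    using K unfolding standard_kernel_def by blast
  obtain C where C: "\<And>f. in_L2 f \<Longrightarrow> Lp_norm 2 (\<lambda>_. 1) (T f) \<le> ennreal C * Lp_norm 2 (\<lambda>_. 1) f"
    using T by (auto simp: L2_bounded_operator_def)
  have T_L2: "in_L2 (T f)" if "in_L2 f" for f using T that by (auto simp: L2_bounded_operator_def)
  \<comment> \<open>The given constants carry no sign; enlarging them provides the signs demanded by
    \<open>czo\<close>.\<close>
  define c' where "c' = max c 1"
  have c': "0 < c'" "c \<le> c'" by (auto simp: c'_def)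
  define C' where "C' = max C 0"
  have C': "0 \<le> C'" "ennreal C = ennreal C'" by (auto simp: C'_def max_def ennreal_neg)
  have smooth': "norm (K x y - K x' y) + norm (K y x - K y x') \<le> c' * (dist x x' powr \<delta> / dist x y powr (real CARD('n) + \<delta>))"
    if "dist x x' < dist x y / 2" for x x' y
  proof -
    have "norm (K x y - K x' y) + norm (K y x - K y x') \<le> c * (dist x x' powr \<delta> / dist x y powr (real CARD('n) + \<delta>))"
      using smooth[of x x' y] that by (simp add: dist_norm)
    also have "\<dots> \<le> c' * (dist x x' powr \<delta> / dist x y powr (real CARD('n) + \<delta>))"
      using c' by (intro mult_right_mono) auto
    finally show ?thesis .
  qed
  have "czo T K c' \<delta> (C'\<^sup>2)"
  proof
    show "in_L2 (T f)" if "in_L2 f" for f using that by (rule T_L2)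
    show "AE x in lebesgue. T (\<lambda>y. f y + g y) x = T f x + T g x" if "in_L2 f" "in_L2 g" for f g
      using T that by (auto simp: L2_bounded_operator_def)
    show "L2_sq (T f) \<le> ennreal (C'\<^sup>2) * L2_sq f" if f: "in_L2 f" for f
    proof -
      obtain a where a: "L2_sq f = ennreal a" "0 \<le> a" using f by (cases "L2_sq f") (auto simp: in_L2_iff)
      obtain b where b: "L2_sq (T f) = ennreal b" "0 \<le> b" using T_L2[OF f] by (cases "L2_sq (T f)") (auto simp: in_L2_iff)
      have "ennreal (sqrt b) \<le> ennreal C' * ennreal (sqrt a)"
        using C[OF f] a b unfolding Lp_norm_2 C'(2) by simp
      then have "sqrt b \<le> C' * sqrt a" using C'(1) a(2) by (simp add: ennreal_mult[symmetric])
      then have "(sqrt b)\<^sup>2 \<le> (C' * sqrt a)\<^sup>2" using b(2) by (intro power_mono) auto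
      then have "b \<le> C'\<^sup>2 * a" using a(2) b(2) by (simp add: power_mult_distrib)
      then show ?thesis unfolding a(1) b(1) using a(2) by (simp add: ennreal_mult[symmetric] ennreal_leI)
    qed
    show "norm (K x y) \<le> c' / dist x y ^ CARD('n)" if "x \<noteq> y" for x y
    proof -
      have "norm (K x y) \<le> c / dist x y ^ CARD('n)" using size[OF that] by (simp add: dist_norm)
      also have "\<dots> \<le> c' / dist x y ^ CARD('n)" using c' by (intro divide_right_mono) auto
      finally show ?thesis .
    qed
    show "norm (K x y - K x' y) \<le> c' * (dist x x' powr \<delta> / dist x y powr (real CARD('n) + \<delta>))"
      if "dist x x' < dist x y / 2" for x x' y
      using smooth'[OF that] norm_ge_zero[of "K y x - K y x'"] by linarith
    show "norm (K y x - K y x') \<le> c' * (dist x x' powr \<delta> / dist x y powr (real CARD('n) + \<delta>))"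
      if "dist x x' < dist x y / 2" for x x' y
      using smooth'[OF that] norm_ge_zero[of "K x y - K x' y"] by linarith
  qed (use c' \<delta> ker in auto)
  then show ?thesis by blast
qed

theorem mainTheorem4:
  fixes T :: "(real^'n \<Rightarrow> complex) \<Rightarrow> (real^'n \<Rightarrow> complex)"
    and p :: real
    and A B :: "ennreal \<Rightarrow> ennreal"
    and u v :: "real^'n \<Rightarrow> real"
  assumes "calderon_zygmund_operator T"
    and "1 < p"
    and "young_function A" and "young_function B"
    and "Bp_condition (p / (p - 1)) (complementary A)"
    and "Bp_condition p (complementary B)"
    and "weight u" and "weight v"
    and "(SUP Q\<in>cubes. luxemburg_avg A Q (\<lambda>x. ennreal (u x powr (1 / p))) *
                       luxemburg_avg B Q (\<lambda>x. inverse (ennreal (v x powr (1 / p))))) < \<infinity>"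
  shows "\<exists>c::real. 0 < c \<and> (\<forall>f. in_L2 f \<longrightarrow> Lp_norm p u (T f) \<le> ennreal c * Lp_norm p v f)"
proof -
  obtain K cK \<delta> cT where "czo T K cK \<delta> cT" using calderon_zygmund_czo[OF assms(1)] by blast
  then interpret czo T K cK \<delta> cT .
  obtain C where C: "0 \<le> C" "\<And>f. in_L2 f \<Longrightarrow>
    (\<integral>\<^sup>+x. ennreal (norm (T f x) powr p * u x) \<partial>lebesgue) \<le> ennreal C * (\<integral>\<^sup>+x. ennreal (norm (f x) powr p * v x) \<partial>lebesgue)"
    using two_weight[OF assms(2-)] by blast
  \<comment> \<open>The p-th root converts the integral inequality to norms. Adding 1 makes c
    positive, which also settles the case of infinite right-hand norm.\<close>
  define c where "c = (C + 1) powr (1 / p)"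
  have c: "0 < c" using C(1) by (simp add: c_def)
  have "Lp_norm p u (T f) \<le> ennreal c * Lp_norm p v f" if f: "in_L2 f" for f
  proof (cases "(\<integral>\<^sup>+x. ennreal (norm (f x) powr p * v x) \<partial>lebesgue) = \<infinity>")
    case True
    then have "Lp_norm p v f = \<infinity>" by (simp add: Lp_norm_def)
    then show ?thesis using c by (simp add: ennreal_mult_top)
  next
    case False
    then obtain e where e: "(\<integral>\<^sup>+x. ennreal (norm (f x) powr p * v x) \<partial>lebesgue) = ennreal e" "0 \<le> e"
      by (cases "\<integral>\<^sup>+x. ennreal (norm (f x) powr p * v x) \<partial>lebesgue") auto
    have le: "(\<integral>\<^sup>+x. ennreal (norm (T f x) powr p * u x) \<partial>lebesgue) \<le> ennreal (C * e)"
      using C(2)[OF f] C(1) e by (simp add: ennreal_mult)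
    then obtain i where i: "(\<integral>\<^sup>+x. ennreal (norm (T f x) powr p * u x) \<partial>lebesgue) = ennreal i" "0 \<le> i"
      by (cases "\<integral>\<^sup>+x. ennreal (norm (T f x) powr p * u x) \<partial>lebesgue") (auto simp: top_unique)
    have "i \<le> C * e" using le C(1) e(2) unfolding i(1) by simp
    also have "\<dots> \<le> (C + 1) * e" using e(2) by (intro mult_right_mono) auto
    finally have "i powr (1 / p) \<le> ((C + 1) * e) powr (1 / p)" using i(2) assms(2) by (intro powr_mono2) auto
    also have "\<dots> = c * e powr (1 / p)" by (simp add: c_def powr_mult)
    finally show ?thesis using i e c by (simp add: Lp_norm_def ennreal_mult[symmetric] ennreal_leI)
  qed
  with c show ?thesis by blast
qed

end
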